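(* Let $n\ge 2$, let $\mathcal{O}$ be a bounded convex domain in $\mathbb{R}^n$ with smooth boundary $\partial\mathcal{O}$, and let $p,q\in\mathbb{R}^n\setminus\overline{\mathcal{O}}$ be such that the line segment $l_{pq}$ joining $p$ to $q$ satisfies $l_{pq}\cap\mathcal{O}\neq\emptyset$. Then any minimizer of $E$ over $\mathcal{A}$ consists of a geodesic on $\partial\mathcal{O}$ that connects the two vision boundaries $\Gamma_p$ and $\Gamma_q$, together with two line segments connecting the points $p$ and $q$ to the vision boundaries $\Gamma_p$ and $\Gamma_q$, respectively (the segments joining $p$ and $q$ to the endpoints of the geodesic lying on $\Gamma_p$ and $\Gamma_q$).
   Context: Let $I=[0,1]$ and $\mathcal{O}^c=\mathbb{R}^n\setminus\mathcal{O}$. The energy is $E(\mathbf{u})=\int_I|\mathbf{u}'(t)|^2\,dt$. The admissible set is $$\mathcal{A}=\{\mathbf{u}\in H^1(I,\mathbb{R}^n) : \mathbf{u}(0)=p,\ \mathbf{u}(1)=q,\ \mathbf{u}(t)\in\mathcal{O}^c\text{ for all }t\in I\},$$ where $H^1$ is the Sobolev space of vector-valued functions (identified with their continuous representatives). A minimizer is an element $\mathbf{u}\in\mathcal{A}$ with $E(\mathbf{u})=\inf_{\mathbf{v}\in\mathcal{A}}E(\mathbf{v})$. For a point $p\in\mathbb{R}^n\setminus\overline{\mathcal{O}}$, the vision cone $\mathcal{C}_p$ of $p$ (relative to $\mathcal{O}$) is the cone with apex $p$ that is tangent to $\mathcal{O}$, i.e. the union of the rays from $p$ that meet $\overline{\mathcal{O}}$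 but do not meet $\mathcal{O}$. The vision boundary of $p$ is $\Gamma_p=\mathcal{C}_p\cap\partial\mathcal{O}$. Geodesics on $\partial\mathcal{O}$ are with respect to the Riemannian metric induced from $\mathbb{R}^n$. *)

theory Defs
  imports "HOL-Analysis.Analysis"
begin

text \<open>
  Differentiability of order \<open>k\<close> on \<open>S\<close>, with derivatives taken within \<open>S\<close>. It is used for open
  \<open>S\<close> and for nondegenerate compact intervals of the real line (one-sided derivatives at the end
  points); in both cases the derivative \<open>f'\<close> is uniquely determined on \<open>S\<close>.
\<close>

primrec Ck_on :: "nat \<Rightarrow> 'a::real_normed_vector set \<Rightarrow> ('a \<Rightarrow> 'b::real_normed_vector) \<Rightarrow> bool" where
  "Ck_on 0 S f \<longleftrightarrow> continuous_on S f"
| "Ck_on (Suc k) S f \<longleftrightarrow>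
     (\<exists>f'. (\<forall>x\<in>S. (f has_derivative f' x) (at x within S)) \<and> (\<forall>v. Ck_on k S (\<lambda>x. f' x v)))"

definition smooth_on :: "'a::real_normed_vector set \<Rightarrow> ('a \<Rightarrow> 'b::real_normed_vector) \<Rightarrow> bool" where
  "smooth_on S f \<longleftrightarrow> (\<forall>k. Ck_on k S f)"

text \<open>
  The boundary is locally the regular zero set of a smooth function that is negative exactly
  on the domain. For open \<open>\<Omega>\<close> this entails \<open>frontier \<Omega> \<inter> U = {y \<in> U. \<rho> y = 0}\<close>.
\<close>

definition smooth_boundary :: "(real ^ 'n) set \<Rightarrow> bool" where
  "smooth_boundary \<Omega> \<longleftrightarrow>
     (\<forall>x\<in>frontier \<Omega>. \<exists>U (\<rho> :: real ^ 'n \<Rightarrow> real).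
        open U \<and> x \<in> U \<and> smooth_on U \<rho> \<and>
        (\<forall>y\<in>U. \<exists>v. frechet_derivative \<rho> (at y) v \<noteq> 0) \<and>
        \<Omega> \<inter> U = {y \<in> U. \<rho> y < 0})"

definition test_function :: "(real \<Rightarrow> real) \<Rightarrow> bool" where
  "test_function \<phi> \<longleftrightarrow> smooth_on UNIV \<phi> \<and> closure {t. \<phi> t \<noteq> 0} \<subseteq> {0<..<1}"

definition L2_I :: "(real \<Rightarrow> real ^ 'n) \<Rightarrow> bool" where
  "L2_I g \<longleftrightarrow> set_borel_measurable lborel {0..1} g \<and>
     set_integrable lborel {0..1} (\<lambda>t. (norm (g t))\<^sup>2)"

definition is_weak_derivative :: "(real \<Rightarrow> real ^ 'n) \<Rightarrow> (real \<Rightarrow> real ^ 'n) \<Rightarrow> bool" where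
  "is_weak_derivative u g \<longleftrightarrow>
     (\<forall>\<phi>. test_function \<phi> \<longrightarrow>
        (LINT t:{0..1}|lborel. deriv \<phi> t *\<^sub>R u t) = - (LINT t:{0..1}|lborel. \<phi> t *\<^sub>R g t))"

text \<open>
  \<open>H\<^sup>1([0,1], \<real>\<^sup>n)\<close>, each class being given by its continuous representative. Values outside
  \<open>[0,1]\<close> are irrelevant here and in everything that follows.
\<close>

definition H1_I :: "(real \<Rightarrow> real ^ 'n) set" where
  "H1_I = {u. continuous_on {0..1} u \<and> (\<exists>g. L2_I g \<and> is_weak_derivative u g)}"

text \<open>The weak derivative is unique up to null sets, so the choice does not affect \<open>energy\<close>.\<close>

definition weak_derivative :: "(real \<Rightarrow> real ^ 'n) \<Rightarrow> real \<Rightarrow> real ^ 'n" where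
  "weak_derivative u = (SOME g. L2_I g \<and> is_weak_derivative u g)"

definition energy :: "(real \<Rightarrow> real ^ 'n) \<Rightarrow> real" where
  "energy u = (LINT t:{0..1}|lborel. (norm (weak_derivative u t))\<^sup>2)"

definition admissible :: "(real ^ 'n) set \<Rightarrow> real ^ 'n \<Rightarrow> real ^ 'n \<Rightarrow> (real \<Rightarrow> real ^ 'n) set" where
  "admissible \<Omega> p q = {u \<in> H1_I. u 0 = p \<and> u 1 = q \<and> (\<forall>t\<in>{0..1}. u t \<in> - \<Omega>)}"

definition is_minimizer :: "(real ^ 'n) set \<Rightarrow> real ^ 'n \<Rightarrow> real ^ 'n \<Rightarrow> (real \<Rightarrow> real ^ 'n) \<Rightarrow> bool" where
  "is_minimizer \<Omega> p q u \<longleftrightarrow>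
     u \<in> admissible \<Omega> p q \<and> energy u = (INF v \<in> admissible \<Omega> p q. energy v)"

definition ray :: "real ^ 'n \<Rightarrow> real ^ 'n \<Rightarrow> (real ^ 'n) set" where
  "ray p v = {p + s *\<^sub>R v | s. 0 \<le> s}"

definition vision_cone :: "(real ^ 'n) set \<Rightarrow> real ^ 'n \<Rightarrow> (real ^ 'n) set" where
  "vision_cone \<Omega> p =
     \<Union> {ray p v | v. v \<noteq> 0 \<and> ray p v \<inter> closure \<Omega> \<noteq> {} \<and> ray p v \<inter> \<Omega> = {}}"

definition vision_boundary :: "(real ^ 'n) set \<Rightarrow> real ^ 'n \<Rightarrow> (real ^ 'n) set" where
  "vision_boundary \<Omega> p = vision_cone \<Omega> p \<inter> frontier \<Omega>"

definition tangent_space_at :: "(real ^ 'n) set \<Rightarrow> real ^ 'n \<Rightarrow> (real ^ 'n) set" where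
  "tangent_space_at M x =
     {v. \<exists>e>0. \<exists>c. smooth_on {-e<..<e} c \<and> (\<forall>s\<in>{-e<..<e}. c s \<in> M) \<and> c 0 = x \<and>
           (c has_vector_derivative v) (at 0)}"

text \<open>
  The covariant derivative along a curve in a submanifold \<open>M\<close> of \<open>\<real>\<^sup>n\<close>, for the metric induced on
  \<open>M\<close>, is the tangential part of the ordinary derivative. Hence the geodesic equation says that
  the acceleration is normal to \<open>M\<close>.
\<close>

definition geodesic_on :: "(real ^ 'n) set \<Rightarrow> real \<Rightarrow> real \<Rightarrow> (real \<Rightarrow> real ^ 'n) \<Rightarrow> bool" where
  "geodesic_on M a b c \<longleftrightarrow>
     a < b \<and> smooth_on {a..b} c \<and> (\<forall>t\<in>{a..b}. c t \<in> M) \<and>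
     (\<forall>t\<in>{a..b}. \<forall>v\<in>tangent_space_at M (c t).
        vector_derivative (\<lambda>s. vector_derivative c (at s within {a..b})) (at t within {a..b}) \<bullet> v = 0)"

end

theory Submission imports Defs begin

text \<open>
  Write \<open>g\<close> for the weak derivative of a minimizer \<open>u\<close> and \<open>K\<close> for the closure of the convex
  obstacle \<open>\<Omega>\<close>. Everything is extracted from two kinds of variations, both carried by
  piecewise linear hat functions \<open>\<eta>\<close>.

  Pushing away from a point \<open>z \<in> K\<close>, that is replacing \<open>u\<close> by \<open>u + \<epsilon> \<eta> (u - z)\<close>, never enters
  \<open>\<Omega>\<close>: otherwise \<open>u t\<close> would lie on a segment from a point of \<open>\<Omega>\<close> to a point of \<open>K\<close>, hence in
  \<open>\<Omega>\<close>. The first variation then says that \<open>\<bar>u\<bar>\<^sup>2 / 2 - u \<bullet> z\<close> minus the double primitive of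
  \<open>\<bar>g\<bar>\<^sup>2\<close> is a concave function of time (\<open>potential_concave\<close>). Where \<open>u\<close> stays off \<open>K\<close>, every small
  displacement is allowed, and \<open>u\<close> is affine there (\<open>free_affine\<close>).

  Concave functions have one-sided derivatives. Subtracting two of the potentials, for \<open>z\<close> and \<open>z'\<close>
  in \<open>\<Omega>\<close>, leaves \<open>u \<bullet> (z' - z)\<close>, so \<open>u\<close> has one-sided derivatives as well. At a contact point
  concavity forces the jump of the velocity to point along the inward normal, while staying outside
  \<open>\<Omega>\<close> forces it to point outwards; so there is no jump, and the velocity is tangent to the
  boundary (\<open>contact_velocity\<close>). A differentiable concave function has a continuous derivative, and
  therefore \<open>u\<close> is continuously differentiable on \<open>(0, 1)\<close>.

  Let \<open>a\<close> and \<open>b\<close> be the first and the last contact time. Off \<open>[a, b]\<close> the curve is straight, and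
  tangency at \<open>a\<close> and \<open>b\<close> puts the contact points on the vision boundaries. Between them the curve
  cannot leave the boundary, since a straight piece with both ends in the convex set \<open>K\<close> lies in
  \<open>K\<close>. If \<open>a = b\<close>, both segments would be part of one tangent line, which misses \<open>\<Omega>\<close>.

  It remains to see that \<open>u\<close> is a smooth geodesic on \<open>[a, b]\<close>. The monotone derivatives of the
  potentials bound the difference quotients \<open>D\<close> of the velocity: \<open>D \<bullet> (u s - z)\<close> is at most \<open>o(1)\<close>
  for all \<open>z \<in> K\<close>. Because the boundary is differentiable, the directions \<open>z - u s\<close> with \<open>z \<in> \<Omega>\<close>
  fill, up to positive factors, the whole open half-space below the tangent plane, and therefore the tangential part of \<open>D\<close>
  tends to \<open>0\<close>. The normal part converges because the velocity is orthogonal to the gradient \<open>N\<close> of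
  a local defining function (\<open>velocity_has_derivative_on_contact\<close>). This gives
  \<open>u'' = - ((u' \<bullet> (N \<circ> u)') / (N \<bullet> N)) N\<close>, an equation that makes the acceleration normal and
  through which smoothness of \<open>N\<close> raises the regularity of \<open>u\<close> one order at a time.

  The Sobolev side rests on two facts: a continuous function with a weak derivative \<open>g\<close> is a
  primitive of \<open>g\<close> (\<open>weak_derivative_has_density\<close>), and primitives are closed under products
  (\<open>has_density_prod\<close>).
\<close>

section \<open>Calculus of the classes C^k\<close>

lemma Ck_on_cong:
  assumes "\<And>x. x \<in> S \<Longrightarrow> f x = g x" and "Ck_on k S f"
  shows "Ck_on k S g"
proof (cases k)
  case 0
  then show ?thesis using assms continuous_on_cong[of S S f g] by simp
next
  case (Suc j)
  then obtain f' where f': "\<forall>x\<in>S. (f has_derivative f' x) (at x within S)" "\<forall>v. Ck_on j S (\<lambda>x. f' x v)"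
    using assms(2) by auto
  have "\<forall>x\<in>S. (g has_derivative f' x) (at x within S)"
    using f'(1) assms(1) has_derivative_transform by metis
  then show ?thesis using f'(2) Suc by auto
qed

lemma Ck_on_Suc_D: "Ck_on (Suc k) S f \<Longrightarrow> Ck_on k S f"
proof (induction k arbitrary: f)
  case 0
  then show ?case
    by (auto simp: continuous_on_eq_continuous_within intro: has_derivative_continuous)
next
  case (Suc k)
  then obtain f' where f': "\<forall>x\<in>S. (f has_derivative f' x) (at x within S)" "\<forall>v. Ck_on (Suc k) S (\<lambda>x. f' x v)"
    by auto
  have "\<forall>v. Ck_on k S (\<lambda>x. f' x v)"
    using Suc.IH f'(2) by blast
  then show ?case using f'(1) by auto
qed

lemma Ck_on_const: "Ck_on k S (\<lambda>x. c)"
proof (induction k arbitrary: c)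
  case (Suc k)
  have "Ck_on k S (\<lambda>x. 0 :: 'b)" using Suc .
  then show ?case by (auto intro!: exI[of _ "\<lambda>x v. 0"])
qed simp

lemma Ck_on_bounded_linear:
  assumes "bounded_linear L" and "Ck_on k S f"
  shows "Ck_on k S (\<lambda>x. L (f x))"
  using assms(2)
proof (induction k arbitrary: f)
  case 0
  then show ?case using bounded_linear.continuous_on[OF assms(1)] by auto
next
  case (Suc k)
  then obtain f' where f': "\<forall>x\<in>S. (f has_derivative f' x) (at x within S)" "\<forall>v. Ck_on k S (\<lambda>x. f' x v)"
    by auto
  show ?case
    using f' Suc.IH
    by (auto intro!: exI[of _ "\<lambda>x v. L (f' x v)"] bounded_linear.has_derivative[OF assms(1)])
qed

lemma Ck_on_add: "Ck_on k S f \<Longrightarrow> Ck_on k S g \<Longrightarrow> Ck_on k S (\<lambda>x. f x + g x)"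
proof (induction k arbitrary: f g)
  case 0
  then show ?case by (simp add: continuous_on_add)
next
  case (Suc k)
  then obtain f' g' where
    "\<forall>x\<in>S. (f has_derivative f' x) (at x within S)" "\<forall>v. Ck_on k S (\<lambda>x. f' x v)"
    "\<forall>x\<in>S. (g has_derivative g' x) (at x within S)" "\<forall>v. Ck_on k S (\<lambda>x. g' x v)"
    by auto
  then show ?case using Suc.IH
    by (auto intro!: exI[of _ "\<lambda>x v. f' x v + g' x v"] has_derivative_add)
qed

lemma Ck_on_sum: "(\<And>i. i \<in> A \<Longrightarrow> Ck_on k S (f i)) \<Longrightarrow> Ck_on k S (\<lambda>x. \<Sum>i\<in>A. f i x)"
  by (induction A rule: infinite_finite_induct) (auto simp: Ck_on_const Ck_on_add)

lemma Ck_on_scaleR: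
  fixes f :: "'a::real_normed_vector \<Rightarrow> real"
  shows "Ck_on k S f \<Longrightarrow> Ck_on k S g \<Longrightarrow> Ck_on k S (\<lambda>x. f x *\<^sub>R g x)"
proof (induction k arbitrary: f g)
  case 0
  then show ?case by (simp add: continuous_on_scaleR)
next
  case (Suc k)
  then obtain f' g' where
    *: "\<forall>x\<in>S. (f has_derivative f' x) (at x within S)" "\<forall>v. Ck_on k S (\<lambda>x. f' x v)"
    "\<forall>x\<in>S. (g has_derivative g' x) (at x within S)" "\<forall>v. Ck_on k S (\<lambda>x. g' x v)"
    by auto
  have "Ck_on k S f" "Ck_on k S g"
    using Suc.prems Ck_on_Suc_D by blast+
  then have "\<forall>v. Ck_on k S (\<lambda>x. f x *\<^sub>R g' x v + f' x v *\<^sub>R g x)"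
    using *(2,4) by (intro allI Ck_on_add Suc.IH) auto
  then show ?case using *(1,3)
    by (auto intro!: exI[of _ "\<lambda>x v. f x *\<^sub>R g' x v + f' x v *\<^sub>R g x"] has_derivative_scaleR)
qed

lemma Ck_on_mult:
  fixes f g :: "'a::real_normed_vector \<Rightarrow> real"
  shows "Ck_on k S f \<Longrightarrow> Ck_on k S g \<Longrightarrow> Ck_on k S (\<lambda>x. f x * g x)"
  using Ck_on_scaleR[of k S f g] by simp

lemma Ck_on_compose:
  fixes \<psi> :: "'a::euclidean_space \<Rightarrow> 'b::real_normed_vector"
  assumes "c ` S \<subseteq> U"
  shows "Ck_on k U \<psi> \<Longrightarrow> Ck_on k S c \<Longrightarrow> Ck_on k S (\<lambda>x. \<psi> (c x))"
proof (induction k arbitrary: \<psi>)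
  case 0
  then show ?case using assms continuous_on_compose2 by force
next
  case (Suc k)
  then obtain \<psi>' c' where
    *: "\<forall>x\<in>U. (\<psi> has_derivative \<psi>' x) (at x within U)" "\<forall>v. Ck_on k U (\<lambda>x. \<psi>' x v)"
    "\<forall>x\<in>S. (c has_derivative c' x) (at x within S)" "\<forall>v. Ck_on k S (\<lambda>x. c' x v)"
    by auto
  have ck: "Ck_on k S c" using Suc.prems Ck_on_Suc_D by blast
  have D: "((\<lambda>x. \<psi> (c x)) has_derivative (\<lambda>v. \<psi>' (c x) (c' x v))) (at x within S)" if "x \<in> S" for x
    by (rule has_derivative_in_compose2[of U]) (use * assms that in auto)
  have "Ck_on k S (\<lambda>x. \<psi>' (c x) (c' x v))" for v
  proof (rule Ck_on_cong)
    show "Ck_on k S (\<lambda>x. \<Sum>i\<in>Basis. (c' x v \<bullet> i) *\<^sub>R \<psi>' (c x) i)"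
    proof (intro Ck_on_sum Ck_on_scaleR)
      fix i :: 'a
      show "Ck_on k S (\<lambda>x. c' x v \<bullet> i)"
        using Ck_on_bounded_linear[OF bounded_linear_inner_left] *(4) by blast
      show "Ck_on k S (\<lambda>x. \<psi>' (c x) i)"
        using Suc.IH[OF _ ck] *(2) by blast
    qed
    fix x assume "x \<in> S"
    then have "c x \<in> U" using assms by auto
    then have "bounded_linear (\<psi>' (c x))" using *(1) has_derivative_bounded_linear by blast
    then interpret bounded_linear "\<psi>' (c x)" .
    have "\<psi>' (c x) (c' x v) = \<psi>' (c x) (\<Sum>i\<in>Basis. (c' x v \<bullet> i) *\<^sub>R i)"
      by (simp add: euclidean_representation)
    also have "\<dots> = (\<Sum>i\<in>Basis. (c' x v \<bullet> i) *\<^sub>R \<psi>' (c x) i)"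
      by (simp add: sum scaleR)
    finally show "(\<Sum>i\<in>Basis. (c' x v \<bullet> i) *\<^sub>R \<psi>' (c x) i) = \<psi>' (c x) (c' x v)" ..
  qed
  then show ?case using D by (auto intro!: exI[of _ "\<lambda>x v. \<psi>' (c x) (c' x v)"])
qed

lemma Ck_on_inverse:
  fixes f :: "'a::real_normed_vector \<Rightarrow> real"
  assumes "\<And>x. x \<in> S \<Longrightarrow> f x \<noteq> 0"
  shows "Ck_on k S f \<Longrightarrow> Ck_on k S (\<lambda>x. inverse (f x))"
proof (induction k)
  case 0
  then show ?case using assms by (simp add: continuous_on_inverse)
next
  case (Suc k)
  then obtain f' where
    *: "\<forall>x\<in>S. (f has_derivative f' x) (at x within S)" "\<forall>v. Ck_on k S (\<lambda>x. f' x v)"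
    by auto
  have i: "Ck_on k S (\<lambda>x. inverse (f x))" using Suc Ck_on_Suc_D by blast
  have "Ck_on k S (\<lambda>x. - (inverse (f x) * f' x v * inverse (f x)))" for v
    by (rule Ck_on_bounded_linear[OF bounded_linear_minus[OF bounded_linear_ident]])
       (intro Ck_on_mult i *(2)[rule_format])
  moreover have "\<forall>x\<in>S. ((\<lambda>x. inverse (f x)) has_derivative
      (\<lambda>v. - (inverse (f x) * f' x v * inverse (f x)))) (at x within S)"
    using * assms by (auto intro!: has_derivative_inverse)
  ultimately show ?case
    by (auto intro!: exI[of _ "\<lambda>x v. - (inverse (f x) * f' x v * inverse (f x))"])
qed

lemma Ck_on_vector_derivativeI:
  assumes "\<And>t. t \<in> S \<Longrightarrow> (f has_vector_derivative f' t) (at t within S)" and "Ck_on k S f'"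
  shows "Ck_on (Suc k) S f"
  using assms Ck_on_bounded_linear[OF bounded_linear_scaleR_right assms(2)]
  by (auto simp: has_vector_derivative_def intro!: exI[of _ "\<lambda>t v. v *\<^sub>R f' t"])

lemma Ck_on_Suc_vector_derivativeE:
  fixes f :: "real \<Rightarrow> 'b::real_normed_vector"
  assumes "Ck_on (Suc k) S f"
  obtains f' where "\<And>t. t \<in> S \<Longrightarrow> (f has_vector_derivative f' t) (at t within S)" and "Ck_on k S f'"
proof -
  obtain f' where f': "\<forall>x\<in>S. (f has_derivative f' x) (at x within S)" "\<forall>v. Ck_on k S (\<lambda>x. f' x v)"
    using assms by auto
  show ?thesis
  proof
    show "Ck_on k S (\<lambda>t. f' t 1)" using f'(2) by blast
    fix t assume "t \<in> S"
    then have "(f has_derivative f' t) (at t within S)" using f' by blast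
    moreover have "f' t = (\<lambda>v. v *\<^sub>R f' t 1)"
    proof
      fix v
      have "linear (f' t)"
        using calculation has_derivative_bounded_linear bounded_linear.linear by blast
      from linear_cmul[OF this, of v 1] show "f' t v = v *\<^sub>R f' t 1" by simp
    qed
    ultimately show "(f has_vector_derivative f' t 1) (at t within S)"
      unfolding has_vector_derivative_def by simp
  qed
qed

text \<open>
  Derivatives within an interval are unique, so the local derivatives agree with one globally defined
  function.
\<close>

lemma Ck_on_interval_local:
  fixes f :: "real \<Rightarrow> 'b::euclidean_space"
  assumes "a < b"
    and "\<And>t. t \<in> {a..b} \<Longrightarrow> \<exists>T. open T \<and> t \<in> T \<and> Ck_on k ({a..b} \<inter> T) f"
  shows "Ck_on k {a..b} f"
  using assms(2)
proof (induction k arbitrary: f)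
  case 0
  have "continuous (at t within {a..b}) f" if t: "t \<in> {a..b}" for t
  proof -
    obtain T where T: "open T" "t \<in> T" "continuous_on ({a..b} \<inter> T) f" using 0 t by auto
    then have "continuous (at t within {a..b} \<inter> T) f"
      using t by (simp add: continuous_on_eq_continuous_within)
    moreover have "at t within {a..b} \<inter> T = at t within {a..b}"
      using at_within_nhd[of t T "{a..b} \<inter> T" "{a..b}"] T by auto
    ultimately show ?thesis by simp
  qed
  then show ?case by (simp add: continuous_on_eq_continuous_within)
next
  case (Suc k)
  define f' where "f' t = vector_derivative f (at t within {a..b})" for t
  have *: "\<exists>T. open T \<and> t \<in> T \<and> Ck_on k ({a..b} \<inter> T) f' \<and>
     (f has_vector_derivative f' t) (at t within {a..b})" if t: "t \<in> {a..b}" for t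
  proof -
    obtain T where T: "open T" "t \<in> T" "Ck_on (Suc k) ({a..b} \<inter> T) f" using Suc.prems t by blast
    then obtain h where h: "\<And>s. s \<in> {a..b} \<inter> T \<Longrightarrow> (f has_vector_derivative h s) (at s within {a..b} \<inter> T)"
      "Ck_on k ({a..b} \<inter> T) h"
      using Ck_on_Suc_vector_derivativeE by blast
    have h1: "(f has_vector_derivative h s) (at s within {a..b})" if "s \<in> {a..b} \<inter> T" for s
    proof -
      have "at s within {a..b} \<inter> T = at s within {a..b}"
        using that T(1) at_within_nhd[of s T "{a..b} \<inter> T" "{a..b}"] by auto
      then show ?thesis using h(1)[OF that] by simp
    qed
    have h2: "h s = f' s" if "s \<in> {a..b} \<inter> T" for s
      unfolding f'_def using vector_derivative_within_closed_interval[of a b s f "h s"] \<open>a < b\<close> h1[OF that] that by auto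
    show ?thesis
      using T h1 h2 t Ck_on_cong[OF h2 h(2)] by (intro exI[of _ T]) auto
  qed
  show ?case
  proof (rule Ck_on_vector_derivativeI)
    show "Ck_on k {a..b} f'"
    proof (rule Suc.IH)
      fix t assume "t \<in> {a..b}"
      from *[OF this] show "\<exists>T. open T \<and> t \<in> T \<and> Ck_on k ({a..b} \<inter> T) f'" by metis
    qed
    fix t assume "t \<in> {a..b}"
    from *[OF this] show "(f has_vector_derivative f' t) (at t within {a..b})" by metis
  qed
qed

section \<open>Smooth bumps\<close>

text \<open>
  The functions \<open>p (1 / x) exp (- 1 / x)\<close>, extended by \<open>0\<close>, form a class that is closed under
  differentiation; this makes all of them smooth. The factor \<open>[:0, 0, 1:]\<close> in the derivative comes
  from the inner derivative of \<open>1 / x\<close>.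
\<close>

definition poly_exp_cutoff :: "real poly \<Rightarrow> real \<Rightarrow> real" where
  "poly_exp_cutoff p x = (if x > 0 then poly p (1 / x) * exp (- (1 / x)) else 0)"

lemma poly_times_exp_minus_tendsto_0: "((\<lambda>y::real. poly p y * exp (- y)) \<longlongrightarrow> 0) at_top"
proof -
  have "((\<lambda>y::real. \<Sum>i\<le>degree p. coeff p i * (y ^ i / exp y)) \<longlongrightarrow> (\<Sum>i\<le>degree p. coeff p i * 0)) at_top"
    by (intro tendsto_sum tendsto_mult tendsto_const tendsto_power_div_exp_0)
  then show ?thesis
    by (simp add: poly_altdef exp_minus sum_distrib_right divide_inverse mult.assoc)
qed

lemma poly_exp_cutoff_has_derivative:
  "(poly_exp_cutoff p has_real_derivative
     poly_exp_cutoff ([:0, 0, 1:] * (p - pderiv p)) x) (at x)"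
proof (cases x "0 :: real" rule: linorder_cases)
  case less
  have "((\<lambda>x. 0) has_real_derivative 0) (at x)" by simp
  moreover have "eventually (\<lambda>y. 0 = poly_exp_cutoff p y) (nhds x)"
    using eventually_nhds_in_open[of "{..<0}" x] less
    by (auto simp: poly_exp_cutoff_def elim!: eventually_mono)
  ultimately have "(poly_exp_cutoff p has_real_derivative 0) (at x)"
    using DERIV_cong_ev[OF refl _ refl, of "\<lambda>x. 0" "poly_exp_cutoff p" x 0] by simp
  then show ?thesis using less by (simp add: poly_exp_cutoff_def)
next
  case greater
  have "((\<lambda>x. poly p (1 / x) * exp (- (1 / x))) has_real_derivative
      poly_exp_cutoff ([:0, 0, 1:] * (p - pderiv p)) x) (at x)"
    using greater
    by (auto intro!: derivative_eq_intros DERIV_chain2[of "poly p"] poly_DERIV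
        simp: poly_exp_cutoff_def field_simps power2_eq_square)
  moreover have "eventually (\<lambda>y. poly p (1 / y) * exp (- (1 / y)) = poly_exp_cutoff p y) (nhds x)"
    using eventually_nhds_in_open[of "{0<..}" x] greater
    by (auto simp: poly_exp_cutoff_def elim!: eventually_mono)
  ultimately show ?thesis
    using DERIV_cong_ev[OF refl _ refl, of "\<lambda>x. poly p (1 / x) * exp (- (1 / x))" "poly_exp_cutoff p" x] by blast
next
  case equal
  have "((\<lambda>h. poly_exp_cutoff p h / h) \<longlongrightarrow> 0) (at_right 0)"
  proof -
    have "((\<lambda>h. poly ([:0, 1:] * p) (inverse h) * exp (- inverse h)) \<longlongrightarrow> 0) (at_right (0::real))"
      using filterlim_compose[OF poly_times_exp_minus_tendsto_0 filterlim_inverse_at_top_right] .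
    then show ?thesis
    proof (rule Lim_transform_eventually)
      show "\<forall>\<^sub>F h in at_right 0. poly ([:0, 1:] * p) (inverse h) * exp (- inverse h) = poly_exp_cutoff p h / h"
        by (auto simp: eventually_at_filter poly_exp_cutoff_def field_simps)
    qed
  qed
  moreover have "((\<lambda>h. poly_exp_cutoff p h / h) \<longlongrightarrow> 0) (at_left 0)"
    by (rule Lim_transform_eventually[of "\<lambda>h. 0"])
       (auto simp: eventually_at_filter poly_exp_cutoff_def)
  ultimately have "((\<lambda>h. poly_exp_cutoff p h / h) \<longlongrightarrow> 0) (at 0)"
    by (simp add: filterlim_split_at)
  then show ?thesis
    using equal by (simp add: DERIV_def poly_exp_cutoff_def)
qed

lemma Ck_on_poly_exp_cutoff: "Ck_on k UNIV (poly_exp_cutoff p)"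
proof (induction k arbitrary: p)
  case 0
  have "isCont (poly_exp_cutoff p) x" for x
    using poly_exp_cutoff_has_derivative DERIV_isCont by blast
  then show ?case by (simp add: continuous_at_imp_continuous_on)
next
  case (Suc k)
  show ?case
    by (rule Ck_on_vector_derivativeI)
       (use Suc poly_exp_cutoff_has_derivative in
         \<open>auto simp: has_real_derivative_iff_has_vector_derivative[symmetric]\<close>)
qed

text \<open>A smooth function that is positive exactly on \<open>(0, 1)\<close>.\<close>

definition bump :: "real \<Rightarrow> real" where
  "bump x = poly_exp_cutoff 1 x * poly_exp_cutoff 1 (1 - x)"

lemma Ck_on_bump: "Ck_on k UNIV bump"
proof -
  have "Ck_on k UNIV (\<lambda>x::real. 1 - x)"
  proof -
    have "Ck_on k UNIV (\<lambda>x::real. x)"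
      by (induction k) (auto intro!: exI[of _ "\<lambda>x v. v"] Ck_on_const)
    from Ck_on_add[OF Ck_on_const Ck_on_bounded_linear[OF bounded_linear_minus[OF bounded_linear_ident] this]]
    show ?thesis by simp
  qed
  from Ck_on_compose[OF _ Ck_on_poly_exp_cutoff this] show ?thesis
    unfolding bump_def[abs_def] by (intro Ck_on_mult Ck_on_poly_exp_cutoff) auto
qed

lemma bump_pos: "0 < x \<Longrightarrow> x < 1 \<Longrightarrow> 0 < bump x"
  and bump_zero: "x \<le> 0 \<or> 1 \<le> x \<Longrightarrow> bump x = 0"
  by (auto simp: bump_def poly_exp_cutoff_def)

lemma bump_nonneg: "0 \<le> bump x"
  by (auto simp: bump_def poly_exp_cutoff_def)

lemma continuous_on_bump: "continuous_on S bump"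
  using Ck_on_bump[of 0] continuous_on_subset by auto

text \<open>
  A smooth step: the primitive is constant on both sides of \<open>[0, 1]\<close>, so that differences of two
  translates of it have compact support.
\<close>

lemma bump_antiderivative:
  obtains S m where "\<And>x. (S has_real_derivative bump x) (at x)"
    and "\<And>x. x \<le> 0 \<Longrightarrow> S x = 0" and "\<And>x. 1 \<le> x \<Longrightarrow> S x = m"
proof
  define S where "S x = integral {-1..x} bump" for x
  have int: "bump integrable_on {a..b}" for a b
    by (intro integrable_continuous_real continuous_on_bump)
  show S0: "S x = 0" if "x \<le> 0" for x
    unfolding S_def by (rule integral_unique[OF has_integral_is_0]) (use that bump_zero in auto)
  show "S x = S 1" if "1 \<le> x" for x
  proof -
    have "integral {1..x} bump = 0"
      by (rule integral_unique[OF has_integral_is_0]) (use bump_zero in auto)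
    then show ?thesis
      unfolding S_def using Henstock_Kurzweil_Integration.integral_combine[of "-1" 1 x bump] int that by simp
  qed
  show "(S has_real_derivative bump x) (at x)" for x
  proof (cases "x < 0")
    case True
    have "eventually (\<lambda>y. 0 = S y) (nhds x)"
      using eventually_nhds_in_open[of "{..<0}" x] True by (auto simp: S0 elim!: eventually_mono)
    then show ?thesis
      using DERIV_cong_ev[OF refl _ refl, of "\<lambda>x. 0" S x 0] True by (simp add: bump_zero)
  next
    case False
    have "(S has_real_derivative bump x) (at x within {-1..x+1})"
      unfolding S_def by (rule integral_has_real_derivative[OF continuous_on_bump]) (use False in auto)
    then show ?thesis using False by (subst (asm) at_within_interior) auto
  qed
qed

section \<open>Absolutely continuous functions on the unit interval\<close>

text \<open>
  Absolute continuity with a prescribed almost everywhere derivative. Carrying the density along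
  turns the product rule and integration by parts into statements about integrals.
\<close>

definition has_density :: "(real \<Rightarrow> 'a::euclidean_space) \<Rightarrow> (real \<Rightarrow> 'a) \<Rightarrow> bool" where
  "has_density F f \<longleftrightarrow> set_integrable lborel {0..1} f \<and>
     (\<forall>t\<in>{0..1}. (LINT s:{0..t}|lborel. f s) = F t - F 0)"

lemma set_integrable_Icc_subset:
  fixes f :: "real \<Rightarrow> 'a::euclidean_space"
  assumes "set_integrable lborel {0..1} f" and "0 \<le> s" "t \<le> (1::real)"
  shows "set_integrable lborel {s..t} f"
  by (rule set_integrable_subset[OF assms(1)]) (use assms in auto)

lemma LINT_Icc_split:
  fixes f :: "real \<Rightarrow> 'a::euclidean_space"
  assumes "set_integrable lborel {0..1} f" and "0 \<le> r" "r \<le> s" "s \<le> t" "t \<le> 1"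
  shows "(LINT x:{r..t}|lborel. f x) = (LINT x:{r..s}|lborel. f x) + (LINT x:{s..t}|lborel. f x)"
proof -
  have "set_integrable lborel {r..t} f" "set_integrable lborel {r..s} f" "set_integrable lborel {s..t} f"
    using assms by (auto intro: set_integrable_Icc_subset)
  from this[THEN set_borel_integral_eq_integral(2)] this[THEN set_borel_integral_eq_integral(1)]
  show ?thesis
    using Henstock_Kurzweil_Integration.integral_combine[of r s t f] assms by simp
qed

lemma has_density_increment:
  assumes "has_density F f" and "0 \<le> s" "s \<le> t" "t \<le> 1"
  shows "F t - F s = (LINT x:{s..t}|lborel. f x)"
proof -
  have "(LINT x:{0..t}|lborel. f x) = F t - F 0" "(LINT x:{0..s}|lborel. f x) = F s - F 0"
    "set_integrable lborel {0..1} f"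
    using assms unfolding has_density_def by auto
  then show ?thesis
    using LINT_Icc_split[of f 0 s t] assms(2-4) by (simp add: algebra_simps)
qed

lemma has_density_continuous_on:
  assumes "has_density F f"
  shows "continuous_on {0..1} F"
proof -
  have int: "set_integrable lborel {0..1} f" using assms unfolding has_density_def by blast
  have "continuous_on {0..1} (\<lambda>t. F 0 + integral {0..t} f)"
    by (intro continuous_intros indefinite_integral_continuous_1 set_borel_integral_eq_integral(1) int)
  moreover have "F 0 + integral {0..t} f = F t" if t: "t \<in> {0..1}" for t
  proof -
    have "(LINT s:{0..t}|lborel. f s) = F t - F 0"
      using assms t unfolding has_density_def by blast
    moreover have "(LINT s:{0..t}|lborel. f s) = integral {0..t} f"
      by (rule set_borel_integral_eq_integral(2)[OF set_integrable_Icc_subset[OF int]]) (use t in auto)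
    ultimately have "integral {0..t} f = F t - F 0" by (rule trans[OF sym, rotated])
    then show ?thesis by simp
  qed
  ultimately show ?thesis by (subst (asm) continuous_on_cong) auto
qed

lemma has_density_add:
  assumes "has_density F f" "has_density G g"
  shows "has_density (\<lambda>t. F t + G t) (\<lambda>t. f t + g t)"
  unfolding has_density_def
proof (intro conjI ballI)
  have *: "set_integrable lborel {0..1} f" "set_integrable lborel {0..1} g"
    using assms unfolding has_density_def by auto
  then show "set_integrable lborel {0..1} (\<lambda>t. f t + g t)" by simp
  fix t :: real assume t: "t \<in> {0..1}"
  then have "(LINT s:{0..t}|lborel. f s + g s) = (LINT s:{0..t}|lborel. f s) + (LINT s:{0..t}|lborel. g s)"
    by (intro set_integral_add) (use * in \<open>auto intro: set_integrable_Icc_subset\<close>)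
  then show "(LINT s:{0..t}|lborel. f s + g s) = F t + G t - (F 0 + G 0)"
    using assms[unfolded has_density_def, THEN conjunct2, rule_format, OF t] by simp
qed

lemma has_density_bounded_linear:
  fixes L :: "'a::euclidean_space \<Rightarrow> 'b::euclidean_space"
  assumes "bounded_linear L" "has_density F f"
  shows "has_density (\<lambda>t. L (F t)) (\<lambda>t. L (f t))"
  unfolding has_density_def
proof (intro conjI ballI)
  interpret bounded_linear L by fact
  have *: "set_integrable lborel {0..1} f"
    using assms unfolding has_density_def by auto
  have **: "indicator A x *\<^sub>R L y = L (indicator A x *\<^sub>R y)" for A x y by (simp add: scaleR)
  show "set_integrable lborel {0..1} (\<lambda>t. L (f t))"
    using integrable_bounded_linear[OF assms(1) *[unfolded set_integrable_def]]
    unfolding set_integrable_def ** .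
  fix t :: real assume t: "t \<in> {0..1}"
  have "set_integrable lborel {0..t} f" using * t by (auto intro: set_integrable_Icc_subset)
  then have "(LINT s:{0..t}|lborel. L (f s)) = L (LINT s:{0..t}|lborel. f s)"
    unfolding set_lebesgue_integral_def set_integrable_def **
    by (intro integral_bounded_linear assms(1))
  then show "(LINT s:{0..t}|lborel. L (f s)) = L (F t) - L (F 0)"
    using assms(2)[unfolded has_density_def, THEN conjunct2, rule_format, OF t] by (simp add: diff)
qed

lemma has_density_const: "has_density (\<lambda>t. c) (\<lambda>t. 0)"
  unfolding has_density_def set_integrable_def set_lebesgue_integral_def by simp

lemma has_density_derivative:
  assumes "\<And>t. t \<in> {0..1} \<Longrightarrow> (F has_vector_derivative f t) (at t within {0..1})"
    and "continuous_on {0..1} f"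
  shows "has_density F f"
  unfolding has_density_def
proof (intro conjI ballI)
  show int: "set_integrable lborel {0..1} f"
    using assms(2) by (rule borel_integrable_atLeastAtMost')
  fix t :: real assume t: "t \<in> {0..1}"
  have "(f has_integral (F t - F 0)) {0..t}"
    using t by (intro fundamental_theorem_of_calculus)
      (auto intro: has_vector_derivative_within_subset[OF assms(1)])
  then have "integral {0..t} f = F t - F 0" by (rule integral_unique)
  then show "(LINT s:{0..t}|lborel. f s) = F t - F 0"
    using set_borel_integral_eq_integral(2)[OF set_integrable_Icc_subset[OF int, of 0 t]] t by simp
qed

lemma has_density_integral:
  assumes "set_integrable lborel {0..1} f"
  shows "has_density (\<lambda>t. LINT s:{0..t}|lborel. f s) f"
proof -
  have "(LINT s:{0..0::real}|lborel. f s) = 0"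
    using set_borel_integral_eq_integral(2)[OF set_integrable_Icc_subset[OF assms, of 0 0]] by simp
  then show ?thesis using assms unfolding has_density_def by auto
qed

lemma set_integrable_continuous_prod:
  fixes prod :: "'a::euclidean_space \<Rightarrow> 'b::euclidean_space \<Rightarrow> 'c::euclidean_space"
  assumes "bounded_bilinear prod" "continuous_on {0..1} F" "set_integrable lborel {0..1} g"
  shows "set_integrable lborel {0..1} (\<lambda>t::real. prod (F t) (g t))"
proof -
  interpret bounded_bilinear prod by fact
  obtain K where K: "\<And>a b. norm (prod a b) \<le> norm a * norm b * K" "K > 0" using pos_bounded by blast
  have "compact (F ` {0..1})" using assms(2) by (intro compact_continuous_image) auto
  then obtain B where B: "\<And>t. t \<in> {0..1} \<Longrightarrow> norm (F t) \<le> B" "B > 0"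
    using compact_imp_bounded bounded_pos by (metis imageI)
  have mF: "(\<lambda>t. indicator {0..1} t *\<^sub>R F t) \<in> borel_measurable borel"
    using borel_measurable_continuous_on_indicator[OF _ assms(2)] by simp
  have mg: "(\<lambda>t. indicator {0..1} t *\<^sub>R g t) \<in> borel_measurable borel"
    using assms(3) unfolding set_integrable_def by (simp add: borel_measurable_integrable measurable_lborel1[symmetric] del: measurable_lborel1)
  have eq: "(\<lambda>t. indicator {0..1} t *\<^sub>R prod (F t) (g t)) =
     (\<lambda>t. prod (indicator {0..1} t *\<^sub>R F t) (indicator {0..1} t *\<^sub>R g t))"
    by (auto simp: indicator_def zero_left)
  have "continuous_on UNIV (\<lambda>(x, y). prod x y)"
    by (simp add: split_beta) (intro continuous_on continuous_intros)
  then have m: "(\<lambda>t. indicator {0..1} t *\<^sub>R prod (F t) (g t)) \<in> borel_measurable lborel"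
    unfolding eq using borel_measurable_continuous_Pair[OF mF mg, of prod] by (simp add: split_beta)
  show ?thesis unfolding set_integrable_def
  proof (rule Bochner_Integration.integrable_bound[OF _ m])
    show "integrable lborel (\<lambda>t. (B * K) * norm (indicator {0..1} t *\<^sub>R g t))"
      using assms(3) unfolding set_integrable_def by (intro integrable_mult_right integrable_norm)
    show "AE t in lborel. norm (indicator {0..1} t *\<^sub>R prod (F t) (g t))
        \<le> norm (B * K * norm (indicator {0..1} t *\<^sub>R g t))"
    proof (rule AE_I2)
      fix t :: real
      show "norm (indicator {0..1} t *\<^sub>R prod (F t) (g t))
        \<le> norm (B * K * norm (indicator {0..1} t *\<^sub>R g t))"
      proof (cases "t \<in> {0..1}")
        case True
        have "norm (prod (F t) (g t)) \<le> norm (F t) * norm (g t) * K" using K by simp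
        also have "\<dots> \<le> B * norm (g t) * K"
          using B(1)[OF True] K(2) by (intro mult_right_mono) auto
        finally show ?thesis using True B(2) K(2) by (simp add: abs_mult mult_ac)
      qed simp
    qed
  qed
qed

text \<open>
  The two iterated integrals cover the triangles \<open>s \<le> r\<close> and \<open>r \<le> s\<close> of the plane, whose common
  diagonal is a null set. This is the product rule for primitives in disguise.
\<close>

lemma Fubini_triangle:
  fixes prod :: "'a::euclidean_space \<Rightarrow> 'b::euclidean_space \<Rightarrow> 'c::euclidean_space"
  assumes "bounded_bilinear prod" and f: "integrable lborel f" and g: "integrable lborel g"
  shows "(LINT r|lborel. prod (LINT s:{..r}|lborel. f s) (g r)) +
         (LINT s|lborel. prod (f s) (LINT r:{..s}|lborel. g r)) =
         prod (integral\<^sup>L lborel f) (integral\<^sup>L lborel (g :: real \<Rightarrow> 'b))"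
proof -
  interpret bounded_bilinear prod by fact
  obtain K where K: "\<And>a b. norm (prod a b) \<le> norm a * norm b * K" "K > 0" using pos_bounded by blast
  have [measurable]: "f \<in> borel_measurable borel" "g \<in> borel_measurable borel"
    using borel_measurable_integrable[OF f] borel_measurable_integrable[OF g] by simp_all
  have cont: "continuous_on UNIV (\<lambda>x. prod (fst x) (snd x))"
    by (intro continuous_on continuous_intros)
  have m: "(\<lambda>z. prod (f (fst z)) (g (snd z))) \<in> borel_measurable (lborel \<Otimes>\<^sub>M lborel)"
    by (rule borel_measurable_continuous_Pair[OF _ _ cont]) measurable
  have "integrable (lborel \<Otimes>\<^sub>M lborel) (\<lambda>z. (norm (f (fst z)) * norm (g (snd z))) * K)"
  proof (rule integrable_mult_left, rule lborel_pair.Fubini_integrable)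
    show "(\<lambda>z. norm (f (fst z)) * norm (g (snd z))) \<in> borel_measurable (lborel \<Otimes>\<^sub>M lborel)"
      by measurable
    show "integrable lborel (\<lambda>x. LBINT y. norm (norm (f (fst (x, y))) * norm (g (snd (x, y)))))"
      using f g by simp
    show "AE x in lborel. integrable lborel (\<lambda>y. norm (f (fst (x, y))) * norm (g (snd (x, y))))"
      using g by simp
  qed
  then have int: "integrable (lborel \<Otimes>\<^sub>M lborel) (\<lambda>z. prod (f (fst z)) (g (snd z)))"
    by (rule Bochner_Integration.integrable_bound[OF _ m]) (use K in \<open>auto simp: abs_mult\<close>)
  define h where "h s r = indicat_real {s..} r *\<^sub>R prod (f s) (g r)" for s r
  define k where "k s r = indicat_real {..s} r *\<^sub>R prod (f s) (g r)" for s r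
  have eqs: "(\<lambda>(s, r). h s r) = (\<lambda>z. indicat_real {z. fst z \<le> snd z} z *\<^sub>R prod (f (fst z)) (g (snd z)))"
     "(\<lambda>(s, r). k s r) = (\<lambda>z. indicat_real {z. snd z \<le> fst z} z *\<^sub>R prod (f (fst z)) (g (snd z)))"
    by (auto simp: h_def k_def indicator_def)
  have sets: "{z. fst z \<le> snd z} \<in> sets (lborel \<Otimes>\<^sub>M lborel :: (real \<times> real) measure)"
    "{z. snd z \<le> fst z} \<in> sets (lborel \<Otimes>\<^sub>M lborel :: (real \<times> real) measure)"
    unfolding lborel_prod sets_lborel
    by (intro borel_closed closed_Collect_le continuous_intros)+
  have hi: "integrable (lborel \<Otimes>\<^sub>M lborel) (\<lambda>(s, r). h s r)"
    unfolding eqs(1) by (rule integrable_mult_indicator[OF sets(1) int])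
  have ki: "integrable (lborel \<Otimes>\<^sub>M lborel) (\<lambda>(s, r). k s r)"
    unfolding eqs(2) by (rule integrable_mult_indicator[OF sets(2) int])
  have ind: "integrable lborel (\<lambda>s. indicat_real A s *\<^sub>R f s)" "integrable lborel (\<lambda>s. indicat_real A s *\<^sub>R g s)"
    if "A \<in> sets borel" for A
    using integrable_mult_indicator[of A lborel] that f g by auto
  have h1: "(LINT s|lborel. h s r) = prod (LINT s:{..r}|lborel. f s) (g r)" for r
  proof -
    have "(LINT s|lborel. h s r) = (LINT s|lborel. prod (indicat_real {..r} s *\<^sub>R f s) (g r))"
      unfolding h_def by (intro Bochner_Integration.integral_cong) (auto simp: indicator_def zero_left)
    then show ?thesis
      unfolding set_lebesgue_integral_def
      using integral_bounded_linear[OF bounded_linear_left ind(1)] by simp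
  qed
  have h2: "(LINT r|lborel. h s r) = prod (f s) (LINT r:{s..}|lborel. g r)" for s
  proof -
    have "(LINT r|lborel. h s r) = (LINT r|lborel. prod (f s) (indicat_real {s..} r *\<^sub>R g r))"
      unfolding h_def by (intro Bochner_Integration.integral_cong) (auto simp: indicator_def zero_right)
    then show ?thesis
      unfolding set_lebesgue_integral_def
      using integral_bounded_linear[OF bounded_linear_right ind(2)] by simp
  qed
  have k2: "(LINT r|lborel. k s r) = prod (f s) (LINT r:{..s}|lborel. g r)" for s
  proof -
    have "(LINT r|lborel. k s r) = (LINT r|lborel. prod (f s) (indicat_real {..s} r *\<^sub>R g r))"
      unfolding k_def by (intro Bochner_Integration.integral_cong) (auto simp: indicator_def zero_right)
    then show ?thesis
      unfolding set_lebesgue_integral_def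
      using integral_bounded_linear[OF bounded_linear_right ind(2)] by simp
  qed
  have sum: "(LINT r:{s..}|lborel. g r) + (LINT r:{..s}|lborel. g r) = integral\<^sup>L lborel g" for s
  proof -
    have "(LINT r:{s..}|lborel. g r) + (LINT r:{..s}|lborel. g r) =
       (LINT r|lborel. indicat_real {s..} r *\<^sub>R g r + indicat_real {..s} r *\<^sub>R g r)"
      unfolding set_lebesgue_integral_def
      by (rule Bochner_Integration.integral_add[symmetric]) (auto intro: ind)
    also have "\<dots> = integral\<^sup>L lborel g"
    proof (rule integral_cong_AE)
      show "AE r in lborel. indicat_real {s..} r *\<^sub>R g r + indicat_real {..s} r *\<^sub>R g r = g r"
        using AE_lborel_singleton[of s] by eventually_elim (auto simp: indicator_def)
    qed measurable
    finally show ?thesis .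
  qed
  have "(LINT r|lborel. prod (LINT s:{..r}|lborel. f s) (g r)) = (LINT s|lborel. prod (f s) (LINT r:{s..}|lborel. g r))"
    using lborel_pair.Fubini_integral[OF hi] by (simp only: h1 h2)
  moreover have "integrable lborel (\<lambda>s. prod (f s) (LINT r:{s..}|lborel. g r))"
    using lborel_pair.integrable_fst[OF hi] by (simp only: h2)
  moreover have "integrable lborel (\<lambda>s. prod (f s) (LINT r:{..s}|lborel. g r))"
    using lborel_pair.integrable_fst[OF ki] by (simp only: k2)
  ultimately have "(LINT r|lborel. prod (LINT s:{..r}|lborel. f s) (g r)) +
         (LINT s|lborel. prod (f s) (LINT r:{..s}|lborel. g r)) =
     (LINT s|lborel. prod (f s) (integral\<^sup>L lborel g))"
    by (simp add: Bochner_Integration.integral_add[symmetric] add_right[symmetric] sum)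
  also have "\<dots> = prod (integral\<^sup>L lborel f) (integral\<^sup>L lborel g)"
    by (rule integral_bounded_linear[OF bounded_linear_left f])
  finally show ?thesis .
qed

text \<open>
  On \<open>[0, t]\<close> each function is its initial value plus the primitive of its density; the product of
  the two primitives is given by the decomposition of the square \<open>[0, t]\<times>[0, t]\<close> into triangles.
\<close>

lemma has_density_prod:
  fixes prod :: "'a::euclidean_space \<Rightarrow> 'b::euclidean_space \<Rightarrow> 'c::euclidean_space"
  assumes "bounded_bilinear prod" and F: "has_density F f" and G: "has_density G g"
  shows "has_density (\<lambda>t. prod (F t) (G t)) (\<lambda>t. prod (F t) (g t) + prod (f t) (G t))"
  unfolding has_density_def
proof (intro conjI ballI)
  interpret bounded_bilinear prod by fact
  have fi: "set_integrable lborel {0..1} f" and gi: "set_integrable lborel {0..1} g"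
    using F G unfolding has_density_def by auto
  have cF: "continuous_on {0..1} F" and cG: "continuous_on {0..1} G"
    using F G has_density_continuous_on by auto
  have i1: "set_integrable lborel {0..1} (\<lambda>t. prod (F t) (g t))"
    by (rule set_integrable_continuous_prod[OF assms(1) cF gi])
  have i2: "set_integrable lborel {0..1} (\<lambda>t. prod (f t) (G t))"
    by (rule set_integrable_continuous_prod[OF bounded_bilinear.flip[OF assms(1)] cG fi])
  show "set_integrable lborel {0..1} (\<lambda>t. prod (F t) (g t) + prod (f t) (G t))"
    using i1 i2 by simp
  fix t :: real assume t: "t \<in> {0..1}"
  define f' where "f' s = indicat_real {0..t} s *\<^sub>R f s" for s
  define g' where "g' s = indicat_real {0..t} s *\<^sub>R g s" for s
  have f': "integrable lborel f'" and g': "integrable lborel g'"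
    using set_integrable_Icc_subset[OF fi, of 0 t] set_integrable_Icc_subset[OF gi, of 0 t] t
    unfolding set_integrable_def f'_def g'_def by auto
  have Ff: "(LINT s:{..r}|lborel. f' s) = F r - F 0" if "r \<in> {0..t}" for r
  proof -
    have "(LINT s:{..r}|lborel. f' s) = (LINT s:{0..r}|lborel. f s)"
      unfolding set_lebesgue_integral_def f'_def using that
      by (intro Bochner_Integration.integral_cong) (auto simp: indicator_def)
    then show ?thesis using has_density_increment[OF F, of 0 r] that t by simp
  qed
  have Gg: "(LINT s:{..r}|lborel. g' s) = G r - G 0" if "r \<in> {0..t}" for r
  proof -
    have "(LINT s:{..r}|lborel. g' s) = (LINT s:{0..r}|lborel. g s)"
      unfolding set_lebesgue_integral_def g'_def using that
      by (intro Bochner_Integration.integral_cong) (auto simp: indicator_def)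
    then show ?thesis using has_density_increment[OF G, of 0 r] that t by simp
  qed
  have It: "integral\<^sup>L lborel f' = F t - F 0" "integral\<^sup>L lborel g' = G t - G 0"
    using has_density_increment[OF F, of 0 t] has_density_increment[OF G, of 0 t] t
    unfolding f'_def[abs_def] g'_def[abs_def] set_lebesgue_integral_def by auto
  have sub: "set_integrable lborel {0..t} h" if "set_integrable lborel {0..1} h" for h :: "real \<Rightarrow> 'c"
    using set_integrable_Icc_subset[OF that, of 0 t] t by auto
  have c1: "set_integrable lborel {0..1} (\<lambda>s. prod (F 0) (g s))"
    by (rule set_integrable_continuous_prod[OF assms(1) continuous_on_const gi])
  have c2: "set_integrable lborel {0..1} (\<lambda>s. prod (f s) (G 0))"
    by (rule set_integrable_continuous_prod[OF bounded_bilinear.flip[OF assms(1)] continuous_on_const fi])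
  have "(LINT r|lborel. prod (LINT s:{..r}|lborel. f' s) (g' r)) =
     (LINT r:{0..t}|lborel. prod (F r) (g r) - prod (F 0) (g r))"
    unfolding set_lebesgue_integral_def[of lborel "{0..t}"]
    by (intro Bochner_Integration.integral_cong)
       (auto simp: Ff indicator_def diff_left g'_def zero_right)
  also have "\<dots> = (LINT r:{0..t}|lborel. prod (F r) (g r)) - (LINT r:{0..t}|lborel. prod (F 0) (g r))"
    by (intro set_integral_diff sub i1 c1)
  also have "(LINT r:{0..t}|lborel. prod (F 0) (g r)) = prod (F 0) (G t - G 0)"
    unfolding It(2)[symmetric] integral_bounded_linear[OF bounded_linear_right g', symmetric]
    by (simp add: set_lebesgue_integral_def g'_def scaleR_right)
  finally have 1: "(LINT r|lborel. prod (LINT s:{..r}|lborel. f' s) (g' r)) =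
    (LINT r:{0..t}|lborel. prod (F r) (g r)) - prod (F 0) (G t - G 0)" .
  have "(LINT s|lborel. prod (f' s) (LINT r:{..s}|lborel. g' r)) =
     (LINT r:{0..t}|lborel. prod (f r) (G r) - prod (f r) (G 0))"
    unfolding set_lebesgue_integral_def[of lborel "{0..t}"]
    by (intro Bochner_Integration.integral_cong)
       (auto simp: Gg indicator_def diff_right f'_def zero_left)
  also have "\<dots> = (LINT r:{0..t}|lborel. prod (f r) (G r)) - (LINT r:{0..t}|lborel. prod (f r) (G 0))"
    by (intro set_integral_diff sub i2 c2)
  also have "(LINT r:{0..t}|lborel. prod (f r) (G 0)) = prod (F t - F 0) (G 0)"
    unfolding It(1)[symmetric] integral_bounded_linear[OF bounded_linear_left f', symmetric]
    by (simp add: set_lebesgue_integral_def f'_def scaleR_left)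
  finally have 2: "(LINT s|lborel. prod (f' s) (LINT r:{..s}|lborel. g' r)) =
    (LINT r:{0..t}|lborel. prod (f r) (G r)) - prod (F t - F 0) (G 0)" .
  have "(LINT r:{0..t}|lborel. prod (F r) (g r) + prod (f r) (G r)) =
     (LINT r:{0..t}|lborel. prod (F r) (g r)) + (LINT r:{0..t}|lborel. prod (f r) (G r))"
    by (intro set_integral_add sub i1 i2)
  also have "\<dots> = prod (F t - F 0) (G t - G 0) + prod (F 0) (G t - G 0) + prod (F t - F 0) (G 0)"
    using Fubini_triangle[OF assms(1) f' g'] unfolding 1 2 It by (simp add: algebra_simps)
  also have "\<dots> = prod (F t) (G t) - prod (F 0) (G 0)"
    by (simp add: diff_left diff_right)
  finally show "(LINT r:{0..t}|lborel. prod (F r) (g r) + prod (f r) (G r)) = prod (F t) (G t) - prod (F 0) (G 0)" .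
qed

section \<open>The Sobolev space on the interval\<close>

lemma smooth_derivD:
  fixes \<phi> :: "real \<Rightarrow> real"
  assumes "smooth_on UNIV \<phi>"
  shows "(\<phi> has_real_derivative deriv \<phi> t) (at t)" and "continuous_on UNIV (deriv \<phi>)"
proof -
  have "Ck_on (Suc 0) UNIV \<phi>" using assms unfolding smooth_on_def by blast
  then obtain d where d: "\<And>t. t \<in> UNIV \<Longrightarrow> (\<phi> has_vector_derivative d t) (at t within UNIV)" "Ck_on 0 UNIV d"
    using Ck_on_Suc_vector_derivativeE[of 0 UNIV \<phi>] by metis
  have D: "(\<phi> has_real_derivative d t) (at t)" for t
    using d(1)[of t] by (simp add: has_real_derivative_iff_has_vector_derivative)
  then have "deriv \<phi> = d" using DERIV_imp_deriv by blast
  then show "(\<phi> has_real_derivative deriv \<phi> t) (at t)" "continuous_on UNIV (deriv \<phi>)"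
    using D d(2) by auto
qed

lemma smooth_test_has_density:
  assumes "test_function \<phi>"
  shows "has_density \<phi> (deriv \<phi>)" and "\<phi> 0 = 0" and "\<phi> 1 = 0"
proof -
  have sm: "smooth_on UNIV \<phi>" and sub: "closure {t. \<phi> t \<noteq> 0} \<subseteq> {0<..<1}"
    using assms unfolding test_function_def by auto
  show "has_density \<phi> (deriv \<phi>)"
  proof (rule has_density_derivative)
    show "(\<phi> has_vector_derivative deriv \<phi> t) (at t within {0..1})" for t
      using has_field_derivative_at_within[OF smooth_derivD(1)[OF sm]]
      by (simp add: has_real_derivative_iff_has_vector_derivative)
    show "continuous_on {0..1} (deriv \<phi>)"
      using smooth_derivD(2)[OF sm] continuous_on_subset by blast
  qed
  have "t \<in> {0<..<1}" if "\<phi> t \<noteq> 0" for t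
    using that closure_subset[of "{t. \<phi> t \<noteq> 0}"] sub by blast
  then show "\<phi> 0 = 0" "\<phi> 1 = 0" by force+
qed

text \<open>
  Integration by parts: the product with a test function vanishes at both ends.
\<close>

lemma has_density_weak_derivative:
  fixes u :: "real \<Rightarrow> real ^ 'n"
  assumes "has_density u g"
  shows "is_weak_derivative u g"
  unfolding is_weak_derivative_def
proof (intro allI impI)
  fix \<phi> assume t: "test_function \<phi>"
  note \<phi> = smooth_test_has_density[OF t]
  have P: "has_density (\<lambda>t. \<phi> t *\<^sub>R u t) (\<lambda>t. \<phi> t *\<^sub>R g t + deriv \<phi> t *\<^sub>R u t)"
    by (rule has_density_prod[OF bounded_bilinear_scaleR \<phi>(1) assms])
  have i1: "set_integrable lborel {0..1} (\<lambda>t. \<phi> t *\<^sub>R g t)"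
    using assms by (intro set_integrable_continuous_prod[OF bounded_bilinear_scaleR has_density_continuous_on[OF \<phi>(1)]])
      (auto simp: has_density_def)
  have i2: "set_integrable lborel {0..1} (\<lambda>t. deriv \<phi> t *\<^sub>R u t)"
    using \<phi>(1) by (intro set_integrable_continuous_prod[OF bounded_bilinear.flip[OF bounded_bilinear_scaleR] has_density_continuous_on[OF assms]])
      (auto simp: has_density_def)
  have "(LINT t:{0..1}|lborel. \<phi> t *\<^sub>R g t + deriv \<phi> t *\<^sub>R u t) = 0"
    using has_density_increment[OF P, of 0 1] \<phi> by simp
  then have "(LINT t:{0..1}|lborel. \<phi> t *\<^sub>R g t) + (LINT t:{0..1}|lborel. deriv \<phi> t *\<^sub>R u t) = 0"
    using set_integral_add(2)[OF i1 i2] by simp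
  then show "(LINT t:{0..1}|lborel. deriv \<phi> t *\<^sub>R u t) = - (LINT t:{0..1}|lborel. \<phi> t *\<^sub>R g t)"
    by (simp add: add_eq_0_iff)
qed

lemma Ck_on_affine: "Ck_on k S (\<lambda>x::real. a * x + b)"
proof (cases k)
  case 0
  then show ?thesis by (auto intro!: continuous_intros)
next
  case (Suc j)
  have "((\<lambda>x::real. a * x + b) has_vector_derivative a) (at t within S)" for t
    by (auto intro!: derivative_eq_intros simp: has_real_derivative_iff_has_vector_derivative[symmetric])
  then show ?thesis using Suc Ck_on_vector_derivativeI[OF _ Ck_on_const] by metis
qed

text \<open>The test function is a smoothed indicator of \<open>[s, t]\<close>.\<close>

lemma test_function_two_bumps:
  assumes "0 < s" "s + \<delta> \<le> t" "t + \<delta> < 1" "0 < \<delta>"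
  obtains \<phi> where "test_function \<phi>" and "\<And>x. deriv \<phi> x = bump ((x - s) / \<delta>) - bump ((x - t) / \<delta>)"
proof -
  obtain S m where S: "\<And>x. (S has_real_derivative bump x) (at x)"
    "\<And>x. x \<le> 0 \<Longrightarrow> S x = 0" "\<And>x. 1 \<le> x \<Longrightarrow> S x = m"
    using bump_antiderivative by metis
  define \<phi> where "\<phi> x = \<delta> * S ((x - s) / \<delta>) - \<delta> * S ((x - t) / \<delta>)" for x
  have D: "(\<phi> has_real_derivative (bump ((x - s) / \<delta>) - bump ((x - t) / \<delta>))) (at x)" for x
    unfolding \<phi>_def using \<open>0 < \<delta>\<close>
    by (auto intro!: derivative_eq_intros DERIV_chain2[of S] S(1) simp: field_simps)
  have "Ck_on k UNIV (\<lambda>x. bump ((x - r) / \<delta>))" for k r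
    using Ck_on_compose[OF _ Ck_on_bump Ck_on_affine[of k UNIV "1/\<delta>" "- r/\<delta>"]]
    by (simp add: diff_divide_distrib)
  then have ck: "Ck_on k UNIV (\<lambda>x. bump ((x - s) / \<delta>) - bump ((x - t) / \<delta>))" for k
    using Ck_on_add[of k UNIV "\<lambda>x. bump ((x - s) / \<delta>)" "\<lambda>x. - bump ((x - t) / \<delta>)"]
      Ck_on_bounded_linear[OF bounded_linear_minus[OF bounded_linear_ident], of k UNIV "\<lambda>x. bump ((x - t) / \<delta>)"]
    by simp
  have "Ck_on k UNIV \<phi>" for k
  proof (rule Ck_on_Suc_D, rule Ck_on_vector_derivativeI[OF _ ck])
    show "(\<phi> has_vector_derivative bump ((x - s) / \<delta>) - bump ((x - t) / \<delta>)) (at x)" for x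
      using D by (simp add: has_real_derivative_iff_has_vector_derivative)
  qed
  moreover have "closure {x. \<phi> x \<noteq> 0} \<subseteq> {0<..<1}"
  proof -
    have "\<phi> x = 0" if "x \<notin> {s..t+\<delta>}" for x
    proof (cases "x < s")
      case True
      then have "(x - s) / \<delta> \<le> 0" "(x - t) / \<delta> \<le> 0"
        using assms by (auto simp: divide_nonpos_pos)
      then show ?thesis unfolding \<phi>_def by (simp add: S(2))
    next
      case False
      then have "1 \<le> (x - s) / \<delta>" "1 \<le> (x - t) / \<delta>"
        using assms that by (auto simp: field_simps)
      then show ?thesis unfolding \<phi>_def by (simp add: S(3))
    qed
    then have "{x. \<phi> x \<noteq> 0} \<subseteq> {s..t+\<delta>}" by blast
    then have "closure {x. \<phi> x \<noteq> 0} \<subseteq> {s..t+\<delta>}" by (rule closure_minimal) simp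
    also have "\<dots> \<subseteq> {0<..<1}" using assms by auto
    finally show ?thesis .
  qed
  ultimately show ?thesis
    using that[of \<phi>] D DERIV_imp_deriv unfolding test_function_def smooth_on_def by blast
qed

text \<open>
  If \<open>d s < m < d t\<close>, then a test function whose derivative is a positive bump near \<open>s\<close> minus an equal
  bump near \<open>t\<close> pairs strictly positively with \<open>m - d\<close>, although it pairs to zero with \<open>d\<close> and with
  constants.
\<close>

lemma du_Bois_Reymond_less:
  fixes d :: "real \<Rightarrow> real"
  assumes "continuous_on {0..1} d"
    and weak: "\<And>\<phi>. test_function \<phi> \<Longrightarrow> (LINT x:{0..1}|lborel. deriv \<phi> x * d x) = 0"
    and st: "0 < s" "s < t" "t < 1"
  shows "d s \<ge> d t"
proof (rule ccontr)
  assume "\<not> d s \<ge> d t"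
  define m where "m = (d s + d t) / 2"
  have m: "d s < m" "m < d t" using \<open>\<not> d s \<ge> d t\<close> by (auto simp: m_def)
  have "open {0<..<1::real}" by simp
  then have cont: "isCont d x" if "x \<in> {0<..<1}" for x
    using assms(1) that continuous_on_eq_continuous_at continuous_on_subset greaterThanLessThan_subseteq_atLeastAtMost_iff
    by (metis order_refl)
  have "\<forall>\<^sub>F x in nhds s. d x < m"
    using order_tendstoD(2)[OF cont[of s, unfolded isCont_def] m(1)] m(1) st
    by (simp add: eventually_nhds_conv_at)
  then obtain e1 where e1: "e1 > 0" "\<And>x. dist x s < e1 \<Longrightarrow> d x < m"
    unfolding eventually_nhds_metric by blast
  have "\<forall>\<^sub>F x in nhds t. m < d x"
    using order_tendstoD(1)[OF cont[of t, unfolded isCont_def] m(2)] m(2) st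
    by (simp add: eventually_nhds_conv_at)
  then obtain e2 where e2: "e2 > 0" "\<And>x. dist x t < e2 \<Longrightarrow> m < d x"
    unfolding eventually_nhds_metric by blast
  define \<delta> where "\<delta> = min (min e1 e2) (min (t - s) (1 - t)) / 2"
  have \<delta>: "0 < \<delta>" "\<delta> < e1" "\<delta> < e2" "s + \<delta> \<le> t" "t + \<delta> < 1"
    using e1(1) e2(1) st by (auto simp: \<delta>_def min_def field_simps)
  obtain \<phi> where \<phi>: "test_function \<phi>" "\<And>x. deriv \<phi> x = bump ((x - s) / \<delta>) - bump ((x - t) / \<delta>)"
    using test_function_two_bumps[of s \<delta> t] st \<delta> by metis
  have cb: "continuous_on {0..1} (\<lambda>x. bump ((x - r) / \<delta>))" for r
    using \<delta>(1) by (intro continuous_on_compose2[OF continuous_on_bump[of UNIV]] continuous_intros) auto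
  define h where "h x = deriv \<phi> x * (m - d x)" for x
  have ch: "continuous_on {0..1} h"
    unfolding h_def \<phi>(2) by (intro continuous_intros assms(1) cb)
  have hnn: "0 \<le> h x" if "x \<in> {0..1}" for x
  proof -
    consider "x \<in> {s<..<s+\<delta>}" | "x \<in> {t<..<t+\<delta>}" | "x \<notin> {s<..<s+\<delta>}" "x \<notin> {t<..<t+\<delta>}" by blast
    then show ?thesis
    proof cases
      case 1
      then have "d x < m" "bump ((x - t) / \<delta>) = 0"
        using e1(2)[of x] \<delta> by (auto simp: dist_real_def bump_zero divide_nonpos_pos)
      then show ?thesis unfolding h_def \<phi>(2) using bump_nonneg by simp
    next
      case 2
      then have "m < d x" "bump ((x - s) / \<delta>) = 0"
        using e2(2)[of x] \<delta> by (auto simp: dist_real_def bump_zero field_simps)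
      then show ?thesis unfolding h_def \<phi>(2) using bump_nonneg[of "(x - t) / \<delta>"]
        by (simp add: mult_le_0_iff zero_le_mult_iff)
    next
      case 3
      have "bump ((x - r) / \<delta>) = 0" if "x \<notin> {r<..<r+\<delta>}" for r
        using that \<delta>(1) by (intro bump_zero) (auto simp: field_simps)
      then show ?thesis using 3 unfolding h_def \<phi>(2) by simp
    qed
  qed
  have ci: "set_integrable lborel {0..1} (\<lambda>x. deriv \<phi> x * d x)" "set_integrable lborel {0..1} (\<lambda>x. deriv \<phi> x * m)"
    unfolding \<phi>(2) by (intro borel_integrable_atLeastAtMost' continuous_intros assms(1) cb)+
  have "(LINT x:{0..1}|lborel. h x) = (LINT x:{0..1}|lborel. deriv \<phi> x * m) - (LINT x:{0..1}|lborel. deriv \<phi> x * d x)"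
    unfolding h_def right_diff_distrib by (intro set_integral_diff ci)
  also have "\<dots> = (LINT x:{0..1}|lborel. deriv \<phi> x) * m"
    using weak[OF \<phi>(1)] by simp
  also have "\<dots> = 0"
    using has_density_increment[OF smooth_test_has_density(1)[OF \<phi>(1)], of 0 1] smooth_test_has_density(2,3)[OF \<phi>(1)]
    by simp
  finally have "integral {0..1} h = 0"
    using set_borel_integral_eq_integral(2)[OF borel_integrable_atLeastAtMost'[OF ch]] by simp
  then have "\<forall>x\<in>{0..1}. h x = 0"
    using integral_eq_0_iff[OF ch] hnn by simp
  then have "h (s + \<delta> / 2) = 0" using st \<delta> by auto
  moreover have "d (s + \<delta> / 2) < m" using e1(2)[of "s + \<delta>/2"] \<delta> by (auto simp: dist_real_def)
  moreover have "bump ((s + \<delta> / 2 - t) / \<delta>) = 0" using \<delta> by (intro bump_zero) (auto simp: field_simps)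
  moreover have "bump ((s + \<delta> / 2 - s) / \<delta>) > 0" using \<delta> by (intro bump_pos) (auto simp: field_simps)
  ultimately show False unfolding h_def \<phi>(2) by simp
qed

lemma du_Bois_Reymond:
  fixes d :: "real \<Rightarrow> real"
  assumes c: "continuous_on {0..1} d"
    and weak: "\<And>\<phi>. test_function \<phi> \<Longrightarrow> (LINT x:{0..1}|lborel. deriv \<phi> x * d x) = 0"
    and "t \<in> {0..1}"
  shows "d t = d 0"
proof -
  have le: "d s \<ge> d t" if "0 < s" "s < t" "t < 1" for s t
    by (rule du_Bois_Reymond_less[OF c weak that])
  have ge: "- d s \<ge> - d t" if "0 < s" "s < t" "t < 1" for s t
    by (rule du_Bois_Reymond_less[OF continuous_on_minus[OF c] _ that])
       (use weak in \<open>simp add: set_lebesgue_integral_def\<close>)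
  define c where "c = (1/2 :: real)"
  have "0 < c" "c < 1" by (auto simp: c_def)
  then have "d x = d c" if "x \<in> {0<..<1}" for x
    using le[of x c] ge[of x c] le[of c x] ge[of c x] that
    by (cases x c rule: linorder_cases) auto
  moreover have "{0..1::real} \<subseteq> closure {0<..<1}" by simp
  ultimately have "d x = d c" if "x \<in> {0..1}" for x
    using continuous_constant_on_closure[of "{0<..<1}" d "d c" x] c that by simp
  from this[of t] this[of 0] show ?thesis using assms(3) by simp
qed

lemma L2_set_integrable:
  assumes "L2_I g"
  shows "set_integrable lborel {0..1} g"
proof -
  have m: "(\<lambda>t. indicator {0..1} t *\<^sub>R g t) \<in> borel_measurable lborel"
    and i: "set_integrable lborel {0..1} (\<lambda>t. (norm (g t))\<^sup>2)"
    using assms unfolding L2_I_def set_borel_measurable_def by auto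
  have i2: "set_integrable lborel {0..1} (\<lambda>t. 1 + (norm (g t))\<^sup>2)"
    by (intro set_integral_add i borel_integrable_atLeastAtMost' continuous_intros)
  have *: "x \<le> 1 + x\<^sup>2" for x :: real
    using zero_le_power2[of "x - 1/2"] by (simp add: power2_eq_square algebra_simps)
  show ?thesis
    unfolding set_integrable_def
    by (rule Bochner_Integration.integrable_bound[OF i2[unfolded set_integrable_def] m])
       (auto simp: indicator_def * intro!: AE_I2)
qed

text \<open>
  The primitive of \<open>g\<close> also has \<open>g\<close> as a weak derivative, so the difference to \<open>u\<close> has weak derivative
  zero and is constant.
\<close>

lemma weak_derivative_has_density:
  fixes u :: "real \<Rightarrow> real ^ 'n"
  assumes c: "continuous_on {0..1} u" and "L2_I g" and w: "is_weak_derivative u g"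
  shows "has_density u g"
proof -
  have gi: "set_integrable lborel {0..1} g" using assms L2_set_integrable by blast
  define v where "v t = (LINT s:{0..t}|lborel. g s)" for t
  have v: "has_density v g" unfolding v_def by (rule has_density_integral[OF gi])
  have vw: "is_weak_derivative v g" by (rule has_density_weak_derivative[OF v])
  have cv: "continuous_on {0..1} v" by (rule has_density_continuous_on[OF v])
  have "u t - v t = u 0 - v 0" if t: "t \<in> {0..1}" for t
  proof (unfold vec_eq_iff, rule allI)
    fix i
    define d where "d t = (u t - v t) $ i" for t
    have "d t = d 0"
    proof (rule du_Bois_Reymond[OF _ _ t])
      show "continuous_on {0..1} d" unfolding d_def by (intro continuous_intros c cv)
      fix \<phi> assume t: "test_function \<phi>"
      have cd: "continuous_on {0..1} (deriv \<phi>)"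
        using t smooth_derivD(2) continuous_on_subset unfolding test_function_def by blast
      have iu: "set_integrable lborel {0..1} (\<lambda>t. deriv \<phi> t *\<^sub>R u t)"
        "set_integrable lborel {0..1} (\<lambda>t. deriv \<phi> t *\<^sub>R v t)"
        by (intro borel_integrable_atLeastAtMost' continuous_intros cd c cv)+
      have i: "set_integrable lborel {0..1} (\<lambda>t. deriv \<phi> t *\<^sub>R (u t - v t))"
        by (intro borel_integrable_atLeastAtMost' continuous_intros cd c cv)
      have "(LINT t:{0..1}|lborel. deriv \<phi> t *\<^sub>R (u t - v t)) = 0"
        using w vw t set_integral_diff(2)[OF iu] unfolding is_weak_derivative_def
        by (simp add: scaleR_diff_right)
      moreover have "(LINT x:{0..1}|lborel. deriv \<phi> x * d x) =
          (LINT t:{0..1}|lborel. deriv \<phi> t *\<^sub>R (u t - v t)) $ i"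
        unfolding set_lebesgue_integral_def d_def
        using integral_bounded_linear[OF bounded_linear_vec_nth i[unfolded set_integrable_def], of i]
        by (simp add: mult.assoc)
      ultimately show "(LINT x:{0..1}|lborel. deriv \<phi> x * d x) = 0" by simp
    qed
    then show "(u t - v t) $ i = (u 0 - v 0) $ i" unfolding d_def .
  qed
  then have "v t - v 0 = u t - u 0" if "t \<in> {0..1}" for t
    using that by (simp add: algebra_simps)
  then show ?thesis using v unfolding has_density_def by simp
qed

text \<open>
  Two densities of the same function have the same integral over all half-lines. Half-lines generate
  the Borel sets and are stable under intersection, so the integrals agree over all Borel sets.
\<close>

lemma has_density_unique_AE:
  assumes f: "has_density F f" and g: "has_density F g"
  shows "AE t in lborel. t \<in> {0..1} \<longrightarrow> f t = g t"
proof -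
  define f' where "f' t = indicat_real {0..1} t *\<^sub>R f t" for t
  define g' where "g' t = indicat_real {0..1} t *\<^sub>R g t" for t
  have i: "integrable lborel f'" "integrable lborel g'"
    using f g unfolding has_density_def set_integrable_def f'_def g'_def by auto
  define h where "h t = f' t - g' t" for t
  have hi: "integrable lborel h" unfolding h_def by (intro Bochner_Integration.integrable_diff i)
  have half: "(LINT x:{..t}|lborel. h x) = 0" for t
  proof -
    have gen: "(LINT x:{..t}|lborel. (indicat_real {0..1} x *\<^sub>R f x)) = (if t < 0 then 0 else F (min t 1) - F 0)"
      if "has_density F f" for f
    proof -
      have "(LINT x:{..t}|lborel. (indicat_real {0..1} x *\<^sub>R f x)) = (LINT x:{0..min t 1}|lborel. f x)"
        unfolding set_lebesgue_integral_def by (intro Bochner_Integration.integral_cong) (auto simp: indicator_def)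
      also have "\<dots> = (if t < 0 then 0 else F (min t 1) - F 0)"
        using has_density_increment[OF that, of 0 "min t 1"] by (auto simp: set_lebesgue_integral_def)
      finally show ?thesis .
    qed
    have "set_integrable lborel {..t} f'" "set_integrable lborel {..t} g'"
      using i unfolding set_integrable_def by (auto intro!: integrable_mult_indicator)
    then have "(LINT x:{..t}|lborel. h x) = (LINT x:{..t}|lborel. f' x) - (LINT x:{..t}|lborel. g' x)"
      unfolding h_def by (rule set_integral_diff)
    also have "\<dots> = 0" unfolding f'_def g'_def using gen[OF f] gen[OF g] by simp
    finally show ?thesis .
  qed
  have total: "integral\<^sup>L lborel h = 0"
  proof -
    have "integral\<^sup>L lborel h = (LINT x:{..1}|lborel. h x)"
      unfolding set_lebesgue_integral_def h_def f'_def g'_def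
      by (intro Bochner_Integration.integral_cong) (auto simp: indicator_def)
    then show ?thesis using half by simp
  qed
  have all: "set_lebesgue_integral lborel A h = 0" if "A \<in> sets borel" for A
  proof -
    have "Int_stable (range (\<lambda>a::real. {..a}))"
      by (auto simp: Int_stable_def)
    moreover have "range (\<lambda>a::real. {..a}) \<subseteq> Pow UNIV"
      by simp
    moreover have "A \<in> sigma_sets UNIV (range (\<lambda>a::real. {..a}))"
      using that unfolding borel_eq_atMost by simp
    ultimately show ?thesis
    proof (induction A rule: sigma_sets_induct_disjoint)
      case (basic A)
      then show ?case using half by auto
    next
      case empty
      then show ?case by (simp add: set_lebesgue_integral_def)
    next
      case (compl A)
      then have A: "A \<in> sets borel" unfolding borel_eq_atMost by simp
      have "set_lebesgue_integral lborel (UNIV - A) h + set_lebesgue_integral lborel A h = integral\<^sup>L lborel h"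
      proof -
        have "integrable lborel (\<lambda>x. indicat_real (UNIV - A) x *\<^sub>R h x)"
          "integrable lborel (\<lambda>x. indicat_real A x *\<^sub>R h x)"
          using A hi by (auto intro!: integrable_mult_indicator simp del: indicator_simps)
        from Bochner_Integration.integral_add[OF this, symmetric] show ?thesis
          unfolding set_lebesgue_integral_def
          by (auto intro!: Bochner_Integration.integral_cong simp: indicator_def)
      qed
      then show ?case using compl total by simp
    next
      case (union A)
      then have A: "A i \<in> sets lborel" for i unfolding borel_eq_atMost sets_lborel by auto
      have "set_integrable lborel (\<Union>i. A i) h"
        unfolding set_integrable_def using A hi by (intro integrable_mult_indicator) auto
      then have "set_lebesgue_integral lborel (\<Union>i. A i) h = (\<Sum>i. set_lebesgue_integral lborel (A i) h)"
        using union(1) A by (intro lebesgue_integral_countable_add) (auto simp: disjoint_family_on_def)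
      then show ?case using union by simp
    qed
  qed
  have "AE t in lborel. f' t = g' t"
  proof (rule sigma_finite_measure.density_unique_banach[OF lborel.sigma_finite_measure_axioms i])
    fix A :: "real set" assume "A \<in> sets lborel"
    then have A: "A \<in> sets borel" by simp
    have "set_integrable lborel A f'" "set_integrable lborel A g'"
      using i A unfolding set_integrable_def by (auto intro!: integrable_mult_indicator)
    then have "set_lebesgue_integral lborel A h = set_lebesgue_integral lborel A f' - set_lebesgue_integral lborel A g'"
      unfolding h_def by (rule set_integral_diff)
    then show "set_lebesgue_integral lborel A f' = set_lebesgue_integral lborel A g'"
      using all[OF A] by simp
  qed
  then show ?thesis by eventually_elim (auto simp: f'_def g'_def indicator_def split: if_splits)
qed

lemma H1_weak_derivative:
  assumes "u \<in> H1_I"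
  shows "L2_I (weak_derivative u)" and "has_density u (weak_derivative u)"
proof -
  have ex: "\<exists>g. L2_I g \<and> is_weak_derivative u g" and c: "continuous_on {0..1} u"
    using assms unfolding H1_I_def by auto
  have *: "L2_I (weak_derivative u) \<and> is_weak_derivative u (weak_derivative u)"
    unfolding weak_derivative_def by (rule someI_ex[OF ex])
  then show "L2_I (weak_derivative u)" "has_density u (weak_derivative u)"
    using weak_derivative_has_density[OF c] by auto
qed

lemma L2_has_density_H1:
  fixes u :: "real \<Rightarrow> real ^ 'n"
  assumes "L2_I g" "has_density u g"
  shows "u \<in> H1_I"
  using assms has_density_continuous_on has_density_weak_derivative unfolding H1_I_def by blast

text \<open>
  All weak derivatives of a function agree almost everywhere, so the chosen one can be replaced.
\<close>

lemma energy_eq: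
  fixes u :: "real \<Rightarrow> real ^ 'n"
  assumes "L2_I g" "has_density u g"
  shows "energy u = (LINT t:{0..1}|lborel. (norm (g t))\<^sup>2)"
proof -
  define h where "h = weak_derivative u"
  have h: "L2_I h" "has_density u h"
    using H1_weak_derivative[OF L2_has_density_H1[OF assms]] by (auto simp: h_def)
  have m: "set_borel_measurable lborel {0..1} (\<lambda>t. (norm (g t))\<^sup>2)" if "L2_I g" for g :: "real \<Rightarrow> real ^ 'n"
    using that unfolding L2_I_def set_integrable_def set_borel_measurable_def
    using borel_measurable_integrable by blast
  have "(LINT t:{0..1}|lborel. (norm (h t))\<^sup>2) = (LINT t:{0..1}|lborel. (norm (g t))\<^sup>2)"
    unfolding set_lebesgue_integral_def
    using has_density_unique_AE[OF h(2) assms(2)] m[OF h(1)] m[OF assms(1)]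
    by (intro integral_cong_AE) (auto simp: set_borel_measurable_def indicator_def)
  then show ?thesis unfolding energy_def h_def .
qed

section \<open>First variation of the energy\<close>

lemma L2_bounded_mult:
  fixes g :: "real \<Rightarrow> real ^ 'n"
  assumes "L2_I g" and m: "set_borel_measurable lborel {0..1} h" and B: "\<And>t. t \<in> {0..1} \<Longrightarrow> \<bar>h t\<bar> \<le> B"
  shows "L2_I (\<lambda>t. h t *\<^sub>R g t)"
proof -
  have mg: "(\<lambda>t. indicat_real {0..1} t *\<^sub>R g t) \<in> borel_measurable lborel"
    and ig: "set_integrable lborel {0..1} (\<lambda>t. (norm (g t))\<^sup>2)"
    using assms(1) unfolding L2_I_def set_borel_measurable_def by auto
  have mh: "(\<lambda>t. indicat_real {0..1} t *\<^sub>R h t) \<in> borel_measurable lborel"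
    using m unfolding set_borel_measurable_def by simp
  have mp: "(\<lambda>t. indicat_real {0..1} t *\<^sub>R (h t *\<^sub>R g t)) \<in> borel_measurable lborel"
  proof -
    have "(\<lambda>t. indicat_real {0..1} t *\<^sub>R (h t *\<^sub>R g t)) =
        (\<lambda>t. (indicat_real {0..1} t *\<^sub>R h t) *\<^sub>R (indicat_real {0..1} t *\<^sub>R g t))"
      by (auto simp: indicator_def)
    then show ?thesis using borel_measurable_scaleR[OF mh mg] by simp
  qed
  have mn: "(\<lambda>t. indicat_real {0..1} t *\<^sub>R (norm (h t *\<^sub>R g t))\<^sup>2) \<in> borel_measurable lborel"
  proof -
    have "(\<lambda>t. indicat_real {0..1} t *\<^sub>R (norm (h t *\<^sub>R g t))\<^sup>2) =
        (\<lambda>t. (norm (indicat_real {0..1} t *\<^sub>R (h t *\<^sub>R g t)))\<^sup>2)"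
      by (auto simp: indicator_def)
    then show ?thesis using borel_measurable_power[OF measurable_compose[OF mp borel_measurable_norm]] by simp
  qed
  have "set_integrable lborel {0..1} (\<lambda>t. B\<^sup>2 * (norm (g t))\<^sup>2)" using ig by simp
  then have "set_integrable lborel {0..1} (\<lambda>t. (norm (h t *\<^sub>R g t))\<^sup>2)"
    unfolding set_integrable_def
  proof (rule Bochner_Integration.integrable_bound[OF _ mn], intro AE_I2)
    fix t
    have "(h t)\<^sup>2 \<le> B\<^sup>2" if "t \<in> {0..1}" using B[OF that] by (metis abs_le_square_iff abs_ge_self order_trans)
    then show "norm (indicat_real {0..1} t *\<^sub>R (norm (h t *\<^sub>R g t))\<^sup>2)
         \<le> norm (indicat_real {0..1} t *\<^sub>R (B\<^sup>2 * (norm (g t))\<^sup>2))"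
      by (auto simp: indicator_def power_mult_distrib intro: mult_right_mono)
  qed
  then show ?thesis using mp unfolding L2_I_def set_borel_measurable_def by simp
qed

lemma L2_continuous:
  fixes g :: "real \<Rightarrow> real ^ 'n"
  assumes "continuous_on {0..1} g"
  shows "L2_I g"
  unfolding L2_I_def set_borel_measurable_def
  using borel_measurable_continuous_on_indicator[OF _ assms]
  by (auto intro!: borel_integrable_atLeastAtMost' continuous_intros assms)

lemma L2_inner_integrable:
  fixes g h :: "real \<Rightarrow> real ^ 'n"
  assumes "L2_I g" "L2_I h"
  shows "set_integrable lborel {0..1} (\<lambda>t. g t \<bullet> h t)"
proof -
  have mg: "(\<lambda>t. indicat_real {0..1} t *\<^sub>R g t) \<in> borel_measurable lborel"
    and mh: "(\<lambda>t. indicat_real {0..1} t *\<^sub>R h t) \<in> borel_measurable lborel"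
    using assms unfolding L2_I_def set_borel_measurable_def by auto
  have m: "(\<lambda>t. indicat_real {0..1} t *\<^sub>R (g t \<bullet> h t)) \<in> borel_measurable lborel"
  proof -
    have "(\<lambda>t. indicat_real {0..1} t *\<^sub>R (g t \<bullet> h t)) =
        (\<lambda>t. (indicat_real {0..1} t *\<^sub>R g t) \<bullet> (indicat_real {0..1} t *\<^sub>R h t))"
      by (auto simp: indicator_def)
    then show ?thesis using borel_measurable_inner[OF mg mh] by simp
  qed
  have "set_integrable lborel {0..1} (\<lambda>t. (norm (g t))\<^sup>2 + (norm (h t))\<^sup>2)"
    using assms unfolding L2_I_def by (intro set_integral_add) auto
  then show ?thesis
    unfolding set_integrable_def
  proof (rule Bochner_Integration.integrable_bound[OF _ m], intro AE_I2)
    fix t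
    have "\<bar>g t \<bullet> h t\<bar> \<le> norm (g t) * norm (h t)" by (rule Cauchy_Schwarz_ineq2)
    also have "\<dots> \<le> (norm (g t))\<^sup>2 + (norm (h t))\<^sup>2"
    proof -
      have "2 * (norm (g t) * norm (h t)) \<le> (norm (g t))\<^sup>2 + (norm (h t))\<^sup>2"
        using sum_squares_bound[of "norm (g t)" "norm (h t)"] by (simp only: mult.assoc)
      moreover have "0 \<le> norm (g t) * norm (h t)" by simp
      ultimately show ?thesis by linarith
    qed
    finally show "norm (indicat_real {0..1} t *\<^sub>R (g t \<bullet> h t))
        \<le> norm (indicat_real {0..1} t *\<^sub>R ((norm (g t))\<^sup>2 + (norm (h t))\<^sup>2))"
      by (auto simp: indicator_def)
  qed
qed

lemma L2_add:
  fixes g h :: "real \<Rightarrow> real ^ 'n"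
  assumes "L2_I g" "L2_I h"
  shows "L2_I (\<lambda>t. g t + h t)"
proof -
  have "set_borel_measurable lborel {0..1} (\<lambda>t. g t + h t)"
    using assms borel_measurable_add unfolding L2_I_def set_borel_measurable_def scaleR_add_right by blast
  moreover have "set_integrable lborel {0..1} (\<lambda>t. (norm (g t))\<^sup>2 + 2 * (g t \<bullet> h t) + (norm (h t))\<^sup>2)"
    using assms L2_inner_integrable[OF assms] unfolding L2_I_def by (intro set_integral_add) auto
  moreover have "(norm (x + y))\<^sup>2 = (norm x)\<^sup>2 + 2 * (x \<bullet> y) + (norm y)\<^sup>2" for x y :: "real ^ 'n"
    by (simp add: power2_norm_eq_inner inner_add_left inner_add_right inner_commute)
  ultimately show ?thesis unfolding L2_I_def by simp
qed

lemma L2_scaleR: "L2_I g \<Longrightarrow> L2_I (\<lambda>t. c *\<^sub>R g t)" for g :: "real \<Rightarrow> real ^ 'n"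
  by (rule L2_bounded_mult[where B = "\<bar>c\<bar>"]) (auto simp: set_borel_measurable_def)

text \<open>
  Only a one-sided variation is admissible in the presence of the obstacle, which is why the
  conclusion is an inequality. The energy along the variation is a quadratic polynomial in \<open>\<epsilon>\<close>.
\<close>

lemma energy_first_variation:
  fixes u :: "real \<Rightarrow> real ^ 'n"
  assumes min: "is_minimizer \<Omega> p q u"
    and g: "L2_I g" "has_density u g" and \<psi>: "L2_I \<psi>'" "has_density \<psi> \<psi>'" "\<psi> 0 = 0" "\<psi> 1 = 0"
    and e: "e > 0" "\<And>\<epsilon> t. 0 < \<epsilon> \<Longrightarrow> \<epsilon> < e \<Longrightarrow> t \<in> {0..1} \<Longrightarrow> u t + \<epsilon> *\<^sub>R \<psi> t \<notin> \<Omega>"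
  shows "0 \<le> (LINT t:{0..1}|lborel. g t \<bullet> \<psi>' t)"
proof (rule ccontr)
  define I where "I = (LINT t:{0..1}|lborel. g t \<bullet> \<psi>' t)"
  define J where "J = (LINT t:{0..1}|lborel. (norm (\<psi>' t))\<^sup>2)"
  assume "\<not> ?thesis"
  then have I: "I < 0" by (simp add: I_def)
  have J: "0 \<le> J" unfolding J_def set_lebesgue_integral_def by (intro integral_nonneg_AE) (auto simp: indicator_def)
  have u: "u \<in> admissible \<Omega> p q" and inf: "energy u = (INF v \<in> admissible \<Omega> p q. energy v)"
    using min unfolding is_minimizer_def by auto
  have nn: "0 \<le> energy v" for v :: "real \<Rightarrow> real ^ 'n"
    unfolding energy_def set_lebesgue_integral_def by (intro integral_nonneg_AE) (auto simp: indicator_def)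
  have ineq: "0 \<le> 2 * I + \<epsilon> * J" if \<epsilon>: "0 < \<epsilon>" "\<epsilon> < e" for \<epsilon>
  proof -
    define v where "v t = u t + \<epsilon> *\<^sub>R \<psi> t" for t
    define h where "h t = g t + \<epsilon> *\<^sub>R \<psi>' t" for t
    have v: "has_density v h" unfolding v_def h_def
      by (intro has_density_add g has_density_bounded_linear[OF bounded_linear_scaleR_right] \<psi>)
    have h: "L2_I h" unfolding h_def by (intro L2_add g L2_scaleR \<psi>)
    have "v \<in> admissible \<Omega> p q"
      using u e(2)[OF \<epsilon>] L2_has_density_H1[OF h v] \<psi>(3,4) unfolding admissible_def by (auto simp: v_def)
    moreover have "bdd_below (energy ` admissible \<Omega> p q)"
      using nn by (auto intro!: bdd_belowI[of _ 0])
    ultimately have "energy u \<le> energy v"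
      unfolding inf by (rule_tac cINF_lower)
    moreover have "energy u = (LINT t:{0..1}|lborel. (norm (g t))\<^sup>2)"
      by (rule energy_eq[OF g])
    moreover have "energy v = (LINT t:{0..1}|lborel. (norm (g t))\<^sup>2) + 2 * \<epsilon> * I + \<epsilon>\<^sup>2 * J"
    proof -
      have i: "set_integrable lborel {0..1} (\<lambda>t. (norm (g t))\<^sup>2)"
        "set_integrable lborel {0..1} (\<lambda>t. 2 * \<epsilon> * (g t \<bullet> \<psi>' t))"
        "set_integrable lborel {0..1} (\<lambda>t. \<epsilon>\<^sup>2 * (norm (\<psi>' t))\<^sup>2)"
        using g(1) \<psi>(1) L2_inner_integrable[OF g(1) \<psi>(1)] unfolding L2_I_def by simp_all
      have "energy v = (LINT t:{0..1}|lborel. (norm (h t))\<^sup>2)" by (rule energy_eq[OF h v])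
      also have "\<dots> = (LINT t:{0..1}|lborel. ((norm (g t))\<^sup>2 + 2 * \<epsilon> * (g t \<bullet> \<psi>' t)) + \<epsilon>\<^sup>2 * (norm (\<psi>' t))\<^sup>2)"
        unfolding h_def power2_norm_eq_inner
        by (simp add: inner_add_left inner_add_right inner_commute power2_eq_square algebra_simps)
      also have "\<dots> = (LINT t:{0..1}|lborel. (norm (g t))\<^sup>2) + 2 * \<epsilon> * I + \<epsilon>\<^sup>2 * J"
        using set_integral_add(2)[OF set_integral_add(1)[OF i(1,2)] i(3)] set_integral_add(2)[OF i(1,2)]
        unfolding I_def J_def by simp
      finally show ?thesis .
    qed
    ultimately have "0 \<le> \<epsilon> * (2 * I + \<epsilon> * J)" by (simp add: power2_eq_square algebra_simps)
    then show ?thesis using \<epsilon> by (simp add: zero_le_mult_iff)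
  qed
  \<comment> \<open>For this \<open>\<epsilon>\<close> the quadratic term is at most half of the negative linear one.\<close>
  define \<epsilon> where "\<epsilon> = min (e / 2) (- I / (J + 1))"
  have "0 < - I / (J + 1)" using I J by (intro divide_pos_pos) auto
  then have \<epsilon>: "0 < \<epsilon>" "\<epsilon> < e" using e(1) unfolding \<epsilon>_def by linarith+
  have "\<epsilon> * J \<le> \<epsilon> * (J + 1)" using \<epsilon> by simp
  also have "\<dots> \<le> (- I / (J + 1)) * (J + 1)" using J by (intro mult_right_mono) (auto simp: \<epsilon>_def)
  also have "\<dots> = - I" using J by simp
  finally show False using ineq[OF \<epsilon>] I by simp
qed

text \<open>
  The piecewise linear function that rises from \<open>0\<close> at \<open>r1\<close> to \<open>1\<close> at \<open>r2\<close> and returns to \<open>0\<close> at \<open>r3\<close>,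
  written as a difference of two ramps because ramps are the primitives of indicators of intervals.
\<close>

definition hat :: "real \<Rightarrow> real \<Rightarrow> real \<Rightarrow> real \<Rightarrow> real" where
  "hat r1 r2 r3 t = max 0 (min t r2 - r1) / (r2 - r1) - max 0 (min t r3 - r2) / (r3 - r2)"

definition hat_density :: "real \<Rightarrow> real \<Rightarrow> real \<Rightarrow> real \<Rightarrow> real" where
  "hat_density r1 r2 r3 t = indicator {r1..r2} t / (r2 - r1) - indicator {r2..r3} t / (r3 - r2)"

lemma hat_nonneg:
  assumes "r1 < r2" "r2 < r3"
  shows "0 \<le> hat r1 r2 r3 t"
proof (cases "t \<le> r2")
  case True
  then show ?thesis using assms by (auto simp: hat_def min_def)
next
  case False
  then have "max 0 (min t r2 - r1) / (r2 - r1) = 1" using assms by (auto simp: min_def)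
  moreover have "max 0 (min t r3 - r2) / (r3 - r2) \<le> 1" using assms by (auto simp: divide_simps)
  ultimately show ?thesis by (simp add: hat_def)
qed

lemma hat_abs_le_1:
  assumes "r1 < r2" "r2 < r3"
  shows "\<bar>hat r1 r2 r3 t\<bar> \<le> 1"
proof -
  have "max 0 (min t r2 - r1) / (r2 - r1) \<le> 1" "0 \<le> max 0 (min t r3 - r2) / (r3 - r2)"
    using assms by (auto simp: divide_simps)
  then have "hat r1 r2 r3 t \<le> 1" unfolding hat_def by linarith
  then show ?thesis using hat_nonneg[OF assms, of t] by simp
qed

lemma hat_eq_0:
  assumes "r1 < r2" "r2 < r3" "t \<notin> {r1<..<r3}"
  shows "hat r1 r2 r3 t = 0"
  using assms by (auto simp: hat_def min_def max_def)

lemma has_density_hat: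
  assumes "0 \<le> r1" "r1 < r2" "r2 < r3" "r3 \<le> 1"
  shows "has_density (hat r1 r2 r3) (hat_density r1 r2 r3)"
proof -
  have ramp: "has_density (\<lambda>t. max 0 (min t s - r)) (indicat_real {r..s})" if "0 \<le> r" "r \<le> s" for r s
    unfolding has_density_def
  proof (intro conjI ballI)
    show "set_integrable lborel {0..1} (indicat_real {r..s})"
      unfolding set_integrable_def
      by (simp add: indicator_inter_arith[symmetric]) (simp add: emeasure_lborel_Icc_eq)
    fix t :: real assume "t \<in> {0..1}"
    then have "(LINT x:{0..t}|lborel. indicat_real {r..s} x) = (LINT x|lborel. indicat_real {r..min t s} x)"
      unfolding set_lebesgue_integral_def using that
      by (intro Bochner_Integration.integral_cong) (auto simp: indicator_def)
    also have "\<dots> = max 0 (min t s - r)" by (auto simp: max_def)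
    finally show "(LINT x:{0..t}|lborel. indicat_real {r..s} x) = max 0 (min t s - r) - max 0 (min 0 s - r)"
      using that by simp
  qed
  have "has_density (\<lambda>t. max 0 (min t r2 - r1) / (r2 - r1) + - (max 0 (min t r3 - r2) / (r3 - r2)))
     (\<lambda>t. indicator {r1..r2} t / (r2 - r1) + - (indicator {r2..r3} t / (r3 - r2)))"
    using assms
    by (intro has_density_add has_density_bounded_linear[OF bounded_linear_divide]
        has_density_bounded_linear[OF bounded_linear_minus[OF bounded_linear_divide]] ramp) auto
  then show ?thesis unfolding hat_def[abs_def] hat_density_def[abs_def] by simp
qed

text \<open>
  Testing a primitive with a hat function compares its slopes on the two sides of the middle node.
\<close>

lemma hat_density_integral:
  assumes k: "has_density K k" and r: "0 \<le> r1" "r1 < r2" "r2 < r3" "r3 \<le> 1"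
  shows "(LINT t:{0..1}|lborel. hat_density r1 r2 r3 t * k t) =
     (K r2 - K r1) / (r2 - r1) - (K r3 - K r2) / (r3 - r2)"
proof -
  have ki: "set_integrable lborel {0..1} k" using k unfolding has_density_def by auto
  have i: "set_integrable lborel {0..1} (\<lambda>t. indicat_real {r..s} t * k t)"
    and eq: "(LINT t:{0..1}|lborel. indicat_real {r..s} t * k t) = K s - K r"
    if "0 \<le> r" "r \<le> s" "s \<le> 1" for r s
  proof -
    have *: "indicat_real {0..1} t *\<^sub>R (indicat_real {r..s} t * k t) = indicat_real {r..s} t *\<^sub>R k t" for t
      using that by (auto simp: indicator_def)
    show "set_integrable lborel {0..1} (\<lambda>t. indicat_real {r..s} t * k t)"
      using set_integrable_Icc_subset[OF ki that(1,3)] unfolding set_integrable_def * .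
    show "(LINT t:{0..1}|lborel. indicat_real {r..s} t * k t) = K s - K r"
      using has_density_increment[OF k that] unfolding set_lebesgue_integral_def * by simp
  qed
  have *: "hat_density r1 r2 r3 t * k t =
     (1 / (r2 - r1)) * (indicat_real {r1..r2} t * k t) - (1 / (r3 - r2)) * (indicat_real {r2..r3} t * k t)" for t
    by (simp add: hat_density_def algebra_simps)
  show ?thesis
    unfolding * using r by (subst set_integral_diff(2)) (auto simp: i eq)
qed

locale obstacle_minimizer =
  fixes \<Omega> :: "(real ^ 'n) set" and p q :: "real ^ 'n" and u :: "real \<Rightarrow> real ^ 'n"
  assumes open_\<Omega>: "open \<Omega>" and convex_\<Omega>: "convex \<Omega>" and nonempty: "\<Omega> \<noteq> {}"
    and minimizer: "is_minimizer \<Omega> p q u"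
begin

text \<open>
  The function \<open>potential c z\<close> collects what the variation in the direction \<open>c u - z\<close> sees. For \<open>c = 1\<close>
  it equals, up to a constant, half the squared distance to \<open>z\<close> corrected by the double primitive of
  \<open>\<bar>u'\<bar>\<^sup>2\<close>, so that formally its second derivative is \<open>u'' \<bullet> (u - z)\<close>. For \<open>c = 0\<close> it is a
  coordinate of the curve.
\<close>

definition weak_velocity where "weak_velocity = weak_derivative u"
definition action where "action t = (LINT s:{0..t}|lborel. (norm (weak_velocity s))\<^sup>2)"
definition iterated_action where "iterated_action t = (LINT s:{0..t}|lborel. action s)"
definition potential where "potential c z t = c * ((norm (u t))\<^sup>2 / 2 - iterated_action t) - u t \<bullet> z"

lemma u_H1: "u \<in> H1_I" and u_0: "u 0 = p" and u_1: "u 1 = q"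
  and u_avoids: "t \<in> {0..1} \<Longrightarrow> u t \<notin> \<Omega>"
  using minimizer unfolding is_minimizer_def admissible_def by auto

lemma weak_velocity_L2: "L2_I weak_velocity" and u_density: "has_density u weak_velocity"
  using H1_weak_derivative[OF u_H1] by (auto simp: weak_velocity_def)

lemma u_continuous: "continuous_on {0..1} u"
  using u_density by (rule has_density_continuous_on)

lemma action_density: "has_density action (\<lambda>t. (norm (weak_velocity t))\<^sup>2)"
  unfolding action_def[abs_def] using weak_velocity_L2 by (intro has_density_integral) (auto simp: L2_I_def)

lemma action_continuous: "continuous_on {0..1} action"
  using action_density by (rule has_density_continuous_on)

lemma iterated_action_density: "has_density iterated_action action"
  unfolding iterated_action_def[abs_def] by (intro has_density_integral borel_integrable_atLeastAtMost' action_continuous)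

lemma iterated_action_has_derivative:
  assumes "t \<in> {0<..<1}"
  shows "(iterated_action has_real_derivative action t) (at t)"
proof -
  have "((\<lambda>t. integral {0..t} action) has_real_derivative action t) (at t within {0..1})"
    using assms by (intro integral_has_real_derivative action_continuous) auto
  moreover have "iterated_action x = integral {0..x} action" if "x \<in> {0..1}" for x
    unfolding iterated_action_def using that
    by (intro set_borel_integral_eq_integral(2) borel_integrable_atLeastAtMost' continuous_on_subset[OF action_continuous]) auto
  ultimately have "(iterated_action has_real_derivative action t) (at t within {0..1})"
    using assms by (subst has_field_derivative_cong_eventually[where g = "\<lambda>t. integral {0..t} action"])
       (auto simp: eventually_at_filter)
  then show ?thesis using assms by (subst (asm) at_within_interior) auto
qed

lemma potential_density:
  "has_density (potential c z) (\<lambda>t. weak_velocity t \<bullet> (c *\<^sub>R u t - z) - c * action t)"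
proof -
  have "has_density (\<lambda>t. u t \<bullet> u t) (\<lambda>t. u t \<bullet> weak_velocity t + weak_velocity t \<bullet> u t)"
    by (rule has_density_prod[OF bounded_bilinear_inner u_density u_density])
  then have 1: "has_density (\<lambda>t. (c / 2) * (u t \<bullet> u t)) (\<lambda>t. (c / 2) * (u t \<bullet> weak_velocity t + weak_velocity t \<bullet> u t))"
    by (rule has_density_bounded_linear[OF bounded_linear_mult_right])
  have 2: "has_density (\<lambda>t. - (u t \<bullet> z)) (\<lambda>t. - (weak_velocity t \<bullet> z))"
    by (rule has_density_bounded_linear[OF bounded_linear_minus[OF bounded_linear_inner_left] u_density])
  have 3: "has_density (\<lambda>t. (- c) * iterated_action t) (\<lambda>t. (- c) * action t)"
    by (rule has_density_bounded_linear[OF bounded_linear_mult_right iterated_action_density])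
  have "potential c z = (\<lambda>t. (c / 2) * (u t \<bullet> u t) + (- (u t \<bullet> z) + (- c) * iterated_action t))"
    by (auto simp: potential_def power2_norm_eq_inner algebra_simps)
  moreover have "(\<lambda>t. weak_velocity t \<bullet> (c *\<^sub>R u t - z) - c * action t) =
     (\<lambda>t. (c / 2) * (u t \<bullet> weak_velocity t + weak_velocity t \<bullet> u t) + (- (weak_velocity t \<bullet> z) + (- c) * action t))"
    by (auto simp: inner_diff_right inner_commute algebra_simps)
  ultimately show ?thesis using has_density_add[OF 1 has_density_add[OF 2 3]] by simp
qed

text \<open>
  The variation along a hat function times \<open>c u - z\<close>. In the first variation the term with
  \<open>\<bar>u'\<bar>\<^sup>2\<close> is integrated by parts against the hat function, which leaves the derivative of the
  potential tested with the derivative of the hat function.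
\<close>

lemma variation_slopes:
  assumes r: "0 \<le> r1" "r1 < r2" "r2 < r3" "r3 \<le> 1" and "e > 0"
    and avoid: "\<And>\<epsilon> t. 0 < \<epsilon> \<Longrightarrow> \<epsilon> < e \<Longrightarrow> t \<in> {0..1} \<Longrightarrow>
       u t + \<epsilon> *\<^sub>R (hat r1 r2 r3 t *\<^sub>R (c *\<^sub>R u t - z)) \<notin> \<Omega>"
  shows "(potential c z r3 - potential c z r2) / (r3 - r2) \<le> (potential c z r2 - potential c z r1) / (r2 - r1)"
proof -
  let ?\<eta> = "hat r1 r2 r3" and ?d = "hat_density r1 r2 r3"
  define \<psi> where "\<psi> t = ?\<eta> t *\<^sub>R (c *\<^sub>R u t - z)" for t
  define \<psi>' where "\<psi>' t = ?\<eta> t *\<^sub>R (c *\<^sub>R weak_velocity t) + ?d t *\<^sub>R (c *\<^sub>R u t - z)" for t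
  have H: "has_density ?\<eta> ?d" by (rule has_density_hat[OF r])
  have ends: "?\<eta> 0 = 0" "?\<eta> 1 = 0" using r by (auto intro!: hat_eq_0)
  have "has_density (\<lambda>t. c *\<^sub>R u t - z) (\<lambda>t. c *\<^sub>R weak_velocity t)"
    using has_density_add[OF has_density_bounded_linear[OF bounded_linear_scaleR_right u_density] has_density_const, of c "- z"]
    by simp
  from has_density_prod[OF bounded_bilinear_scaleR H this] have d\<psi>: "has_density \<psi> \<psi>'"
    unfolding \<psi>_def \<psi>'_def .
  have c\<eta>: "continuous_on {0..1} ?\<eta>" by (rule has_density_continuous_on[OF H])
  have B: "\<bar>?\<eta> t\<bar> \<le> 1" for t by (rule hat_abs_le_1[OF r(2,3)])
  have "L2_I (\<lambda>t. ?\<eta> t *\<^sub>R (c *\<^sub>R weak_velocity t))"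
    using borel_measurable_continuous_on_indicator[OF _ c\<eta>]
    by (intro L2_bounded_mult[OF L2_scaleR[OF weak_velocity_L2] _ B]) (auto simp: set_borel_measurable_def)
  moreover have "L2_I (\<lambda>t. ?d t *\<^sub>R (c *\<^sub>R u t - z))"
  proof (rule L2_bounded_mult[where B = "\<bar>1 / (r2 - r1)\<bar> + \<bar>1 / (r3 - r2)\<bar>"])
    show "L2_I (\<lambda>t. c *\<^sub>R u t - z)" by (intro L2_continuous continuous_intros u_continuous)
    show "set_borel_measurable lborel {0..1} ?d"
      unfolding set_borel_measurable_def hat_density_def by measurable
    show "\<bar>?d t\<bar> \<le> \<bar>1 / (r2 - r1)\<bar> + \<bar>1 / (r3 - r2)\<bar>" for t
      unfolding hat_density_def
      by (rule order_trans[OF abs_triangle_ineq4], intro add_mono) (auto simp: indicator_def)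
  qed
  ultimately have L\<psi>: "L2_I \<psi>'" unfolding \<psi>'_def by (rule L2_add)
  have "0 \<le> (LINT t:{0..1}|lborel. weak_velocity t \<bullet> \<psi>' t)"
    by (rule energy_first_variation[OF minimizer weak_velocity_L2 u_density L\<psi> d\<psi> _ _ \<open>e > 0\<close>])
       (use avoid in \<open>auto simp: \<psi>_def ends\<close>)
  also have "\<dots> = (LINT t:{0..1}|lborel. ?d t * (weak_velocity t \<bullet> (c *\<^sub>R u t - z) - c * action t))"
  proof -
    have P: "has_density (\<lambda>t. ?\<eta> t * action t) (\<lambda>t. ?\<eta> t * (norm (weak_velocity t))\<^sup>2 + ?d t * action t)"
      by (rule has_density_prod[OF bounded_bilinear_mult H action_density])
    then have Pi: "set_integrable lborel {0..1} (\<lambda>t. c * (?\<eta> t * (norm (weak_velocity t))\<^sup>2 + ?d t * action t))"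
      unfolding has_density_def by simp
    have P0: "(LINT t:{0..1}|lborel. c * (?\<eta> t * (norm (weak_velocity t))\<^sup>2 + ?d t * action t)) = 0"
      using has_density_increment[OF P, of 0 1] ends by simp
    have "(LINT t:{0..1}|lborel. ?d t * (weak_velocity t \<bullet> (c *\<^sub>R u t - z) - c * action t)) =
       (LINT t:{0..1}|lborel. weak_velocity t \<bullet> \<psi>' t - c * (?\<eta> t * (norm (weak_velocity t))\<^sup>2 + ?d t * action t))"
      unfolding \<psi>'_def power2_norm_eq_inner
      by (simp add: inner_add_right algebra_simps)
    also have "\<dots> = (LINT t:{0..1}|lborel. weak_velocity t \<bullet> \<psi>' t) -
       (LINT t:{0..1}|lborel. c * (?\<eta> t * (norm (weak_velocity t))\<^sup>2 + ?d t * action t))"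
      by (intro set_integral_diff L2_inner_integrable weak_velocity_L2 L\<psi> Pi)
    finally show ?thesis unfolding P0 by simp
  qed
  also have "\<dots> = (potential c z r2 - potential c z r1) / (r2 - r1) - (potential c z r3 - potential c z r2) / (r3 - r2)"
    by (rule hat_density_integral[OF potential_density r])
  finally show ?thesis by simp
qed

text \<open>
  The point \<open>x\<close> lies strictly between \<open>z\<close> and the pushed point, and convexity would put it into the
  interior of \<open>\<Omega>\<close> if the pushed point were in \<open>\<Omega>\<close>.
\<close>

lemma outward_push_avoids:
  assumes "x \<notin> \<Omega>" "z \<in> closure \<Omega>" "0 \<le> s"
  shows "x + s *\<^sub>R (x - z) \<notin> \<Omega>"
proof
  assume y: "x + s *\<^sub>R (x - z) \<in> \<Omega>"
  show False
  proof (cases "s = 0 \<or> x = z")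
    case True
    then show ?thesis using y assms by auto
  next
    case False
    then have "s > 0" "x \<noteq> z" using assms(3) by auto
    let ?y = "x + s *\<^sub>R (x - z)"
    have "?y \<in> interior \<Omega>" using y open_\<Omega> interior_open by blast
    moreover have "x \<in> open_segment z ?y"
      unfolding in_segment
    proof (intro conjI exI)
      show "z \<noteq> ?y"
      proof
        assume "z = ?y"
        then have "(1 + s) *\<^sub>R (x - z) = 0" by (simp add: algebra_simps)
        then show False using \<open>s > 0\<close> \<open>x \<noteq> z\<close> by simp
      qed
      have "?y - z = (1 + s) *\<^sub>R (x - z)" by (simp add: algebra_simps)
      then have "x = z + (1 / (1 + s)) *\<^sub>R (?y - z)" using \<open>s > 0\<close> by simp
      then show "x = (1 - 1 / (1 + s)) *\<^sub>R z + (1 / (1 + s)) *\<^sub>R ?y"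
        by (simp only: scaleR_diff_left scaleR_diff_right scaleR_one) (simp only: algebra_simps)
    qed (use \<open>s > 0\<close> in auto)
    ultimately have "x \<in> interior \<Omega>"
      using in_interior_closure_convex_segment[OF convex_\<Omega>, of ?y z] assms(2)
      by (auto simp: open_segment_commute)
    then show False using assms(1) interior_subset by blast
  qed
qed

lemma potential_concave:
  assumes "z \<in> closure \<Omega>" and "0 \<le> r1" "r1 < r2" "r2 < r3" "r3 \<le> 1"
  shows "(potential 1 z r3 - potential 1 z r2) / (r3 - r2) \<le> (potential 1 z r2 - potential 1 z r1) / (r2 - r1)"
proof (rule variation_slopes[OF assms(2-5) zero_less_one])
  fix \<epsilon> t :: real assume "0 < \<epsilon>" "t \<in> {0..1}"
  then show "u t + \<epsilon> *\<^sub>R hat r1 r2 r3 t *\<^sub>R (1 *\<^sub>R u t - z) \<notin> \<Omega>"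
    using outward_push_avoids[OF u_avoids assms(1), of t "\<epsilon> * hat r1 r2 r3 t"] hat_nonneg[of r1 r2 r3 t] assms
    by simp
qed

text \<open>
  Away from the obstacle displacements in both directions \<open>z\<close> and \<open>- z\<close> are admissible, so the two slopes
  of every coordinate agree.
\<close>

lemma free_slopes_eq:
  assumes "0 \<le> r1" "r1 < r2" "r2 < r3" "r3 \<le> 1"
    and free: "\<And>r. r \<in> {r1..r3} \<Longrightarrow> u r \<notin> closure \<Omega>"
  shows "(1 / (r3 - r2)) *\<^sub>R (u r3 - u r2) = (1 / (r2 - r1)) *\<^sub>R (u r2 - u r1)"
proof -
  have ineq: "- ((u r3 - u r2) \<bullet> z) / (r3 - r2) \<le> - ((u r2 - u r1) \<bullet> z) / (r2 - r1)" for z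
  proof -
    have "compact (u ` {r1..r3})"
      using assms by (intro compact_continuous_image continuous_on_subset[OF u_continuous]) auto
    moreover have "closed (closure \<Omega>)" "u ` {r1..r3} \<inter> closure \<Omega> = {}" using free by auto
    ultimately obtain d where d: "d > 0" "\<And>x y. x \<in> u ` {r1..r3} \<Longrightarrow> y \<in> closure \<Omega> \<Longrightarrow> d \<le> dist x y"
      using separate_compact_closed by metis
    define e where "e = d / (norm z + 1)"
    have e: "e > 0" using d by (auto simp: e_def intro!: divide_pos_pos add_nonneg_pos)
    have "(potential 0 z r3 - potential 0 z r2) / (r3 - r2) \<le> (potential 0 z r2 - potential 0 z r1) / (r2 - r1)"
    proof (rule variation_slopes[OF assms(1-4) e])
      fix \<epsilon> t :: real assume \<epsilon>: "0 < \<epsilon>" "\<epsilon> < e" and t: "t \<in> {0..1}"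
      let ?v = "u t + \<epsilon> *\<^sub>R hat r1 r2 r3 t *\<^sub>R (0 *\<^sub>R u t - z)"
      show "?v \<notin> \<Omega>"
      proof (cases "t \<in> {r1<..<r3}")
        case False
        then show ?thesis using hat_eq_0[of r1 r2 r3 t] assms u_avoids[OF t] by simp
      next
        case True
        have "dist (u t) ?v = \<epsilon> * \<bar>hat r1 r2 r3 t\<bar> * norm z"
          using \<epsilon> by (simp add: dist_norm abs_mult)
        also have "\<dots> \<le> \<epsilon> * 1 * norm z"
          using hat_abs_le_1[OF assms(2,3), of t] \<epsilon> by (intro mult_right_mono mult_left_mono) auto
        also have "\<dots> < e * (norm z + 1)"
          using mult_right_mono[of \<epsilon> e "norm z"] \<epsilon> e by (simp add: distrib_left)
        also have "\<dots> = d" 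
        proof -
          have "norm z + 1 \<noteq> 0" using norm_ge_zero[of z] by linarith
          then show ?thesis unfolding e_def by simp
        qed
        finally show ?thesis using d(2)[of "u t" ?v] True closure_subset by force
      qed
    qed
    then show ?thesis by (simp add: potential_def inner_diff_left)
  qed
  have "((1 / (r3 - r2)) *\<^sub>R (u r3 - u r2) - (1 / (r2 - r1)) *\<^sub>R (u r2 - u r1)) \<bullet> z = 0" for z
  proof -
    have "- (((u r3 - u r2) \<bullet> z) / (r3 - r2)) \<le> - (((u r2 - u r1) \<bullet> z) / (r2 - r1))"
      using ineq[of z] by (simp only: minus_divide_left)
    moreover have "((u r3 - u r2) \<bullet> z) / (r3 - r2) \<le> ((u r2 - u r1) \<bullet> z) / (r2 - r1)"
      using ineq[of "- z"] by (simp only: inner_minus_right minus_minus)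
    ultimately show ?thesis by (simp add: inner_diff_left[of "(1 / (r3 - r2)) *\<^sub>R (u r3 - u r2)"])
  qed
  then have "(1 / (r3 - r2)) *\<^sub>R (u r3 - u r2) - (1 / (r2 - r1)) *\<^sub>R (u r2 - u r1) = 0"
    by (metis inner_eq_zero_iff)
  then show ?thesis by simp
qed

text \<open>
  The two end points may touch the obstacle; they are reached by continuity from smaller intervals.
\<close>

lemma free_affine:
  assumes "0 \<le> s" "s < t" "t \<le> 1" and free: "\<And>r. r \<in> {s<..<t} \<Longrightarrow> u r \<notin> closure \<Omega>"
    and "r \<in> {s..t}"
  shows "u r = u s + ((r - s) / (t - s)) *\<^sub>R (u t - u s)"
proof (cases "r = s \<or> r = t")
  case True
  then show ?thesis using assms by auto
next
  case False
  then have r: "s < r" "r < t" using assms by auto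
  have c: "continuous_on {s..t} u" using continuous_on_subset[OF u_continuous] assms by auto
  have ul: "(u \<longlongrightarrow> u s) (at_right s)"
    using continuous_on_Icc_at_rightD[OF c] assms by simp
  have ur: "(u \<longlongrightarrow> u t) (at_left t)"
    using continuous_on_Icc_at_leftD[OF c] assms by simp
  have 1: "(1 / (t' - r)) *\<^sub>R (u t' - u r) = (1 / (r - s')) *\<^sub>R (u r - u s')"
    if "s < s'" "s' < r" "r < t'" "t' < t" for s' t'
    using that assms by (intro free_slopes_eq free) auto
  have 2: "(1 / (t' - r)) *\<^sub>R (u t' - u r) = (1 / (r - s)) *\<^sub>R (u r - u s)" if "r < t'" "t' < t" for t'
  proof -
    have "((\<lambda>s'. (1 / (r - s')) *\<^sub>R (u r - u s')) \<longlongrightarrow> (1 / (r - s)) *\<^sub>R (u r - u s)) (at_right s)"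
      using r by (intro tendsto_intros ul) auto
    moreover have "\<forall>\<^sub>F s' in at_right s. (1 / (r - s')) *\<^sub>R (u r - u s') = (1 / (t' - r)) *\<^sub>R (u t' - u r)"
      unfolding eventually_at_right[OF r(1)] using 1 that r by (intro exI[of _ r]) auto
    ultimately have "((\<lambda>s'. (1 / (t' - r)) *\<^sub>R (u t' - u r)) \<longlongrightarrow> (1 / (r - s)) *\<^sub>R (u r - u s)) (at_right s)"
      by (rule Lim_transform_eventually)
    then show ?thesis by (simp only: tendsto_const_iff[OF trivial_limit_at_right_real])
  qed
  have 3: "(1 / (t - r)) *\<^sub>R (u t - u r) = (1 / (r - s)) *\<^sub>R (u r - u s)"
  proof -
    have "((\<lambda>t'. (1 / (t' - r)) *\<^sub>R (u t' - u r)) \<longlongrightarrow> (1 / (t - r)) *\<^sub>R (u t - u r)) (at_left t)"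
      using r by (intro tendsto_intros ur) auto
    moreover have "\<forall>\<^sub>F t' in at_left t. (1 / (t' - r)) *\<^sub>R (u t' - u r) = (1 / (r - s)) *\<^sub>R (u r - u s)"
      unfolding eventually_at_left[OF r(2)] using 2 r by (intro exI[of _ r]) auto
    ultimately have "((\<lambda>t'. (1 / (r - s)) *\<^sub>R (u r - u s)) \<longlongrightarrow> (1 / (t - r)) *\<^sub>R (u t - u r)) (at_left t)"
      by (rule Lim_transform_eventually)
    then show ?thesis by (simp only: tendsto_const_iff[OF trivial_limit_at_left_real])
  qed
  define v where "v = (1 / (r - s)) *\<^sub>R (u r - u s)"
  have a: "u r - u s = (r - s) *\<^sub>R v" using r by (simp add: v_def)
  have "(t - r) *\<^sub>R ((1 / (t - r)) *\<^sub>R (u t - u r)) = (t - r) *\<^sub>R v" unfolding 3 v_def ..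
  then have b: "u t - u r = (t - r) *\<^sub>R v" using r by simp
  have "u t - u s = (u t - u r) + (u r - u s)" by simp
  also have "\<dots> = (t - s) *\<^sub>R v" unfolding a b by (simp add: algebra_simps)
  finally have "((r - s) / (t - s)) *\<^sub>R (u t - u s) = u r - u s" using a assms(2) by simp
  then show ?thesis by simp
qed

end

section \<open>Concave functions of one variable\<close>

text \<open>
  Concavity on \<open>[a, b]\<close> in the form of the three-slope inequality, which is how it comes out of a
  variation with a hat function.
\<close>

definition decreasing_slopes :: "real \<Rightarrow> real \<Rightarrow> (real \<Rightarrow> real) \<Rightarrow> bool" where
  "decreasing_slopes a b f \<longleftrightarrow> (\<forall>x y z. a \<le> x \<longrightarrow> x < y \<longrightarrow> y < z \<longrightarrow> z \<le> b \<longrightarrow>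
     (f z - f y) / (z - y) \<le> (f y - f x) / (y - x))"

lemma decreasing_slopesD:
  "decreasing_slopes a b f \<Longrightarrow> a \<le> x \<Longrightarrow> x < y \<Longrightarrow> y < z \<Longrightarrow> z \<le> b \<Longrightarrow>
     (f z - f y) / (z - y) \<le> (f y - f x) / (y - x)"
  unfolding decreasing_slopes_def by blast

lemma decreasing_slopes_right:
  assumes "decreasing_slopes a b f" "a \<le> x" "x < y" "y \<le> y'" "y' \<le> b"
  shows "(f y' - f x) / (y' - x) \<le> (f y - f x) / (y - x)"
proof (cases "y = y'")
  case False
  then have l: "y < y'" using assms by simp
  define s where "s = (f y - f x) / (y - x)"
  have "(f y' - f y) / (y' - y) \<le> s"
    unfolding s_def using decreasing_slopesD[OF assms(1,2,3) l assms(5)] .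
  then have "f y' - f y \<le> s * (y' - y)" using l by (simp add: pos_divide_le_eq)
  moreover have "f y - f x = s * (y - x)" using assms(3) by (simp add: s_def)
  ultimately have "f y' - f x \<le> s * (y' - x)" by (simp add: algebra_simps)
  then show ?thesis using assms l unfolding s_def[symmetric] by (simp add: pos_divide_le_eq)
qed simp

lemma decreasing_slopes_right_derivative:
  assumes f: "decreasing_slopes a b f" and x: "a < x" "x < b"
  shows "\<exists>l. (f has_real_derivative l) (at_right x)"
proof -
  let ?s = "\<lambda>y. (f y - f x) / (y - x)"
  have "((\<lambda>y. - ?s y) \<longlongrightarrow> Inf ((\<lambda>y. - ?s y) ` ({x<..} \<inter> {..<b}))) (at x within ({x<..} \<inter> {..<b}))"
  proof (rule Lim_right_bound)
    fix y y' assume "y \<in> {..<b}" "y' \<in> {..<b}" "x < y" "y \<le> y'"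
    then show "- ?s y \<le> - ?s y'" using decreasing_slopes_right[OF f, of x y y'] x by auto
  next
    fix y assume "y \<in> {..<b}" "x < y"
    then show "- ((f x - f a) / (x - a)) \<le> - ?s y" using decreasing_slopesD[OF f, of a x y] x by auto
  qed
  moreover have "at x within ({x<..} \<inter> {..<b}) = at_right x"
    by (rule at_within_nhd[of x "{..<b}"]) (use x in auto)
  ultimately have "\<exists>l. ((\<lambda>y. - ?s y) \<longlongrightarrow> l) (at_right x)" by auto
  then obtain l where "((\<lambda>y. - ?s y) \<longlongrightarrow> l) (at_right x)" by blast
  from tendsto_minus[OF this] show ?thesis by (auto simp: has_field_derivative_iff)
qed

lemma decreasing_slopes_left_derivative:
  assumes f: "decreasing_slopes a b f" and x: "a < x" "x < b"
  shows "\<exists>l. (f has_real_derivative l) (at_left x)"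
proof -
  define h where "h y = f (- y)" for y
  have "decreasing_slopes (- b) (- a) h"
    unfolding decreasing_slopes_def
  proof (intro allI impI)
    fix x y z assume *: "- b \<le> x" "x < y" "y < z" "z \<le> - a"
    have "(f (- x) - f (- y)) / (- x - - y) \<le> (f (- y) - f (- z)) / (- y - - z)"
      by (rule decreasing_slopesD[OF f]) (use * in auto)
    then have "- ((f (- y) - f (- z)) / (z - y)) \<le> - ((f (- x) - f (- y)) / (y - x))" by simp
    then show "(h z - h y) / (z - y) \<le> (h y - h x) / (y - x)"
      unfolding h_def minus_divide_left by simp
  qed
  from decreasing_slopes_right_derivative[OF this, of "- x"] x
  obtain l where l: "(h has_real_derivative l) (at_right (- x))" by auto
  have "(h \<circ> uminus has_real_derivative l * (- 1)) (at x within {..<x})"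
    by (rule DERIV_image_chain) (use l in \<open>auto intro!: derivative_eq_intros simp: image_uminus_lessThan\<close>)
  moreover have "h \<circ> uminus = f" by (auto simp: h_def)
  ultimately show ?thesis by auto
qed

lemma right_derivative_le_slope:
  assumes f: "decreasing_slopes a b f" and r: "(f has_real_derivative r) (at_right x)"
    and "a \<le> y" "y < x" "x < b"
  shows "r \<le> (f x - f y) / (x - y)"
proof (rule tendsto_upperbound[OF r[unfolded has_field_derivative_iff]])
  show "\<forall>\<^sub>F z in at_right x. (f z - f x) / (z - x) \<le> (f x - f y) / (x - y)"
    unfolding eventually_at_right[OF \<open>x < b\<close>]
    using decreasing_slopesD[OF f, of y x] assms by (intro exI[of _ b]) auto
qed simp

lemma slope_le_left_derivative:
  assumes f: "decreasing_slopes a b f" and l: "(f has_real_derivative l) (at_left x)"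
    and "x < y" "y \<le> b" "a < x"
  shows "(f y - f x) / (y - x) \<le> l"
proof (rule tendsto_lowerbound[OF l[unfolded has_field_derivative_iff]])
  show "\<forall>\<^sub>F z in at_left x. (f y - f x) / (y - x) \<le> (f z - f x) / (z - x)"
    unfolding eventually_at_left[OF \<open>a < x\<close>]
  proof (intro exI[of _ a] conjI allI impI)
    fix z assume "a < z" "z < x"
    then have "(f y - f x) / (y - x) \<le> (f x - f z) / (x - z)"
      using decreasing_slopesD[OF f, of z x y] assms by auto
    also have "\<dots> = (f z - f x) / (z - x)" using minus_divide_divide[of "f z - f x" "z - x"] by simp
    finally show "(f y - f x) / (y - x) \<le> (f z - f x) / (z - x)" .
  qed (use assms in auto)
qed simp

lemma right_derivative_le_left:
  assumes f: "decreasing_slopes a b f" and r: "(f has_real_derivative r) (at_right x)"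
    and l: "(f has_real_derivative l) (at_left x)" and x: "a < x" "x < b"
  shows "r \<le> l"
proof (rule tendsto_lowerbound[OF l[unfolded has_field_derivative_iff]])
  show "\<forall>\<^sub>F z in at_left x. r \<le> (f z - f x) / (z - x)"
    unfolding eventually_at_left[OF \<open>a < x\<close>]
  proof (intro exI[of _ a] conjI allI impI)
    fix z assume "a < z" "z < x"
    then have "r \<le> (f x - f z) / (x - z)"
      using right_derivative_le_slope[OF f r, of z] x by auto
    also have "\<dots> = (f z - f x) / (z - x)" using minus_divide_divide[of "f z - f x" "z - x"] by simp
    finally show "r \<le> (f z - f x) / (z - x)" .
  qed (use x in auto)
qed simp

context
  fixes a b :: real and f f' :: "real \<Rightarrow> real"
  assumes f: "decreasing_slopes a b f"
    and D: "\<And>x. a < x \<Longrightarrow> x < b \<Longrightarrow> (f has_real_derivative f' x) (at x)"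
begin

lemma slope_bounds:
  shows "a < x \<Longrightarrow> x < y \<Longrightarrow> y < b \<Longrightarrow> f' y \<le> (f y - f x) / (y - x)"
    and "a < x \<Longrightarrow> x < y \<Longrightarrow> y < b \<Longrightarrow> (f y - f x) / (y - x) \<le> f' x"
  using right_derivative_le_slope[OF f has_field_derivative_at_within[OF D]]
    slope_le_left_derivative[OF f has_field_derivative_at_within[OF D]] by auto

lemma decreasing_slopes_derivative_antimono:
  assumes "a < x" "x \<le> y" "y < b"
  shows "f' y \<le> f' x"
  using slope_bounds[of x y] assms by (cases "x = y") auto

text \<open>
  Near \<open>x\<close> the derivative is squeezed between slopes to a fixed point on either side, and these slopes
  depend continuously on their moving end point.
\<close>

lemma decreasing_slopes_derivative_continuous:
  assumes x: "a < x" "x < b"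
  shows "isCont f' x"
  unfolding isCont_def
proof (rule order_tendstoI)
  have cf: "isCont f x" using D[OF x] DERIV_isCont by blast
  have slopes: "((\<lambda>y. (f y - f x) / (y - x)) \<longlongrightarrow> f' x) (at x)"
    using D[OF x] by (simp add: has_field_derivative_iff)
  fix c assume c: "c < f' x"
  have "\<forall>\<^sub>F y in at_right x. c < (f y - f x) / (y - x)"
    using order_tendstoD(1)[OF slopes c] by (simp add: eventually_at_split)
  moreover have "\<forall>\<^sub>F y in at_right x. y < b" using x(2) by (auto simp: eventually_at_right)
  moreover have "\<forall>\<^sub>F y in at_right x. x < y" by (rule eventually_at_right_less)
  ultimately have "\<forall>\<^sub>F y in at_right x. c < (f y - f x) / (y - x) \<and> y < b \<and> x < y"
    by eventually_elim auto
  then obtain z where z: "c < (f z - f x) / (z - x)" "z < b" "x < z"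
    using eventually_happens[of _ "at_right x"] by force
  have "isCont (\<lambda>y. (f z - f y) / (z - y)) x" using cf z by (intro continuous_intros) auto
  then have "\<forall>\<^sub>F y in at x. c < (f z - f y) / (z - y)"
    using order_tendstoD(1) z(1) unfolding isCont_def by blast
  moreover have "\<forall>\<^sub>F y in at x. y \<in> {a<..<z}"
    by (rule eventually_at_in_open') (use x z in auto)
  ultimately show "\<forall>\<^sub>F y in at x. c < f' y"
  proof eventually_elim
    case (elim y)
    then show ?case using slope_bounds(2)[of y z] z by simp
  qed
next
  have cf: "isCont f x" using D[OF x] DERIV_isCont by blast
  have slopes: "((\<lambda>y. (f y - f x) / (y - x)) \<longlongrightarrow> f' x) (at x)"
    using D[OF x] by (simp add: has_field_derivative_iff)
  fix c assume c: "f' x < c"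
  have "\<forall>\<^sub>F y in at_left x. (f y - f x) / (y - x) < c"
    using order_tendstoD(2)[OF slopes c] by (simp add: eventually_at_split)
  moreover have "\<forall>\<^sub>F y in at_left x. a < y" using x(1) by (auto simp: eventually_at_left)
  moreover have "\<forall>\<^sub>F y in at_left x. y < x" by (simp add: eventually_at_filter)
  ultimately have "\<forall>\<^sub>F y in at_left x. (f y - f x) / (y - x) < c \<and> a < y \<and> y < x"
    by eventually_elim auto
  then obtain z where z: "(f z - f x) / (z - x) < c" "a < z" "z < x"
    using eventually_happens[of _ "at_left x"] by force
  have z': "(f x - f z) / (x - z) < c" using z(1) minus_divide_divide[of "f z - f x" "z - x"] by simp
  have "isCont (\<lambda>y. (f y - f z) / (y - z)) x" using cf z by (intro continuous_intros) auto
  then have "\<forall>\<^sub>F y in at x. (f y - f z) / (y - z) < c"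
    using order_tendstoD(2) z' unfolding isCont_def by blast
  moreover have "\<forall>\<^sub>F y in at x. y \<in> {z<..<b}"
    by (rule eventually_at_in_open') (use x z in auto)
  ultimately show "\<forall>\<^sub>F y in at x. f' y < c"
  proof eventually_elim
    case (elim y)
    then show ?case using slope_bounds(1)[of z y] z by simp
  qed
qed

end

section \<open>Local defining functions of a smooth boundary\<close>

text \<open>
  Here \<open>N\<close> is the gradient of \<open>\<rho>\<close>, an outward normal field along the boundary.
\<close>

definition local_defining_function ::
  "(real ^ 'n) set \<Rightarrow> (real ^ 'n) set \<Rightarrow> (real ^ 'n \<Rightarrow> real) \<Rightarrow> (real ^ 'n \<Rightarrow> real ^ 'n) \<Rightarrow> bool" where
  "local_defining_function \<Omega> U \<rho> N \<longleftrightarrow> open U \<and>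
     (\<forall>y\<in>U. (\<rho> has_derivative (\<lambda>v. N y \<bullet> v)) (at y)) \<and> (\<forall>y\<in>U. N y \<noteq> 0) \<and> (\<forall>k. Ck_on k U N) \<and>
     \<Omega> \<inter> U = {y \<in> U. \<rho> y < 0} \<and> (\<forall>y\<in>frontier \<Omega> \<inter> U. \<rho> y = 0)"

lemma smooth_boundary_local_defining_function:
  fixes \<Omega> :: "(real ^ 'n) set"
  assumes "smooth_boundary \<Omega>" "open \<Omega>" "x \<in> frontier \<Omega>"
  obtains U \<rho> N where "local_defining_function \<Omega> U \<rho> N" "x \<in> U"
proof -
  obtain U and \<rho> :: "real ^ 'n \<Rightarrow> real" where U: "open U" "x \<in> U" and sm: "smooth_on U \<rho>"
    and nz: "\<forall>y\<in>U. \<exists>v. frechet_derivative \<rho> (at y) v \<noteq> 0" and \<Omega>U: "\<Omega> \<inter> U = {y \<in> U. \<rho> y < 0}"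
    using bspec[OF assms(1)[unfolded smooth_boundary_def] assms(3)] by blast
  define N where "N y = (\<Sum>i\<in>Basis. frechet_derivative \<rho> (at y) i *\<^sub>R i)" for y
  have diff: "\<exists>f'. (\<forall>y\<in>U. (\<rho> has_derivative f' y) (at y)) \<and> (\<forall>v. Ck_on k U (\<lambda>y. f' y v))" for k
  proof -
    have "Ck_on (Suc k) U \<rho>" using sm unfolding smooth_on_def by blast
    then obtain f' where f': "\<forall>y\<in>U. (\<rho> has_derivative f' y) (at y within U)" "\<forall>v. Ck_on k U (\<lambda>y. f' y v)"
      by auto
    have "(\<rho> has_derivative f' y) (at y)" if "y \<in> U" for y
      using bspec[OF f'(1) that] unfolding at_within_open[OF that U(1)] .
    then show ?thesis using f'(2) by blast
  qed
  have fd: "(\<rho> has_derivative frechet_derivative \<rho> (at y)) (at y)" if "y \<in> U" for y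
  proof -
    obtain f' where "\<forall>y\<in>U. (\<rho> has_derivative f' y) (at y)" using diff[of 0] by blast
    then have "\<rho> differentiable (at y)" using that differentiableI by blast
    then show ?thesis by (simp only: frechet_derivative_works)
  qed
  have N_inner: "N y \<bullet> v = frechet_derivative \<rho> (at y) v" if "y \<in> U" for y v
  proof -
    interpret bounded_linear "frechet_derivative \<rho> (at y)"
      using fd[OF that] has_derivative_bounded_linear by blast
    have "frechet_derivative \<rho> (at y) v = frechet_derivative \<rho> (at y) (\<Sum>i\<in>Basis. (v \<bullet> i) *\<^sub>R i)"
      by (simp add: euclidean_representation)
    also have "\<dots> = (\<Sum>i\<in>Basis. (v \<bullet> i) * frechet_derivative \<rho> (at y) i)" by (simp add: sum scaleR)
    also have "\<dots> = N y \<bullet> v" by (simp add: N_def inner_sum_left inner_commute[of v] mult.commute)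
    finally show ?thesis ..
  qed
  have "local_defining_function \<Omega> U \<rho> N"
    unfolding local_defining_function_def
  proof (intro conjI ballI allI)
    show "(\<rho> has_derivative (\<lambda>v. N y \<bullet> v)) (at y)" if "y \<in> U" for y
      using fd[OF that] N_inner[OF that] by simp
    show "N y \<noteq> 0" if "y \<in> U" for y using bspec[OF nz that] N_inner[OF that] by force
    show "Ck_on k U N" for k
      unfolding N_def
    proof (intro Ck_on_sum)
      fix i :: "real ^ 'n" assume "i \<in> Basis"
      obtain f' where f': "\<forall>y\<in>U. (\<rho> has_derivative f' y) (at y)" "\<forall>v. Ck_on k U (\<lambda>y. f' y v)"
        using diff by blast
      have "f' y i = frechet_derivative \<rho> (at y) i" if "y \<in> U" for y
        using f'(1) that frechet_derivative_at by metis
      have "Ck_on k U (\<lambda>y. frechet_derivative \<rho> (at y) i)"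
        by (rule Ck_on_cong[OF \<open>\<And>y. y \<in> U \<Longrightarrow> f' y i = frechet_derivative \<rho> (at y) i\<close> f'(2)[rule_format]])
      from Ck_on_bounded_linear[OF bounded_linear_scaleR_left this]
      show "Ck_on k U (\<lambda>y. frechet_derivative \<rho> (at y) i *\<^sub>R i)" .
    qed
    show "\<rho> y = 0" if y: "y \<in> frontier \<Omega> \<inter> U" for y
    proof (rule antisym)
      have "y \<notin> \<Omega>" "y \<in> U" using y assms(2) by (auto simp: frontier_def interior_open)
      then have "\<not> \<rho> y < 0" using \<Omega>U by blast
      then show "0 \<le> \<rho> y" by simp
      show "\<rho> y \<le> 0"
      proof (rule ccontr)
        assume "\<not> \<rho> y \<le> 0"
        have "isCont \<rho> y" using fd y has_derivative_continuous by blast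
        then have "\<forall>\<^sub>F z in nhds y. 0 < \<rho> z"
          using order_tendstoD(1)[of \<rho> "\<rho> y" "at y" 0] \<open>\<not> \<rho> y \<le> 0\<close>
          by (auto simp: eventually_nhds_conv_at isCont_def)
        moreover have "\<forall>\<^sub>F z in nhds y. z \<in> U" using U y by (intro eventually_nhds_in_open) auto
        ultimately have "\<forall>\<^sub>F z in nhds y. z \<notin> \<Omega>" 
        proof eventually_elim
          case (elim z)
          then have "\<not> \<rho> z < 0" by simp
          then show ?case using \<Omega>U elim(2) by blast
        qed
        then obtain V where "open V" "y \<in> V" "\<forall>z\<in>V. z \<notin> \<Omega>" unfolding eventually_nhds by blast
        moreover have "y \<in> closure \<Omega>" using y by (simp add: frontier_def)
        ultimately show False using open_Int_closure_eq_empty[of V \<Omega>] by blast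
      qed
    qed
  qed (fact U(1), fact \<Omega>U)
  then show ?thesis using U(2) by (rule that)
qed

lemma local_defining_function_DERIV:
  assumes "local_defining_function \<Omega> U \<rho> N" "x \<in> U"
  shows "((\<lambda>h. \<rho> (x + h *\<^sub>R v)) has_real_derivative N x \<bullet> v) (at 0)"
proof -
  have d: "((\<lambda>h::real. x + h *\<^sub>R v) has_derivative (\<lambda>h. h *\<^sub>R v)) (at 0)"
    by (auto intro!: derivative_eq_intros)
  have "(\<rho> has_derivative (\<lambda>v. N x \<bullet> v)) (at (x + 0 *\<^sub>R v))"
    using assms unfolding local_defining_function_def by simp
  from has_derivative_compose[OF d this] show ?thesis
    by (simp add: has_real_derivative_iff_has_vector_derivative has_vector_derivative_def)
qed

lemma descent_direction_enters:
  assumes L: "local_defining_function \<Omega> U \<rho> N" and x: "x \<in> frontier \<Omega>" "x \<in> U" and v: "N x \<bullet> v < 0"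
  shows "\<exists>\<sigma>>0. x + \<sigma> *\<^sub>R v \<in> \<Omega>"
proof -
  have \<rho>x: "\<rho> x = 0" using L x unfolding local_defining_function_def by blast
  obtain d where d: "d > 0" "\<And>h. h > 0 \<Longrightarrow> h < d \<Longrightarrow> \<rho> (x + h *\<^sub>R v) < 0"
    using DERIV_neg_dec_right[OF local_defining_function_DERIV[OF L x(2)] v] \<rho>x by auto
  have "((\<lambda>h. x + h *\<^sub>R v) \<longlongrightarrow> x + 0 *\<^sub>R v) (at_right 0)" by (intro tendsto_intros)
  then have "\<forall>\<^sub>F h in at_right 0. x + h *\<^sub>R v \<in> U"
    using L x(2) by (intro topological_tendstoD) (auto simp: local_defining_function_def)
  moreover have "\<forall>\<^sub>F h in at_right 0. h < d" using d(1) by (auto simp: eventually_at_right)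
  moreover have "\<forall>\<^sub>F h in at_right (0::real). 0 < h" by (rule eventually_at_right_less)
  ultimately have "\<forall>\<^sub>F h in at_right 0. x + h *\<^sub>R v \<in> U \<and> h < d \<and> 0 < h" by eventually_elim auto
  then obtain h where h: "x + h *\<^sub>R v \<in> U" "h < d" "0 < h"
    using eventually_happens[of _ "at_right (0::real)"] by force
  then have "x + h *\<^sub>R v \<in> \<Omega>"
    using d(2)[of h] L unfolding local_defining_function_def by blast
  then show ?thesis using h(3) by blast
qed

text \<open>
  Moving \<open>z\<close> slightly along the normal makes a hypothetical inequality \<open>0 \<le> N x \<bullet> (z - x)\<close> strict,
  and then the defining function would increase along a segment that runs inside \<open>\<Omega>\<close>.
\<close>

lemma convex_domain_below_tangent:
  assumes L: "local_defining_function \<Omega> U \<rho> N" and x: "x \<in> frontier \<Omega>" "x \<in> U"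
    and "open \<Omega>" "convex \<Omega>" "z \<in> \<Omega>"
  shows "N x \<bullet> (z - x) < 0"
proof (rule ccontr)
  assume "\<not> ?thesis"
  then have nn: "0 \<le> N x \<bullet> (z - x)" by simp
  have N0: "N x \<noteq> 0" using L x unfolding local_defining_function_def by blast
  obtain e where e: "e > 0" "ball z e \<subseteq> \<Omega>" using \<open>open \<Omega>\<close> \<open>z \<in> \<Omega>\<close> open_contains_ball by blast
  define y where "y = z + (e / (2 * norm (N x))) *\<^sub>R N x"
  have "dist z y < e" using e(1) N0 by (simp add: y_def dist_norm)
  then have y: "y \<in> \<Omega>" using e(2) by auto
  have "N x \<bullet> (y - x) = N x \<bullet> (z - x) + (e / (2 * norm (N x))) * (N x \<bullet> N x)"
    by (simp add: y_def inner_diff_right inner_add_right)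
  also have "\<dots> > 0" using nn e(1) N0 by (intro add_nonneg_pos mult_pos_pos) auto
  finally have pos: "0 < N x \<bullet> (y - x)" .
  have \<rho>x: "\<rho> x = 0" using L x unfolding local_defining_function_def by blast
  obtain d where d: "d > 0" "\<And>h. h > 0 \<Longrightarrow> h < d \<Longrightarrow> \<rho> (x + h *\<^sub>R (y - x)) > 0"
    using DERIV_pos_inc_right[OF local_defining_function_DERIV[OF L x(2)] pos] \<rho>x by auto
  have "((\<lambda>h. x + h *\<^sub>R (y - x)) \<longlongrightarrow> x + 0 *\<^sub>R (y - x)) (at_right 0)" by (intro tendsto_intros)
  then have "\<forall>\<^sub>F h in at_right 0. x + h *\<^sub>R (y - x) \<in> U"
    using L x(2) by (intro topological_tendstoD) (auto simp: local_defining_function_def)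
  moreover have "\<forall>\<^sub>F h in at_right 0. h < min d 1" using d(1) by (auto simp: eventually_at_right intro!: exI[of _ "min d 1"])
  moreover have "\<forall>\<^sub>F h in at_right (0::real). 0 < h" by (rule eventually_at_right_less)
  ultimately have "\<forall>\<^sub>F h in at_right 0. x + h *\<^sub>R (y - x) \<in> U \<and> h < min d 1 \<and> 0 < h" by eventually_elim auto
  then obtain h where h: "x + h *\<^sub>R (y - x) \<in> U" "h < d" "h < 1" "0 < h"
    using eventually_happens[of _ "at_right (0::real)"] by force
  have "x \<in> closure \<Omega>" "x \<notin> \<Omega>" using x(1) \<open>open \<Omega>\<close> by (auto simp: frontier_def interior_open)
  then have "x + h *\<^sub>R (y - x) \<in> open_segment x y"
    using h y by (auto simp: in_segment algebra_simps intro!: exI[of _ h])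
  then have "x + h *\<^sub>R (y - x) \<in> interior \<Omega>"
    using in_interior_closure_convex_segment[OF \<open>convex \<Omega>\<close>, of y x] y \<open>x \<in> closure \<Omega>\<close> \<open>open \<Omega>\<close>
    by (auto simp: open_segment_commute interior_open)
  then have "\<rho> (x + h *\<^sub>R (y - x)) < 0"
    using h(1) L \<open>open \<Omega>\<close> unfolding local_defining_function_def by (auto simp: interior_open)
  then show False using d(2)[OF h(4,2)] by simp
qed

section \<open>Continuous differentiability of minimizers\<close>

context obstacle_minimizer
begin

lemma potential_decreasing_slopes:
  assumes "z \<in> closure \<Omega>"
  shows "decreasing_slopes 0 1 (potential 1 z)"
  unfolding decreasing_slopes_def using potential_concave[OF assms] by blast

text \<open>
  The potentials of two points of \<open>\<Omega>\<close> differ by a coordinate of \<open>u\<close>. Since \<open>\<Omega>\<close> is open, all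
  coordinates arise in this way, and they inherit the one-sided derivatives of concave functions.
\<close>

lemma one_sided_velocity:
  assumes ex: "\<And>z. z \<in> \<Omega> \<Longrightarrow> \<exists>l. (potential 1 z has_real_derivative l) (at t within S)"
  shows "\<exists>w. (u has_vector_derivative w) (at t within S)"
proof -
  obtain z0 where z0: "z0 \<in> \<Omega>" using nonempty by blast
  then obtain e where e: "e > 0" "ball z0 e \<subseteq> \<Omega>" using open_\<Omega> open_contains_ball by blast
  have "\<exists>l. ((\<lambda>s. u s \<bullet> i) has_real_derivative l) (at t within S)" if i: "i \<in> Basis" for i
  proof -
    define z1 where "z1 = z0 + (e / 2) *\<^sub>R i"
    have "dist z0 z1 < e" using e(1) i by (simp add: z1_def dist_norm)
    then have z1: "z1 \<in> \<Omega>" using e(2) by auto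
    obtain l0 l1 where l: "(potential 1 z0 has_real_derivative l0) (at t within S)"
      "(potential 1 z1 has_real_derivative l1) (at t within S)"
      using ex z0 z1 by blast
    have "((\<lambda>s. (potential 1 z0 s - potential 1 z1 s) / (e / 2)) has_real_derivative (l0 - l1) / (e / 2)) (at t within S)"
      by (intro DERIV_cdivide DERIV_diff l)
    moreover have "(\<lambda>s. (potential 1 z0 s - potential 1 z1 s) / (e / 2)) = (\<lambda>s. u s \<bullet> i)"
      using e(1) by (auto simp: potential_def z1_def inner_add_right)
    ultimately show ?thesis by auto
  qed
  then obtain l where l: "\<And>i. i \<in> Basis \<Longrightarrow> ((\<lambda>s. u s \<bullet> i) has_real_derivative l i) (at t within S)"
    by metis
  have "(u has_vector_derivative (\<Sum>i\<in>Basis. l i *\<^sub>R i)) (at t within S)"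
    unfolding has_vector_derivative_def
    by (subst has_derivative_componentwise_within)
       (use l in \<open>simp add: has_real_derivative_iff_has_vector_derivative has_vector_derivative_def
          inner_sum_left inner_Basis if_distrib sum.delta cong: if_cong\<close>)
  then show ?thesis by blast
qed

lemma potential_has_derivative:
  assumes w: "(u has_vector_derivative w) (at t within S)" and t: "t \<in> {0<..<1}"
  shows "(potential c z has_real_derivative w \<bullet> (c *\<^sub>R u t - z) - c * action t) (at t within S)"
proof -
  have 1: "((\<lambda>s. u s \<bullet> u s) has_real_derivative u t \<bullet> w + w \<bullet> u t) (at t within S)"
    unfolding has_real_derivative_iff_has_vector_derivative
    by (rule bounded_bilinear.has_vector_derivative[OF bounded_bilinear_inner w w])
  have 2: "((\<lambda>s. u s \<bullet> z) has_real_derivative w \<bullet> z) (at t within S)"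
    unfolding has_real_derivative_iff_has_vector_derivative
    by (rule bounded_linear.has_vector_derivative[OF bounded_linear_inner_left w])
  have 3: "(iterated_action has_real_derivative action t) (at t within S)"
    by (rule has_field_derivative_at_within[OF iterated_action_has_derivative[OF t]])
  have "((\<lambda>s. c * ((u s \<bullet> u s) / 2 - iterated_action s) - u s \<bullet> z) has_real_derivative
      c * ((u t \<bullet> w + w \<bullet> u t) / 2 - action t) - w \<bullet> z) (at t within S)"
    by (intro DERIV_diff DERIV_cmult DERIV_cdivide 1 2 3)
  moreover have "c * ((u t \<bullet> w + w \<bullet> u t) / 2 - action t) - w \<bullet> z = w \<bullet> (c *\<^sub>R u t - z) - c * action t"
    by (simp add: inner_diff_right inner_commute algebra_simps)
  ultimately show ?thesis unfolding potential_def[abs_def] power2_norm_eq_inner by simp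
qed

lemma right_velocity: "\<exists>w. (u has_vector_derivative w) (at_right t)"
  and left_velocity: "\<exists>w. (u has_vector_derivative w) (at_left t)" if t: "t \<in> {0<..<1}"
proof -
  have *: "decreasing_slopes 0 1 (potential 1 z)" if "z \<in> \<Omega>" for z
    using potential_decreasing_slopes closure_subset that by blast
  show "\<exists>w. (u has_vector_derivative w) (at_right t)"
    by (rule one_sided_velocity, rule decreasing_slopes_right_derivative[OF *]) (use t in auto)
  show "\<exists>w. (u has_vector_derivative w) (at_left t)"
    by (rule one_sided_velocity, rule decreasing_slopes_left_derivative[OF *]) (use t in auto)
qed

text \<open>
  The right derivative of a concave function is at most its left derivative; all terms of the
  potential other than the velocity are continuous and cancel.
\<close>

lemma velocity_jump:
  assumes r: "(u has_vector_derivative wr) (at_right t)" and l: "(u has_vector_derivative wl) (at_left t)"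
    and t: "t \<in> {0<..<1}" and z: "z \<in> closure \<Omega>"
  shows "(wr - wl) \<bullet> (u t - z) \<le> 0"
  using right_derivative_le_left[OF potential_decreasing_slopes[OF z]
      potential_has_derivative[OF r t] potential_has_derivative[OF l t]] t
  by (simp add: inner_diff_left)

text \<open>
  Since \<open>\<rho> \<circ> u\<close> has a minimum at the contact time, the right velocity does not point into \<open>\<Omega>\<close> and the
  left velocity does not point out of it. So the jump does not point into \<open>\<Omega>\<close>, whereas
  \<open>velocity_jump\<close> makes it a multiple of the inward normal; it must vanish.
\<close>

lemma contact_velocity:
  assumes r: "(u has_vector_derivative wr) (at_right t)" and l: "(u has_vector_derivative wl) (at_left t)"
    and t: "t \<in> {0<..<1}" and c: "u t \<in> frontier \<Omega>"
    and L: "local_defining_function \<Omega> U \<rho> N" "u t \<in> U"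
  shows "wr = wl \<and> N (u t) \<bullet> wr = 0"
proof -
  have \<rho>0: "\<rho> (u t) = 0" using L c unfolding local_defining_function_def by blast
  have chain: "((\<lambda>s. \<rho> (u s)) has_real_derivative N (u t) \<bullet> w) (at t within S)"
    if "(u has_vector_derivative w) (at t within S)" for w S
  proof -
    have "(\<rho> has_derivative (\<lambda>v. N (u t) \<bullet> v)) (at (u t))"
      using L unfolding local_defining_function_def by blast
    from has_derivative_compose[OF that[unfolded has_vector_derivative_def] this]
    show ?thesis by (simp add: has_real_derivative_iff_has_vector_derivative has_vector_derivative_def)
  qed
  have nonneg: "\<forall>\<^sub>F s in at t. 0 \<le> \<rho> (u s)"
  proof -
    have "isCont u t"
      using u_continuous t continuous_on_interior[of "{0..1}" u t] by simp
    then have "\<forall>\<^sub>F s in at t. u s \<in> U"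
      using L unfolding isCont_def local_defining_function_def by (auto intro: topological_tendstoD)
    moreover have "\<forall>\<^sub>F s in at t. s \<in> {0<..<1}"
      by (rule eventually_at_in_open') (use t in auto)
    ultimately show ?thesis
    proof eventually_elim
      case (elim s)
      then have "u s \<notin> \<Omega>" by (intro u_avoids) auto
      moreover have "\<Omega> \<inter> U = {y \<in> U. \<rho> y < 0}"
        using L unfolding local_defining_function_def by blast
      ultimately have "\<not> \<rho> (u s) < 0" using elim(1) by blast
      then show ?case by simp
    qed
  qed
  have "0 \<le> N (u t) \<bullet> wr"
  proof (rule tendsto_lowerbound[OF chain[OF r, unfolded has_field_derivative_iff]])
    have "\<forall>\<^sub>F s in at_right t. 0 \<le> \<rho> (u s)" using nonneg by (simp add: eventually_at_split)
    moreover have "\<forall>\<^sub>F s in at_right t. t < s" by (rule eventually_at_right_less)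
    ultimately show "\<forall>\<^sub>F s in at_right t. 0 \<le> (\<rho> (u s) - \<rho> (u t)) / (s - t)"
      by eventually_elim (simp add: \<rho>0)
  qed simp
  moreover have "N (u t) \<bullet> wl \<le> 0"
  proof (rule tendsto_upperbound[OF chain[OF l, unfolded has_field_derivative_iff]])
    have "\<forall>\<^sub>F s in at_left t. 0 \<le> \<rho> (u s)" using nonneg by (simp add: eventually_at_split)
    moreover have "\<forall>\<^sub>F s in at_left t. s < t" by (simp add: eventually_at_filter)
    ultimately show "\<forall>\<^sub>F s in at_left t. (\<rho> (u s) - \<rho> (u t)) / (s - t) \<le> 0"
      by eventually_elim (simp add: \<rho>0 divide_nonneg_neg)
  qed simp
  moreover have "wr - wl = 0"
  proof (rule ccontr)
    assume J: "wr - wl \<noteq> 0"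
    \<comment> \<open>Opposite to the jump and tilted inwards, so that \<open>u t + \<sigma> y\<close> is in \<open>\<Omega>\<close> for small \<open>\<sigma>\<close> and can
      serve as \<open>z\<close>.\<close>
    define y where "y = - (wr - wl) - N (u t)"
    have N0: "N (u t) \<noteq> 0" using L unfolding local_defining_function_def by blast
    have JN: "0 \<le> (wr - wl) \<bullet> N (u t)" using calculation by (simp add: inner_diff_left inner_commute)
    have "N (u t) \<bullet> y = - ((wr - wl) \<bullet> N (u t)) - N (u t) \<bullet> N (u t)"
      by (simp add: y_def inner_diff_right inner_diff_left inner_commute)
    also have "\<dots> < 0"
    proof -
      have "0 < N (u t) \<bullet> N (u t)" using N0 by simp
      then show ?thesis using JN by linarith
    qed
    finally obtain \<sigma> where \<sigma>: "\<sigma> > 0" "u t + \<sigma> *\<^sub>R y \<in> \<Omega>"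
      using descent_direction_enters[OF L(1) c L(2)] by blast
    have "(wr - wl) \<bullet> (u t - (u t + \<sigma> *\<^sub>R y)) \<le> 0"
      using velocity_jump[OF r l t] \<sigma>(2) closure_subset by blast
    then have "0 \<le> \<sigma> * ((wr - wl) \<bullet> y)" by simp
    then have "0 \<le> (wr - wl) \<bullet> y" using \<sigma>(1) by (simp add: zero_le_mult_iff)
    also have "(wr - wl) \<bullet> y = - ((wr - wl) \<bullet> (wr - wl)) - (wr - wl) \<bullet> N (u t)"
      unfolding y_def by (simp only: inner_diff_right inner_minus_right)
    finally have "(wr - wl) \<bullet> (wr - wl) \<le> 0" using JN by linarith
    then show False using J by (simp add: inner_gt_zero_iff not_less[symmetric])
  qed
  ultimately show ?thesis by simp
qed

lemma free_velocity:
  assumes r: "(u has_vector_derivative wr) (at_right t)" and l: "(u has_vector_derivative wl) (at_left t)"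
    and t: "t \<in> {0<..<1}" and free: "u t \<notin> closure \<Omega>"
  shows "wr = wl"
proof -
  have "isCont u t" using u_continuous t continuous_on_interior[of "{0..1}" u t] by simp
  then have "\<forall>\<^sub>F s in nhds t. u s \<in> - closure \<Omega>"
    using topological_tendstoD[of u "u t" "at t" "- closure \<Omega>"] free
    by (auto simp: isCont_def eventually_nhds_conv_at)
  moreover have "\<forall>\<^sub>F s in nhds t. s \<in> {0<..<1}" by (rule eventually_nhds_in_open) (use t in auto)
  ultimately have "\<forall>\<^sub>F s in nhds t. u s \<notin> closure \<Omega> \<and> s \<in> {0<..<1}" by eventually_elim auto
  then obtain d where d: "d > 0" "\<And>s. dist s t < d \<Longrightarrow> u s \<notin> closure \<Omega> \<and> s \<in> {0<..<1}"
    unfolding eventually_nhds_metric by blast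
  define s0 s1 where "s0 = t - d / 2" and "s1 = t + d / 2"
  define v where "v = (1 / (s1 - s0)) *\<^sub>R (u s1 - u s0)"
  have in01: "s0 \<in> {0<..<1}" "s1 \<in> {0<..<1}" "s0 < t" "t < s1"
    using d(2)[of s0] d(2)[of s1] d(1) by (auto simp: s0_def s1_def dist_real_def)
  have aff: "u s = u s0 + (s - s0) *\<^sub>R v" if "s \<in> {s0..s1}" for s
  proof -
    have "u s = u s0 + ((s - s0) / (s1 - s0)) *\<^sub>R (u s1 - u s0)"
    proof (rule free_affine)
      show "u r \<notin> closure \<Omega>" if "r \<in> {s0<..<s1}" for r
        using d(2)[of r] that by (auto simp: s0_def s1_def dist_real_def abs_if)
    qed (use in01 that in auto)
    then show ?thesis by (simp add: v_def)
  qed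
  have "((\<lambda>s. u s0 + (s - s0) *\<^sub>R v) has_vector_derivative v) (at t)"
    by (auto intro!: derivative_eq_intros)
  then have D: "(u has_vector_derivative v) (at t)"
  proof (rule has_vector_derivative_transform_within_open)
    show "open {s0<..<s1}" "t \<in> {s0<..<s1}" using in01 by auto
    show "u s0 + (s - s0) *\<^sub>R v = u s" if "s \<in> {s0<..<s1}" for s
      by (rule aff[symmetric]) (use that in auto)
  qed
  have "wr = v"
    using vector_derivative_unique_within[OF _ r has_vector_derivative_at_within[OF D]] by simp
  moreover have "wl = v"
    using vector_derivative_unique_within[OF _ l has_vector_derivative_at_within[OF D]] by simp
  ultimately show ?thesis by simp
qed

end

locale smooth_obstacle_minimizer = obstacle_minimizer \<Omega> p q u
  for \<Omega> :: "(real ^ 'n) set" and p q u +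
  assumes smooth: "smooth_boundary \<Omega>"
begin

definition velocity where "velocity t = vector_derivative u (at t)"

lemma frontier_iff: "t \<in> {0..1} \<Longrightarrow> u t \<in> frontier \<Omega> \<longleftrightarrow> u t \<in> closure \<Omega>"
  using u_avoids open_\<Omega> by (auto simp: frontier_def interior_open)

lemma velocity:
  assumes t: "t \<in> {0<..<1}"
  shows "(u has_vector_derivative velocity t) (at t)"
proof -
  obtain wr wl where r: "(u has_vector_derivative wr) (at_right t)" and l: "(u has_vector_derivative wl) (at_left t)"
    using right_velocity[OF t] left_velocity[OF t] by blast
  have "wr = wl"
  proof (cases "u t \<in> closure \<Omega>")
    case False
    then show ?thesis using free_velocity[OF r l t] by simp
  next
    case True
    then have c: "u t \<in> frontier \<Omega>" using frontier_iff t by simp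
    obtain U \<rho> N where "local_defining_function \<Omega> U \<rho> N" "u t \<in> U"
      using smooth_boundary_local_defining_function[OF smooth open_\<Omega> c] .
    then show ?thesis using contact_velocity[OF r l t c] by blast
  qed
  then have "(u has_vector_derivative wr) (at t)"
    using r l unfolding has_vector_derivative_def has_derivative_within by (simp add: filterlim_at_split)
  moreover from this have "velocity t = wr" unfolding velocity_def by (rule vector_derivative_at)
  ultimately show ?thesis by simp
qed

lemma velocity_tangent:
  assumes t: "t \<in> {0<..<1}" and "u t \<in> frontier \<Omega>" "local_defining_function \<Omega> U \<rho> N" "u t \<in> U"
  shows "N (u t) \<bullet> velocity t = 0"
proof -
  have "(u has_vector_derivative velocity t) (at_right t)" "(u has_vector_derivative velocity t) (at_left t)"
    by (rule has_vector_derivative_at_within[OF velocity[OF t]])+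
  from contact_velocity[OF this assms] show ?thesis by simp
qed

text \<open>
  The derivative of \<open>potential 1 z\<close>.
\<close>

definition momentum where "momentum z t = velocity t \<bullet> (u t - z) - action t"

lemma potential_momentum:
  assumes "0 < t" "t < 1"
  shows "(potential 1 z has_real_derivative momentum z t) (at t)"
proof -
  have t: "t \<in> {0<..<1}" using assms by simp
  from potential_has_derivative[OF velocity[OF t] t, of 1 z] show ?thesis by (simp add: momentum_def)
qed

lemma momentum_antimono:
  "z \<in> closure \<Omega> \<Longrightarrow> 0 < s \<Longrightarrow> s \<le> t \<Longrightarrow> t < 1 \<Longrightarrow> momentum z t \<le> momentum z s"
  by (rule decreasing_slopes_derivative_antimono[OF potential_decreasing_slopes potential_momentum])

text \<open>
  As in the proof that one-sided velocities exist, each coordinate of the velocity is a multiple of a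
  difference of two momenta, which are derivatives of differentiable concave functions.
\<close>

lemma velocity_continuous: "continuous_on {0<..<1} velocity"
proof -
  have cm: "isCont (momentum z) t" if "z \<in> closure \<Omega>" "t \<in> {0<..<1}" for z t
    using that by (intro decreasing_slopes_derivative_continuous[OF potential_decreasing_slopes potential_momentum]) auto
  obtain z0 where z0: "z0 \<in> \<Omega>" using nonempty by blast
  then obtain e where e: "e > 0" "ball z0 e \<subseteq> \<Omega>" using open_\<Omega> open_contains_ball by blast
  have "isCont velocity t" if t: "t \<in> {0<..<1}" for t
    unfolding isCont_def
  proof (subst tendsto_componentwise_iff, intro ballI)
    fix i :: "real ^ 'n" assume i: "i \<in> Basis"
    define z1 where "z1 = z0 + (e / 2) *\<^sub>R i"
    have "dist z0 z1 < e" using e(1) i by (simp add: z1_def dist_norm)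
    then have z1: "z1 \<in> \<Omega>" using e(2) by auto
    have "isCont (\<lambda>t. (momentum z0 t - momentum z1 t) / (e / 2)) t"
      using e(1) z0 z1 closure_subset by (intro continuous_intros cm t) auto
    moreover have "(\<lambda>t. (momentum z0 t - momentum z1 t) / (e / 2)) = (\<lambda>t. velocity t \<bullet> i)"
      using e(1) by (auto simp: momentum_def z1_def inner_diff_right inner_add_right)
    ultimately have "isCont (\<lambda>t. velocity t \<bullet> i) t" by (simp only:)
    then show "((\<lambda>t. velocity t \<bullet> i) \<longlongrightarrow> velocity t \<bullet> i) (at t)" by (simp add: isCont_def)
  qed
  then show ?thesis by (simp add: continuous_at_imp_continuous_on)
qed

end

section \<open>The acceleration on the contact set\<close>

lemma has_vector_derivative_iff_slope:
  fixes f :: "real \<Rightarrow> 'a::euclidean_space"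
  shows "(f has_vector_derivative d) (at s within S) \<longleftrightarrow>
    ((\<lambda>t. (1 / (t - s)) *\<^sub>R (f t - f s)) \<longlongrightarrow> d) (at s within S)"
proof -
  have "((\<lambda>x. f x \<bullet> i) has_derivative (\<lambda>x. (x *\<^sub>R d) \<bullet> i)) (at s within S) \<longleftrightarrow>
      ((\<lambda>t. ((1 / (t - s)) *\<^sub>R (f t - f s)) \<bullet> i) \<longlongrightarrow> d \<bullet> i) (at s within S)" for i
  proof -
    have "((\<lambda>x. f x \<bullet> i) has_derivative (\<lambda>x. (x *\<^sub>R d) \<bullet> i)) (at s within S) \<longleftrightarrow>
       ((\<lambda>x. f x \<bullet> i) has_real_derivative d \<bullet> i) (at s within S)"
      by (simp add: has_real_derivative_iff_has_vector_derivative has_vector_derivative_def)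
    also have "\<dots> \<longleftrightarrow> ((\<lambda>t. ((1 / (t - s)) *\<^sub>R (f t - f s)) \<bullet> i) \<longlongrightarrow> d \<bullet> i) (at s within S)"
      by (simp add: has_field_derivative_iff inner_diff_left)
    finally show ?thesis .
  qed
  then show ?thesis
    unfolding has_vector_derivative_def
    by (subst has_derivative_componentwise_within, subst tendsto_componentwise_iff) simp
qed

text \<open>
  Freezing a function outside \<open>[s, t]\<close> makes it a primitive on the whole unit interval, as needed to
  compare densities of which only one is known to be integrable up to the ends.
\<close>

lemma has_density_clamp:
  fixes F f :: "real \<Rightarrow> 'a::euclidean_space"
  assumes st: "0 \<le> s" "s \<le> t" "t \<le> 1" and int: "set_integrable lborel {s..t} f"
    and incr: "\<And>r. r \<in> {s..t} \<Longrightarrow> (LINT x:{s..r}|lborel. f x) = F r - F s"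
  shows "has_density (\<lambda>r. F (max s (min t r))) (\<lambda>r. indicat_real {s..t} r *\<^sub>R f r)"
  unfolding has_density_def
proof (intro conjI ballI)
  have "indicat_real {0..1} x *\<^sub>R indicat_real {s..t} x *\<^sub>R f x = indicat_real {s..t} x *\<^sub>R f x" for x
    using st by (auto simp: indicator_def)
  then show "set_integrable lborel {0..1} (\<lambda>r. indicat_real {s..t} r *\<^sub>R f r)"
    using int unfolding set_integrable_def by (simp only:)
  fix r :: real assume r: "r \<in> {0..1}"
  show "(LINT x:{0..r}|lborel. indicat_real {s..t} x *\<^sub>R f x) = F (max s (min t r)) - F (max s (min t 0))"
  proof (cases "r < s")
    case True
    have "(LINT x:{0..r}|lborel. indicat_real {s..t} x *\<^sub>R f x) = (LINT x|(lborel :: real measure). (0 :: 'a))"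
      unfolding set_lebesgue_integral_def using True
      by (intro Bochner_Integration.integral_cong) (auto simp: indicator_def)
    then show ?thesis using True st r by (simp add: max_def min_def)
  next
    case False
    have "(LINT x:{0..r}|lborel. indicat_real {s..t} x *\<^sub>R f x) = (LINT x:{s..min t r}|lborel. f x)"
      unfolding set_lebesgue_integral_def using False st
      by (intro Bochner_Integration.integral_cong) (auto simp: indicator_def)
    also have "\<dots> = F (min t r) - F s" using False st by (intro incr) auto
    finally show ?thesis using False st r by (simp add: max_def)
  qed
qed

context smooth_obstacle_minimizer
begin

text \<open>
  The weak velocity and the classical velocity are two densities of the curve frozen outside \<open>[s, t]\<close>,
  so they agree almost everywhere.
\<close>

lemma action_increment:
  assumes st: "0 < s" "s \<le> t" "t < 1"
  shows "action t - action s = (LINT r:{s..t}|lborel. (norm (velocity r))\<^sup>2)"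
proof -
  have cv: "continuous_on {s..t} velocity"
    by (rule continuous_on_subset[OF velocity_continuous]) (use st in auto)
  have vi: "set_integrable lborel {s..r} velocity" if "r \<in> {s..t}" for r
    by (rule borel_integrable_atLeastAtMost', rule continuous_on_subset[OF cv]) (use that in auto)
  have gi: "set_integrable lborel {0..1} weak_velocity" using u_density unfolding has_density_def by blast
  have g: "has_density (\<lambda>r. u (max s (min t r))) (\<lambda>r. indicat_real {s..t} r *\<^sub>R weak_velocity r)"
  proof (rule has_density_clamp)
    show "set_integrable lborel {s..t} weak_velocity" by (rule set_integrable_Icc_subset[OF gi]) (use st in auto)
    show "(LINT x:{s..r}|lborel. weak_velocity x) = u r - u s" if "r \<in> {s..t}" for r
      using has_density_increment[OF u_density, of s r] that st by simp
  qed (use st in auto)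
  have v: "has_density (\<lambda>r. u (max s (min t r))) (\<lambda>r. indicat_real {s..t} r *\<^sub>R velocity r)"
  proof (rule has_density_clamp)
    show "set_integrable lborel {s..t} velocity" by (rule vi) (use st in auto)
    show "(LINT x:{s..r}|lborel. velocity x) = u r - u s" if r: "r \<in> {s..t}" for r
    proof -
      have "(velocity has_integral (u r - u s)) {s..r}"
        by (rule fundamental_theorem_of_calculus)
           (use r st in \<open>auto intro!: has_vector_derivative_at_within velocity\<close>)
      then show ?thesis using set_borel_integral_eq_integral(2)[OF vi[OF r]] integral_unique by metis
    qed
  qed (use st in auto)
  have ae: "AE r in lborel. r \<in> {0..1} \<longrightarrow> indicat_real {s..t} r *\<^sub>R weak_velocity r = indicat_real {s..t} r *\<^sub>R velocity r"
    by (rule has_density_unique_AE[OF g v])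
  have i1: "set_integrable lborel {s..t} (\<lambda>r. (norm (weak_velocity r))\<^sup>2)"
  proof (rule set_integrable_Icc_subset)
    show "set_integrable lborel {0..1} (\<lambda>r. (norm (weak_velocity r))\<^sup>2)" using weak_velocity_L2 unfolding L2_I_def by simp
  qed (use st in auto)
  have i2: "set_integrable lborel {s..t} (\<lambda>r. (norm (velocity r))\<^sup>2)"
    by (intro borel_integrable_atLeastAtMost' continuous_intros cv)
  have "action t - action s = (LINT r:{s..t}|lborel. (norm (weak_velocity r))\<^sup>2)"
    using has_density_increment[OF action_density, of s t] st by simp
  also have "\<dots> = (LINT r:{s..t}|lborel. (norm (velocity r))\<^sup>2)"
    unfolding set_lebesgue_integral_def
  proof (rule integral_cong_AE)
    show "(\<lambda>r. indicat_real {s..t} r *\<^sub>R (norm (weak_velocity r))\<^sup>2) \<in> borel_measurable lborel"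
      using i1 unfolding set_integrable_def by (rule borel_measurable_integrable)
    show "(\<lambda>r. indicat_real {s..t} r *\<^sub>R (norm (velocity r))\<^sup>2) \<in> borel_measurable lborel"
      using i2 unfolding set_integrable_def by (rule borel_measurable_integrable)
    show "AE r in lborel. indicat_real {s..t} r *\<^sub>R (norm (weak_velocity r))\<^sup>2 = indicat_real {s..t} r *\<^sub>R (norm (velocity r))\<^sup>2"
      using ae
    proof eventually_elim
      case (elim r)
      show ?case
      proof (cases "r \<in> {s..t}")
        case True
        then have "weak_velocity r = velocity r" using elim st by simp
        then show ?thesis by simp
      qed simp
    qed
  qed
  finally show ?thesis .
qed

lemma action_has_derivative:
  assumes t: "t \<in> {0<..<1}"
  shows "(action has_real_derivative (norm (velocity t))\<^sup>2) (at t)"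
proof -
  define s0 s1 where "s0 = t / 2" and "s1 = (t + 1) / 2"
  have s: "0 < s0" "s0 < t" "t < s1" "s1 < 1" using t by (auto simp: s0_def s1_def)
  have cv: "continuous_on {s0..s1} (\<lambda>r. (norm (velocity r))\<^sup>2)"
    by (intro continuous_intros continuous_on_subset[OF velocity_continuous]) (use s in auto)
  have "((\<lambda>r. integral {s0..r} (\<lambda>r. (norm (velocity r))\<^sup>2)) has_real_derivative (norm (velocity t))\<^sup>2) (at t within {s0..s1})"
    using s by (intro integral_has_real_derivative cv) auto
  then have "((\<lambda>r. action s0 + integral {s0..r} (\<lambda>r. (norm (velocity r))\<^sup>2)) has_real_derivative (norm (velocity t))\<^sup>2) (at t within {s0..s1})"
    using DERIV_add[OF DERIV_const] by fastforce
  moreover have "at t within {s0..s1} = at t" using s by (intro at_within_interior) auto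
  ultimately have D: "((\<lambda>r. action s0 + integral {s0..r} (\<lambda>r. (norm (velocity r))\<^sup>2)) has_real_derivative (norm (velocity t))\<^sup>2) (at t)"
    by simp
  have eq: "action s0 + integral {s0..r} (\<lambda>r. (norm (velocity r))\<^sup>2) = action r" if "r \<in> {s0<..<s1}" for r
  proof -
    have "set_integrable lborel {s0..r} (\<lambda>r. (norm (velocity r))\<^sup>2)"
      by (rule borel_integrable_atLeastAtMost', rule continuous_on_subset[OF cv]) (use that in auto)
    from set_borel_integral_eq_integral(2)[OF this] show ?thesis
      using action_increment[of s0 r] that s by simp
  qed
  show ?thesis
    using has_vector_derivative_transform_within_open[OF D[unfolded has_real_derivative_iff_has_vector_derivative], of "{s0<..<s1}" action]
      eq s by (simp add: has_real_derivative_iff_has_vector_derivative)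
qed

text \<open>
  The hypothesis on \<open>h\<close> asks for a derivative of the normal along the curve. It determines the normal
  component of the acceleration, by differentiating \<open>N (u t) \<bullet> velocity t = 0\<close>. That there is no
  tangential component is the content of the monotonicity of the momenta: they give a one-sided bound on
  \<open>D \<bullet> y\<close> for every inward direction \<open>y\<close>, and inward directions come arbitrarily close to every
  tangential direction and its opposite.
\<close>

lemma velocity_has_derivative_on_contact:
  assumes ab: "0 < a" "b < 1" and contact: "\<And>t. t \<in> {a..b} \<Longrightarrow> u t \<in> frontier \<Omega>" and s: "s \<in> {a..b}"
    and L: "local_defining_function \<Omega> U \<rho> N" "u s \<in> U"
    and h: "((\<lambda>r. N (u r)) has_vector_derivative h) (at s within {a..b})"
  shows "(velocity has_vector_derivative
      (- (velocity s \<bullet> h) / (N (u s) \<bullet> N (u s))) *\<^sub>R N (u s)) (at s within {a..b})"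
proof -
  let ?F = "at s within {a..b}"
  let ?D = "\<lambda>t. (1 / (t - s)) *\<^sub>R (velocity t - velocity s)"
  define n where "n = N (u s)"
  define \<kappa> where "\<kappa> = - (velocity s \<bullet> h)"
  have n: "n \<noteq> 0" using L unfolding local_defining_function_def n_def by blast
  have in01: "t \<in> {0<..<1}" if "t \<in> {a..b}" for t using that ab by auto
  have tangent: "N (u t) \<bullet> velocity t = 0" if "t \<in> {a..b}" "u t \<in> U" for t
    by (rule velocity_tangent[OF in01[OF that(1)] contact[OF that(1)] L(1) that(2)])
  have nv: "velocity s \<bullet> n = 0" using tangent[OF s L(2)] by (simp add: n_def inner_commute)
  have inF: "\<forall>\<^sub>F t in ?F. t \<in> {a..b} \<and> t \<noteq> s" by (simp add: eventually_at_filter)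
  have vs: "(velocity \<longlongrightarrow> velocity s) ?F"
  proof -
    have "continuous_on {a..b} velocity"
      by (rule continuous_on_subset[OF velocity_continuous]) (use ab in auto)
    then show ?thesis using s unfolding continuous_on_def by blast
  qed
  have us: "((\<lambda>t. (1 / (t - s)) *\<^sub>R (u t - u s)) \<longlongrightarrow> velocity s) ?F"
    using has_vector_derivative_at_within[OF velocity[OF in01[OF s]]] by (simp only: has_vector_derivative_iff_slope)
  have inU: "\<forall>\<^sub>F t in ?F. u t \<in> U"
  proof -
    have "continuous_on {a..b} u"
      by (rule continuous_on_subset[OF u_continuous]) (use ab in auto)
    then have "(u \<longlongrightarrow> u s) ?F" using s unfolding continuous_on_def by blast
    then show ?thesis using L unfolding local_defining_function_def by (auto intro: topological_tendstoD)
  qed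
  have normal: "((\<lambda>t. ?D t \<bullet> n) \<longlongrightarrow> \<kappa>) ?F"
  proof -
    have "((\<lambda>t. - (velocity t \<bullet> ((1 / (t - s)) *\<^sub>R (N (u t) - N (u s))))) \<longlongrightarrow> \<kappa>) ?F"
      unfolding \<kappa>_def
      by (intro tendsto_minus tendsto_inner vs) (use h in \<open>simp only: has_vector_derivative_iff_slope\<close>)
    moreover have "\<forall>\<^sub>F t in ?F. - (velocity t \<bullet> ((1 / (t - s)) *\<^sub>R (N (u t) - N (u s)))) = ?D t \<bullet> n"
      using inU inF
    proof eventually_elim
      case (elim t)
      then have "velocity t \<bullet> N (u t) = 0" using tangent by (simp add: inner_commute)
      then show ?case using nv by (simp add: n_def inner_diff_right inner_diff_left)
    qed
    ultimately show ?thesis by (rule Lim_transform_eventually)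
  qed
  \<comment> \<open>The error term in the monotonicity of the momentum. Its two parts have the same limit
    \<open>\<bar>velocity s\<bar>\<^sup>2\<close>.\<close>
  define R where "R t = (action t - action s) / (t - s) - velocity t \<bullet> ((1 / (t - s)) *\<^sub>R (u t - u s))" for t
  have R: "(R \<longlongrightarrow> 0) ?F"
  proof -
    have "((\<lambda>t. (action t - action s) / (t - s)) \<longlongrightarrow> (norm (velocity s))\<^sup>2) ?F"
      using has_field_derivative_at_within[OF action_has_derivative[OF in01[OF s]]]
      by (simp only: has_field_derivative_iff)
    then have "(R \<longlongrightarrow> (norm (velocity s))\<^sup>2 - velocity s \<bullet> velocity s) ?F"
      unfolding R_def by (intro tendsto_diff tendsto_inner vs us)
    then show ?thesis by (simp add: power2_norm_eq_inner)
  qed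
  have bound: "?D t \<bullet> (u s - z) \<le> R t" if t: "t \<in> {a..b}" "t \<noteq> s" and z: "z \<in> closure \<Omega>" for t z
  proof -
    have "(momentum z t - momentum z s) / (t - s) \<le> 0"
      using momentum_antimono[OF z, of s t] momentum_antimono[OF z, of t s] in01[OF s] in01[OF t(1)] t(2)
      by (cases "s < t") (auto simp: divide_nonpos_pos divide_nonneg_neg)
    moreover have "momentum z t - momentum z s =
       (velocity t - velocity s) \<bullet> (u s - z) + velocity t \<bullet> (u t - u s) - (action t - action s)"
      by (simp add: momentum_def inner_diff_left inner_diff_right)
    moreover have "((velocity t - velocity s) \<bullet> (u s - z) + velocity t \<bullet> (u t - u s) - (action t - action s)) / (t - s)
       = ?D t \<bullet> (u s - z) - R t"
      by (simp add: R_def add_divide_distrib diff_divide_distrib)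
    ultimately show ?thesis by simp
  qed
  have inward: "\<forall>\<^sub>F t in ?F. - e < ?D t \<bullet> y" if y: "n \<bullet> y < 0" and e: "e > 0" for y e
  proof -
    obtain \<sigma> where \<sigma>: "\<sigma> > 0" "u s + \<sigma> *\<^sub>R y \<in> \<Omega>"
      using descent_direction_enters[OF L(1) contact[OF s] L(2)] y unfolding n_def by blast
    have z: "u s + \<sigma> *\<^sub>R y \<in> closure \<Omega>" using \<sigma>(2) closure_subset by blast
    have "\<forall>\<^sub>F t in ?F. R t < \<sigma> * e" using order_tendstoD(2)[OF R, of "\<sigma> * e"] \<sigma>(1) e by simp
    then show ?thesis using inF
    proof eventually_elim
      case (elim t)
      have "- (\<sigma> * (?D t \<bullet> y)) \<le> R t" using bound[of t, OF _ _ z] elim(2) by simp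
      then have "- (\<sigma> * (?D t \<bullet> y)) < \<sigma> * e" using elim(1) by linarith
      then have "\<sigma> * (- e) < \<sigma> * (?D t \<bullet> y)" by simp
      then show ?case using \<sigma>(1) mult_less_cancel_left_pos by blast
    qed
  qed
  have half: "\<forall>\<^sub>F t in ?F. - e < ?D t \<bullet> y" if y: "n \<bullet> y = 0" and e: "e > 0" for y e
  proof -
    \<comment> \<open>Tilting \<open>y\<close> inwards by \<open>\<epsilon> n\<close> costs at most \<open>\<epsilon> (\<bar>\<kappa>\<bar> + 1)\<close>, which is half of \<open>e\<close>.\<close>
    define \<epsilon> where "\<epsilon> = e / (2 * (\<bar>\<kappa>\<bar> + 1))"
    have \<epsilon>: "\<epsilon> > 0" using e by (simp add: \<epsilon>_def divide_pos_pos)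
    have "n \<bullet> (y - \<epsilon> *\<^sub>R n) < 0" using y \<epsilon> n by (simp add: inner_diff_right)
    from inward[OF this, of "e / 2"] e have "\<forall>\<^sub>F t in ?F. - (e / 2) < ?D t \<bullet> (y - \<epsilon> *\<^sub>R n)" by simp
    moreover have "\<forall>\<^sub>F t in ?F. - (\<bar>\<kappa>\<bar> + 1) < ?D t \<bullet> n"
      by (rule order_tendstoD(1)[OF normal]) linarith
    ultimately show ?thesis
    proof eventually_elim
      case (elim t)
      have "\<epsilon> * (- (\<bar>\<kappa>\<bar> + 1)) < \<epsilon> * (?D t \<bullet> n)" using elim(2) \<epsilon> by (rule mult_strict_left_mono)
      moreover have "\<epsilon> * (- (\<bar>\<kappa>\<bar> + 1)) = - (e / 2)" by (simp add: \<epsilon>_def field_simps)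
      moreover have "?D t \<bullet> (y - \<epsilon> *\<^sub>R n) = ?D t \<bullet> y - \<epsilon> * (?D t \<bullet> n)"
        by (simp only: inner_diff_right inner_scaleR_right)
      ultimately show ?case using elim(1) by linarith
    qed
  qed
  have tangential: "((\<lambda>t. ?D t \<bullet> y) \<longlongrightarrow> 0) ?F" if y: "n \<bullet> y = 0" for y
  proof (rule order_tendstoI)
    fix e :: real assume "e < 0"
    then show "\<forall>\<^sub>F t in ?F. e < ?D t \<bullet> y" using half[OF y, of "- e"] by simp
  next
    fix e :: real assume "0 < e"
    then show "\<forall>\<^sub>F t in ?F. ?D t \<bullet> y < e" using half[of "- y" e] y by simp
  qed
  have "(?D \<longlongrightarrow> (\<kappa> / (n \<bullet> n)) *\<^sub>R n) ?F"
  proof (subst tendsto_componentwise_iff, intro ballI)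
    fix i :: "real ^ 'n"
    define c where "c = (i \<bullet> n) / (n \<bullet> n)"
    have "n \<bullet> (i - c *\<^sub>R n) = 0" using n by (simp add: c_def inner_diff_right inner_commute)
    from tendsto_add[OF tangential[OF this] tendsto_mult[OF tendsto_const[of c] normal]]
    have "((\<lambda>t. ?D t \<bullet> (i - c *\<^sub>R n) + c * (?D t \<bullet> n)) \<longlongrightarrow> c * \<kappa>) ?F" by simp
    moreover have "?D t \<bullet> (i - c *\<^sub>R n) + c * (?D t \<bullet> n) = ?D t \<bullet> i" for t
      by (simp only: inner_diff_right inner_scaleR_right)
    moreover have "c * \<kappa> = ((\<kappa> / (n \<bullet> n)) *\<^sub>R n) \<bullet> i" by (simp add: c_def inner_commute)
    ultimately show "((\<lambda>t. ?D t \<bullet> i) \<longlongrightarrow> ((\<kappa> / (n \<bullet> n)) *\<^sub>R n) \<bullet> i) ?F" by (simp only:)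
  qed
  then show ?thesis
    unfolding has_vector_derivative_iff_slope by (simp only: n_def \<kappa>_def)
qed

end

section \<open>Smoothness along the contact set\<close>

lemma Ck_on_subset: "Ck_on k S f \<Longrightarrow> T \<subseteq> S \<Longrightarrow> Ck_on k T f"
proof (induction k arbitrary: f)
  case 0
  then show ?case using continuous_on_subset by auto
next
  case (Suc k)
  then obtain f' where f': "\<forall>x\<in>S. (f has_derivative f' x) (at x within S)" "\<forall>v. Ck_on k S (\<lambda>x. f' x v)"
    by auto
  have "\<forall>x\<in>T. (f has_derivative f' x) (at x within T)"
    using f'(1) Suc.prems(2) has_derivative_subset by (metis subsetD)
  moreover have "\<forall>v. Ck_on k T (\<lambda>x. f' x v)" using Suc.IH f'(2) Suc.prems(2) by metis
  ultimately show ?case unfolding Ck_on.simps by metis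
qed

lemma Ck_on_inner:
  fixes f g :: "'a::real_normed_vector \<Rightarrow> 'b::euclidean_space"
  assumes "Ck_on k S f" "Ck_on k S g"
  shows "Ck_on k S (\<lambda>x. f x \<bullet> g x)"
  by (subst euclidean_inner)
     (intro Ck_on_sum Ck_on_mult Ck_on_bounded_linear[OF bounded_linear_inner_left] assms)

context smooth_obstacle_minimizer
begin

context
  fixes a b
  assumes ab: "0 < a" "a < b" "b < 1" and contact: "\<And>t. t \<in> {a..b} \<Longrightarrow> u t \<in> frontier \<Omega>"
begin

definition acceleration where "acceleration t = vector_derivative velocity (at t within {a..b})"

lemma velocity_within: "t \<in> {a..b} \<Longrightarrow> (u has_vector_derivative velocity t) (at t within S)"
  by (rule has_vector_derivative_at_within[OF velocity]) (use ab in auto)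

text \<open>
  One step of the bootstrap: if the velocity is of class \<open>C\<^sup>k\<close>, then \<open>N \<circ> u\<close> is of class \<open>C\<^sup>k\<^sup>+\<^sup>1\<close>, its
  derivative \<open>h\<close> is of class \<open>C\<^sup>k\<close>, and the formula for the acceleration contains nothing worse.
\<close>

lemma acceleration_local:
  assumes Ck: "Ck_on k {a..b} velocity" and t: "t \<in> {a..b}"
    and L: "local_defining_function \<Omega> U \<rho> N" "u t \<in> U"
  shows "\<exists>T. open T \<and> t \<in> T \<and> Ck_on k ({a..b} \<inter> T) acceleration \<and>
     (velocity has_vector_derivative acceleration t) (at t within {a..b}) \<and> (\<exists>c. acceleration t = c *\<^sub>R N (u t))"
proof -
  have "open U" using L unfolding local_defining_function_def by blast
  moreover have "continuous_on {a..b} u"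
    by (rule continuous_on_subset[OF u_continuous]) (use ab in auto)
  ultimately obtain T where T: "open T" "T \<inter> {a..b} = u -` U \<inter> {a..b}"
    unfolding continuous_on_open_invariant by blast
  define S where "S = {a..b} \<inter> T"
  have uS: "u ` S \<subseteq> U" "t \<in> T" using T(2) t L(2) unfolding S_def by blast+
  have wS: "at r within S = at r within {a..b}" if "r \<in> S" for r
    using that T(1) unfolding S_def by (intro at_within_nhd[of r T]) auto
  have ckv: "Ck_on k S velocity" by (rule Ck_on_subset[OF Ck]) (simp add: S_def)
  have "Ck_on (Suc k) S u"
    by (rule Ck_on_vector_derivativeI[OF _ ckv]) (use velocity_within in \<open>simp add: S_def\<close>)
  moreover have ckN: "Ck_on j U N" for j using L(1) unfolding local_defining_function_def by blast
  ultimately have "Ck_on (Suc k) S (\<lambda>r. N (u r))" using Ck_on_compose[OF uS(1)] by blast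
  then obtain h where h: "\<And>r. r \<in> S \<Longrightarrow> ((\<lambda>r. N (u r)) has_vector_derivative h r) (at r within S)"
    and ckh: "Ck_on k S h"
    using Ck_on_Suc_vector_derivativeE by metis
  have ckNu: "Ck_on k S (\<lambda>r. N (u r))" using \<open>Ck_on (Suc k) S (\<lambda>r. N (u r))\<close> by (rule Ck_on_Suc_D)
  define A where "A r = (- (velocity r \<bullet> h r) / (N (u r) \<bullet> N (u r))) *\<^sub>R N (u r)" for r
  have D: "(velocity has_vector_derivative A r) (at r within {a..b})" if r: "r \<in> S" for r
    unfolding A_def
  proof (rule velocity_has_derivative_on_contact[OF ab(1,3) contact _ L(1)])
    show "((\<lambda>r. N (u r)) has_vector_derivative h r) (at r within {a..b})"
      using h[OF r] unfolding wS[OF r] .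
  qed (use r uS S_def in auto)
  have eq: "A r = acceleration r" if r: "r \<in> S" for r
    unfolding acceleration_def
    by (rule vector_derivative_within_closed_interval[OF ab(2) _ D[OF r], symmetric]) (use r S_def in auto)
  have nz: "N (u r) \<bullet> N (u r) \<noteq> 0" if "r \<in> S" for r
    using that uS(1) L(1) unfolding local_defining_function_def by (auto simp: inner_eq_zero_iff)
  have "Ck_on k S A"
    unfolding A_def divide_inverse
    by (intro Ck_on_scaleR Ck_on_mult Ck_on_inverse nz Ck_on_inner
        Ck_on_bounded_linear[OF bounded_linear_minus[OF bounded_linear_ident]] ckv ckh ckNu)
  with eq have ca: "Ck_on k S acceleration" by (rule Ck_on_cong)
  have tS: "t \<in> S" using t uS(2) by (simp add: S_def)
  have "(velocity has_vector_derivative acceleration t) (at t within {a..b})" using D[OF tS] eq[OF tS] by simp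
  moreover have "\<exists>c. acceleration t = c *\<^sub>R N (u t)" using eq[OF tS] unfolding A_def by metis
  ultimately show ?thesis using T(1) uS(2) ca unfolding S_def by (intro exI[of _ T] conjI)
qed

lemma velocity_has_acceleration:
  assumes Ck: "Ck_on k {a..b} velocity" and t: "t \<in> {a..b}"
  shows "\<exists>T. open T \<and> t \<in> T \<and> Ck_on k ({a..b} \<inter> T) acceleration"
    and "(velocity has_vector_derivative acceleration t) (at t within {a..b})"
proof -
  obtain U \<rho> N where "local_defining_function \<Omega> U \<rho> N" "u t \<in> U"
    using smooth_boundary_local_defining_function[OF smooth open_\<Omega> contact[OF t]] .
  from acceleration_local[OF Ck t this]
  show "\<exists>T. open T \<and> t \<in> T \<and> Ck_on k ({a..b} \<inter> T) acceleration"
    "(velocity has_vector_derivative acceleration t) (at t within {a..b})"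
    by blast+
qed

lemma velocity_Ck: "Ck_on k {a..b} velocity"
proof (induction k)
  case 0
  have "continuous_on {a..b} velocity"
    by (rule continuous_on_subset[OF velocity_continuous]) (use ab in auto)
  then show ?case by simp
next
  case (Suc k)
  have "Ck_on k {a..b} acceleration" by (rule Ck_on_interval_local[OF ab(2) velocity_has_acceleration(1)[OF Suc]])
  from Ck_on_vector_derivativeI[OF velocity_has_acceleration(2)[OF Suc] this] show ?case .
qed

text \<open>
  The acceleration is a multiple of \<open>N\<close>, and \<open>N\<close> is orthogonal to tangent vectors because \<open>\<rho>\<close> vanishes
  along every curve in the boundary.
\<close>

lemma contact_geodesic: "geodesic_on (frontier \<Omega>) a b u"
  unfolding geodesic_on_def
proof (intro conjI ballI)
  show "smooth_on {a..b} u"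
    unfolding smooth_on_def
  proof
    fix k
    have "Ck_on (Suc k) {a..b} u"
      by (rule Ck_on_vector_derivativeI[OF velocity_within velocity_Ck])
    then show "Ck_on k {a..b} u" by (rule Ck_on_Suc_D)
  qed
  fix t v assume t: "t \<in> {a..b}" and v: "v \<in> tangent_space_at (frontier \<Omega>) (u t)"
  obtain U \<rho> N where L: "local_defining_function \<Omega> U \<rho> N" "u t \<in> U"
    using smooth_boundary_local_defining_function[OF smooth open_\<Omega> contact[OF t]] .
  obtain c where c: "acceleration t = c *\<^sub>R N (u t)" and
    D: "(velocity has_vector_derivative acceleration t) (at t within {a..b})"
    using acceleration_local[OF velocity_Ck[of 0] t L] by blast
  have inner: "velocity s = vector_derivative u (at s within {a..b})" if "s \<in> {a..b}" for s
    by (rule vector_derivative_within_closed_interval[OF ab(2) that velocity_within[OF that], symmetric])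
  have "((\<lambda>s. vector_derivative u (at s within {a..b})) has_vector_derivative acceleration t) (at t within {a..b})"
    by (rule has_vector_derivative_transform[OF t _ D]) (use inner in simp)
  from vector_derivative_within_closed_interval[OF ab(2) t this]
  have acc_eq: "vector_derivative (\<lambda>s. vector_derivative u (at s within {a..b})) (at t within {a..b}) = acceleration t" .
  obtain e \<gamma> where \<gamma>: "e > 0" "\<And>s. s \<in> {-e<..<e} \<Longrightarrow> \<gamma> s \<in> frontier \<Omega>" "\<gamma> 0 = u t"
    "(\<gamma> has_vector_derivative v) (at 0)"
    using v unfolding tangent_space_at_def by blast
  have "N (u t) \<bullet> v = 0"
  proof -
    have "(\<rho> has_derivative (\<lambda>v. N (u t) \<bullet> v)) (at (\<gamma> 0))"
      using L \<gamma>(3) unfolding local_defining_function_def by simp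
    from has_derivative_compose[OF \<gamma>(4)[unfolded has_vector_derivative_def] this]
    have 1: "((\<lambda>s. \<rho> (\<gamma> s)) has_real_derivative N (u t) \<bullet> v) (at 0)"
      by (simp add: has_real_derivative_iff_has_vector_derivative has_vector_derivative_def)
    have "isCont \<gamma> 0" using \<gamma>(4) has_vector_derivative_continuous by blast
    then have "\<forall>\<^sub>F s in at 0. \<gamma> s \<in> U"
      using L \<gamma>(3) unfolding isCont_def local_defining_function_def by (auto intro: topological_tendstoD)
    then have "\<forall>\<^sub>F s in nhds 0. \<gamma> s \<in> U" using L(2) \<gamma>(3) by (simp add: eventually_nhds_conv_at)
    moreover have "\<forall>\<^sub>F s in nhds 0. s \<in> {-e<..<e}"
      by (rule eventually_nhds_in_open) (use \<gamma>(1) in auto)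
    ultimately have "\<forall>\<^sub>F s in nhds 0. \<rho> (\<gamma> s) = 0"
    proof eventually_elim
      case (elim s)
      then have "\<gamma> s \<in> frontier \<Omega> \<inter> U" using \<gamma>(2) by blast
      then show ?case using L(1) unfolding local_defining_function_def by blast
    qed
    then have "((\<lambda>s. \<rho> (\<gamma> s)) has_real_derivative 0) (at 0)"
      using DERIV_cong_ev[OF refl _ refl, of "\<lambda>s. \<rho> (\<gamma> s)" "\<lambda>s. 0" 0 0] by simp
    with 1 show ?thesis by (rule DERIV_unique)
  qed
  then show "vector_derivative (\<lambda>s. vector_derivative u (at s within {a..b})) (at t within {a..b}) \<bullet> v = 0"
    unfolding acc_eq c by simp
qed (use ab contact in auto)

end

section \<open>The shape of a minimizer\<close>

text \<open>
  A ray that touches the boundary tangentially stays in the tangent plane, and \<open>\<Omega>\<close> lies strictly on one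
  side of that plane.
\<close>

lemma tangent_point_in_vision_boundary:
  assumes x: "x \<in> frontier \<Omega>" and L: "local_defining_function \<Omega> U \<rho> N" "x \<in> U"
    and o: "o' \<notin> closure \<Omega>" and tan: "N x \<bullet> (x - o') = 0"
  shows "x \<in> vision_boundary \<Omega> o'"
proof -
  have xc: "x \<in> closure \<Omega>" using x by (simp add: frontier_def)
  have "x \<in> ray o' (x - o')" unfolding ray_def by (auto intro!: exI[of _ 1])
  moreover have "ray o' (x - o') \<inter> \<Omega> = {}"
  proof (rule ccontr)
    assume "ray o' (x - o') \<inter> \<Omega> \<noteq> {}"
    then obtain s where "o' + s *\<^sub>R (x - o') \<in> \<Omega>" unfolding ray_def by blast
    then have "N x \<bullet> (o' + s *\<^sub>R (x - o') - x) < 0"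
      by (rule convex_domain_below_tangent[OF L(1) x L(2) open_\<Omega> convex_\<Omega>])
    moreover have "o' + s *\<^sub>R (x - o') - x = (s - 1) *\<^sub>R (x - o')" by (simp add: algebra_simps)
    ultimately show False using tan by simp
  qed
  moreover have "x - o' \<noteq> 0" using xc o by auto
  ultimately have "x \<in> vision_cone \<Omega> o'" unfolding vision_cone_def using xc by blast
  then show ?thesis using x by (simp add: vision_boundary_def)
qed

lemma shape:
  assumes p: "p \<notin> closure \<Omega>" and q: "q \<notin> closure \<Omega>" and pq: "closed_segment p q \<inter> \<Omega> \<noteq> {}"
  shows "\<exists>a b. 0 < a \<and> a < b \<and> b < 1 \<and>
           u a \<in> vision_boundary \<Omega> p \<and> u b \<in> vision_boundary \<Omega> q \<and>
           (\<forall>t\<in>{0..a}. u t = linepath p (u a) (t / a)) \<and>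
           geodesic_on (frontier \<Omega>) a b u \<and>
           (\<forall>t\<in>{b..1}. u t = linepath (u b) q ((t - b) / (1 - b)))"
proof -
  define K where "K = {t \<in> {0..1}. u t \<in> closure \<Omega>}"
  have "closed K"
  proof -
    have "K = {0..1} \<inter> u -` closure \<Omega>" by (auto simp: K_def)
    then show ?thesis using continuous_closed_preimage[OF u_continuous] by simp
  qed
  have Kne: "K \<noteq> {}"
  proof
    assume "K = {}"
    then have "u r = u 0 + ((r - 0) / (1 - 0)) *\<^sub>R (u 1 - u 0)" if "r \<in> {0..1}" for r
      using that by (intro free_affine) (auto simp: K_def)
    then have aff: "u r = p + r *\<^sub>R (q - p)" if "r \<in> {0..1}" for r using that u_0 u_1 by simp
    obtain x where x: "x \<in> closed_segment p q" "x \<in> \<Omega>" using pq by blast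
    obtain r where r: "r \<in> {0..1}" "x = (1 - r) *\<^sub>R p + r *\<^sub>R q"
      using x(1) by (auto simp: in_segment)
    have "x = u r" unfolding r(2) aff[OF r(1)] by (simp add: algebra_simps)
    then show False using x(2) u_avoids[OF r(1)] by simp
  qed
  have Kb: "bdd_below K" "bdd_above K" unfolding K_def by (auto intro!: bdd_belowI[of _ 0] bdd_aboveI[of _ 1])
  define a b where "a = Inf K" and "b = Sup K"
  have aK: "a \<in> K" unfolding a_def by (rule closed_contains_Inf[OF Kne Kb(1) \<open>closed K\<close>])
  have bK: "b \<in> K" unfolding b_def by (rule closed_contains_Sup[OF Kne Kb(2) \<open>closed K\<close>])
  have Kab: "a \<le> t" "t \<le> b" if "t \<in> K" for t
    using that Kb by (auto simp: a_def b_def intro: cInf_lower cSup_upper)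
  have a0: "0 < a" using aK p u_0 by (auto simp: K_def less_le)
  have b1: "b < 1" using bK q u_1 by (auto simp: K_def less_le)
  have ab: "a \<le> b" using Kab(1)[OF bK] .
  have left: "u t = p + (t / a) *\<^sub>R (u a - p)" if "t \<in> {0..a}" for t
  proof -
    have "u t = u 0 + ((t - 0) / (a - 0)) *\<^sub>R (u a - u 0)"
    proof (rule free_affine)
      show "u r \<notin> closure \<Omega>" if "r \<in> {0<..<a}" for r using Kab(1)[of r] that ab b1 by (auto simp: K_def)
    qed (use a0 ab b1 that in auto)
    then show ?thesis using u_0 by simp
  qed
  have right: "u t = u b + ((t - b) / (1 - b)) *\<^sub>R (q - u b)" if "t \<in> {b..1}" for t
  proof -
    have "u t = u b + ((t - b) / (1 - b)) *\<^sub>R (u 1 - u b)"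
    proof (rule free_affine)
      show "u r \<notin> closure \<Omega>" if "r \<in> {b<..<1}" for r using Kab(2)[of r] that ab a0 by (auto simp: K_def)
    qed (use a0 ab b1 that in auto)
    then show ?thesis using u_1 by simp
  qed
  have contact: "u t \<in> frontier \<Omega>" if t: "t \<in> {a..b}" for t
  proof -
    have "u t \<in> closure \<Omega>"
    proof (rule ccontr)
      assume free: "u t \<notin> closure \<Omega>"
      \<comment> \<open>The component of the free set that contains \<open>t\<close>.\<close>
      define s where "s = Sup (K \<inter> {..t})"
      define r where "r = Inf (K \<inter> {t..})"
      have ne: "K \<inter> {..t} \<noteq> {}" "K \<inter> {t..} \<noteq> {}" using aK bK t by auto
      have bd: "bdd_above (K \<inter> {..t})" "bdd_below (K \<inter> {t..})" using Kb by (auto intro: bdd_above_mono bdd_below_mono)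
      have "s \<in> K \<inter> {..t}" unfolding s_def
        by (rule closed_contains_Sup[OF ne(1) bd(1)]) (use \<open>closed K\<close> in auto)
      moreover have "r \<in> K \<inter> {t..}" unfolding r_def
        by (rule closed_contains_Inf[OF ne(2) bd(2)]) (use \<open>closed K\<close> in auto)
      moreover have "t \<notin> K" using free by (simp add: K_def)
      ultimately have sr: "s \<in> K" "r \<in> K" "s < t" "t < r" by (auto simp: less_le)
      have gap: "x \<notin> K" if "x \<in> {s<..<r}" for x
      proof
        assume "x \<in> K"
        show False
        proof (cases "x \<le> t")
          case True
          then have "x \<le> s" unfolding s_def using \<open>x \<in> K\<close> bd by (intro cSup_upper) auto
          then show False using that by simp
        next
          case False
          then have "r \<le> x" unfolding r_def using \<open>x \<in> K\<close> bd by (intro cInf_lower) auto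
          then show False using that by simp
        qed
      qed
      have "u t = u s + ((t - s) / (r - s)) *\<^sub>R (u r - u s)"
      proof (rule free_affine)
        show "u x \<notin> closure \<Omega>" if "x \<in> {s<..<r}" for x
          using gap[OF that] that sr by (auto simp: K_def)
      qed (use sr in \<open>auto simp: K_def\<close>)
      then have "u t = (1 - (t - s) / (r - s)) *\<^sub>R u s + ((t - s) / (r - s)) *\<^sub>R u r"
        by (simp add: algebra_simps)
      then have "u t \<in> closed_segment (u s) (u r)"
        using sr unfolding in_segment by (intro exI[of _ "(t - s) / (r - s)"]) auto
      moreover have "closed_segment (u s) (u r) \<subseteq> closure \<Omega>"
        using sr convex_\<Omega> by (intro closed_segment_subset convex_closure) (auto simp: K_def)
      ultimately show False using free by blast
    qed
    then show ?thesis using frontier_iff[of t] t a0 b1 by simp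
  qed
  have va: "velocity a = (1 / a) *\<^sub>R (u a - p)"
  proof -
    have "((\<lambda>t. p + (t / a) *\<^sub>R (u a - p)) has_vector_derivative (1 / a) *\<^sub>R (u a - p)) (at a within {0..a})"
      using a0 by (auto intro!: derivative_eq_intros)
    then have "(u has_vector_derivative (1 / a) *\<^sub>R (u a - p)) (at a within {0..a})"
    proof (rule has_vector_derivative_transform[rotated 2])
      show "u t = p + (t / a) *\<^sub>R (u a - p)" if "t \<in> {0..a}" for t by (rule left[OF that])
    qed (use a0 in simp)
    moreover have "(u has_vector_derivative velocity a) (at a within {0..a})"
      by (rule has_vector_derivative_at_within[OF velocity]) (use a0 ab b1 in auto)
    moreover have "at a within {0..a} \<noteq> bot" using a0 by (simp add: trivial_limit_within)
    ultimately show ?thesis using vector_derivative_unique_within by metis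
  qed
  have vb: "velocity b = (1 / (1 - b)) *\<^sub>R (q - u b)"
  proof -
    have "((\<lambda>t. u b + ((t - b) / (1 - b)) *\<^sub>R (q - u b)) has_vector_derivative (1 / (1 - b)) *\<^sub>R (q - u b)) (at b within {b..1})"
      using b1 by (auto intro!: derivative_eq_intros)
    then have "(u has_vector_derivative (1 / (1 - b)) *\<^sub>R (q - u b)) (at b within {b..1})"
    proof (rule has_vector_derivative_transform[rotated 2])
      show "u t = u b + ((t - b) / (1 - b)) *\<^sub>R (q - u b)" if "t \<in> {b..1}" for t by (rule right[OF that])
    qed (use b1 in simp)
    moreover have "(u has_vector_derivative velocity b) (at b within {b..1})"
      by (rule has_vector_derivative_at_within[OF velocity]) (use a0 ab b1 in auto)
    moreover have "at b within {b..1} \<noteq> bot" using b1 by (simp add: trivial_limit_within)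
    ultimately show ?thesis using vector_derivative_unique_within by metis
  qed
  have ca: "u a \<in> frontier \<Omega>" and cb: "u b \<in> frontier \<Omega>" using contact ab by auto
  obtain Ua \<rho>a Na where La: "local_defining_function \<Omega> Ua \<rho>a Na" "u a \<in> Ua"
    using smooth_boundary_local_defining_function[OF smooth open_\<Omega> ca] .
  obtain Ub \<rho>b Nb where Lb: "local_defining_function \<Omega> Ub \<rho>b Nb" "u b \<in> Ub"
    using smooth_boundary_local_defining_function[OF smooth open_\<Omega> cb] .
  have "Na (u a) \<bullet> velocity a = 0" by (rule velocity_tangent[OF _ ca La]) (use a0 ab b1 in auto)
  then have ta: "Na (u a) \<bullet> (u a - p) = 0" using va a0 by simp
  have "Nb (u b) \<bullet> velocity b = 0" by (rule velocity_tangent[OF _ cb Lb]) (use a0 ab b1 in auto)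
  then have tb: "Nb (u b) \<bullet> (q - u b) = 0" using vb b1 by simp
  then have tb': "Nb (u b) \<bullet> (u b - q) = 0" by (simp add: inner_diff_right)
  have "a < b"
  proof (rule ccontr)
    assume "\<not> a < b"
    then have eq: "a = b" using ab by simp
    obtain x where x: "x \<in> closed_segment p q" "x \<in> \<Omega>" using pq by blast
    then obtain r where r: "x = (1 - r) *\<^sub>R p + r *\<^sub>R q" by (auto simp: in_segment)
    define v where "v = velocity a"
    have pv: "p = u a - a *\<^sub>R v" unfolding v_def va using a0 by simp
    have qv: "q = u a + (1 - a) *\<^sub>R v" unfolding v_def eq vb using b1 by simp
    \<comment> \<open>The two straight pieces form one line through \<open>u a\<close>, which contains the segment from \<open>p\<close> to \<open>q\<close>.\<close>
    have "x - u a = (r - a) *\<^sub>R v" unfolding r by (subst pv, subst qv) (simp add: algebra_simps)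
    moreover have "Na (u a) \<bullet> v = 0" unfolding v_def va using ta by simp
    ultimately have "Na (u a) \<bullet> (x - u a) = 0" by simp
    then show False
      using convex_domain_below_tangent[OF La(1) ca La(2) open_\<Omega> convex_\<Omega> x(2)] by simp
  qed
  show ?thesis
  proof (rule exI[of _ a], rule exI[of _ b], intro conjI ballI)
    show "u a \<in> vision_boundary \<Omega> p" by (rule tangent_point_in_vision_boundary[OF ca La p ta])
    show "u b \<in> vision_boundary \<Omega> q" by (rule tangent_point_in_vision_boundary[OF cb Lb q tb'])
    show "u t = linepath p (u a) (t / a)" if "t \<in> {0..a}" for t
      using left[OF that] by (simp add: linepath_def algebra_simps)
    show "u t = linepath (u b) q ((t - b) / (1 - b))" if "t \<in> {b..1}" for t
      using right[OF that] by (simp add: linepath_def algebra_simps)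
    show "geodesic_on (frontier \<Omega>) a b u"
      by (rule contact_geodesic[OF a0 \<open>a < b\<close> b1 contact])
  qed (use a0 b1 \<open>a < b\<close> in auto)
qed

end

theorem theorem1p4:
  fixes \<Omega> :: "(real ^ 'n) set" and p q :: "real ^ 'n" and u :: "real \<Rightarrow> real ^ 'n"
  assumes "CARD('n) \<ge> 2"
    and "open \<Omega>" and "connected \<Omega>" and "\<Omega> \<noteq> {}" and "bounded \<Omega>" and "convex \<Omega>"
    and "smooth_boundary \<Omega>"
    and "p \<notin> closure \<Omega>" and "q \<notin> closure \<Omega>"
    and "closed_segment p q \<inter> \<Omega> \<noteq> {}"
    and "is_minimizer \<Omega> p q u"
  shows "\<exists>a b. 0 < a \<and> a < b \<and> b < 1 \<and>
           u a \<in> vision_boundary \<Omega> p \<and> u b \<in> vision_boundary \<Omega> q \<and>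
           (\<forall>t\<in>{0..a}. u t = linepath p (u a) (t / a)) \<and>
           geodesic_on (frontier \<Omega>) a b u \<and>
           (\<forall>t\<in>{b..1}. u t = linepath (u b) q ((t - b) / (1 - b)))"
proof -
  interpret smooth_obstacle_minimizer \<Omega> p q u
    by unfold_locales (use assms in auto)
  show ?thesis by (rule shape[OF assms(8-10)])
qed

end
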